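(* Let $d\ge 3$. For $n\ge 1$, let $\mathsf{P}^d_n$ denote the uniform probability distribution on the set $\mathcal{T}^d_n$ of black-rooted well-charged $d$-regular blossoming trees of charge $0$ with $n$ black vertices. Then the sequence $(\mathsf{P}^d_n)_{n\ge1}$ converges weakly, with respect to the local topology on $\overline{\mathcal{T}}^d$, to a limiting probability measure $\mathsf{P}^d_\infty$ supported on the set of infinite $d$-regular well-charged blossoming trees with a single spine.
   Context: Blossoming trees. A blossoming tree is a plane tree, endowed with one of its two proper 2-colorings of vertices in black and white, in which each corner may carry some dangling half-edges; a half-edge attached to a black vertex is called an opening stem, one attached to a white vertex a closing stem. The degree of a vertex counts both its incident tree edges and its incident stems; the tree is $d$-regular if all vertices have degree $d$. A rooted tree has a distinguished root corner (a pair of consecutive half-edges, stems included, around the root vertex); it is black-rooted if the root vertex is black. The height of a vertex is its distance to the root vertex. The charge of a finite blossoming tree is its number of closing stems minus its number of opening stems; in a rooted finite tree $\mathrm{t}$ the charge $\mathrm{c}_{\mathrm{t}}(v)$ of a vertex $v$ is the charge of the subtree of $\mathrm{t}$ rooted at $v$ (consisting of $v$ and its descendants). A finite rooted blossoming tree is well-charged if every black vertex has charge at most $1$ and every white vertex has charge at least $0$. $\mathcal{T}^d_n$ is the set of finite black-rooted well-charged $d$-regular trees of charge $0$ with $n$ black vertices, and $\mathcal{T}^d=\bigsqcup_{n\ge1}\mathcal{T}^d_n$. Local topology. For $\mathrm{t}\in\mathcal{T}^d$, $B_R(\mathrm{t})$ consists of the vertices of height at most $R$, with the edges having an extremity of height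 at most $R-1$ and the stems attached to vertices of height at most $R-1$, rooted as $\mathrm{t}$. Set $\mathrm{d}_{\mathrm{loc}}(\mathrm{t},\mathrm{t}')=\bigl(1+\sup\{R\ge0:B_R(\mathrm{t})=B_R(\mathrm{t}')\}\bigr)^{-1}$. $\overline{\mathcal{T}}^d$ is the completion of $(\mathcal{T}^d,\mathrm{d}_{\mathrm{loc}})$, a Polish space; elements of $\overline{\mathcal{T}}^d\setminus\mathcal{T}^d$ are called infinite $d$-regular blossoming trees. A spine of a tree is an infinite (self-avoiding) path starting at its root vertex. Charges in infinite trees. A charge function on an infinite tree $T\in\overline{\mathcal{T}}^d$ with root vertex $\varnothing_T$ is a function $\mathrm{c}$ from the vertices of $T$ to $\mathbb{Z}$ with $\mathrm{c}(\varnothing_T)=0$ and, for every vertex $v$, $\mathrm{c}(v)=n_{\mathrm{cl}}(v)-n_{\mathrm{op}}(v)+\sum_{u}\mathrm{c}(u)$, where $n_{\mathrm{cl}}(v),n_{\mathrm{op}}(v)$ are the numbers of closing and opening stems at $v$ and the sum is over the children $u$ of $v$. If $T$ has a single spine, it has a unique charge function, and $T$ is called well-charged if this function satisfies $\mathrm{c}(v)\le 1$ for all black $v$ and $\mathrm{c}(v)\ge 0$ for all white $v$. "Supported on a set" means that the measure gives this set full mass. *)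

theory Defs
  imports "HOL-Probability.Probability"
begin

datatype colour = Black | White

datatype 'a half_edge = Stem | Edge 'a

text \<open>
  A plane tree rooted at a corner is the same as an ordered tree: the half-edges around the root
  are listed starting from the root corner, those around any other vertex are listed
  starting after (and excluding) the half-edge that leads to its parent. A listed half-edge is either
  a stem or the edge to a child. The type contains infinite, locally finite trees, and colours are
  arbitrary here; properness is the predicate \<open>properly_coloured\<close> below.
\<close>

codatatype btree = Vertex (colour: colour) (halves: "btree half_edge list")

text \<open>Vertices are addressed by the list of half-edge indices leading to them from the root;
  \<open>[]\<close> is the root and the height of a vertex is the length of its address.\<close>

fun subtree_at :: "btree \<Rightarrow> nat list \<Rightarrow> btree option" where
  "subtree_at t [] = Some t"
| "subtree_at t (i # v) =
     (if i < length (halves t)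
      then (case halves t ! i of Stem \<Rightarrow> None | Edge u \<Rightarrow> subtree_at u v)
      else None)"

definition verts :: "btree \<Rightarrow> nat list set" where
  "verts t = {v. subtree_at t v \<noteq> None}"

definition subtree :: "btree \<Rightarrow> nat list \<Rightarrow> btree" where
  "subtree t v = the (subtree_at t v)"

definition children :: "btree \<Rightarrow> nat list \<Rightarrow> nat list set" where
  "children t v = {u \<in> verts t. \<exists>i. u = v @ [i]}"

abbreviation colour_at :: "btree \<Rightarrow> nat list \<Rightarrow> colour" where
  "colour_at t v \<equiv> colour (subtree t v)"

definition properly_coloured :: "btree \<Rightarrow> bool" where
  "properly_coloured t \<longleftrightarrow>
     (\<forall>v\<in>verts t. \<forall>u\<in>children t v. colour_at t u \<noteq> colour_at t v)"

definition degree :: "btree \<Rightarrow> nat list \<Rightarrow> nat" where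
  "degree t v = length (halves (subtree t v)) + (if v = [] then 0 else 1)"

definition regular :: "nat \<Rightarrow> btree \<Rightarrow> bool" where
  "regular d t \<longleftrightarrow> (\<forall>v\<in>verts t. degree t v = d)"

definition num_stems :: "btree \<Rightarrow> nat list \<Rightarrow> nat" where
  "num_stems t v = count_list (halves (subtree t v)) Stem"

definition num_opening :: "btree \<Rightarrow> nat list \<Rightarrow> nat" where
  "num_opening t v = (if colour_at t v = Black then num_stems t v else 0)"

definition num_closing :: "btree \<Rightarrow> nat list \<Rightarrow> nat" where
  "num_closing t v = (if colour_at t v = White then num_stems t v else 0)"

definition charge :: "btree \<Rightarrow> int" where
  "charge t = int (\<Sum>v\<in>verts t. num_closing t v) - int (\<Sum>v\<in>verts t. num_opening t v)"

definition charges_bounded :: "btree \<Rightarrow> (nat list \<Rightarrow> int) \<Rightarrow> bool" where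
  "charges_bounded t c \<longleftrightarrow>
     (\<forall>v\<in>verts t. (colour_at t v = Black \<longrightarrow> c v \<le> 1) \<and> (colour_at t v = White \<longrightarrow> c v \<ge> 0))"

definition well_charged :: "btree \<Rightarrow> bool" where
  "well_charged t \<longleftrightarrow> charges_bounded t (\<lambda>v. charge (subtree t v))"

definition trees_n :: "nat \<Rightarrow> nat \<Rightarrow> btree set" where
  "trees_n d n =
     {t. properly_coloured t \<and> finite (verts t) \<and> colour t = Black \<and> well_charged t \<and>
         regular d t \<and> charge t = 0 \<and> card {v \<in> verts t. colour_at t v = Black} = n}"

definition trees :: "nat \<Rightarrow> btree set" where
  "trees d = (\<Union>n\<in>{1..}. trees_n d n)"

text \<open>The ball of radius \<open>R\<close>: vertices of height \<open>R\<close> are kept, but stripped of their stems and of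
  the edges to their children.\<close>

primrec tree_ball :: "nat \<Rightarrow> btree \<Rightarrow> btree" where
  "tree_ball 0 t = Vertex (colour t) []"
| "tree_ball (Suc R) t = Vertex (colour t) (map (map_half_edge (tree_ball R)) (halves t))"

lemma colour_tree_ball [simp]: "colour (tree_ball R t) = colour t"
  by (cases R) auto

lemma tree_ball_tree_ball: "tree_ball R (tree_ball S t) = tree_ball (min R S) t"
proof (induction R arbitrary: S t)
  case (Suc R)
  show ?case
    by (cases S) (auto simp: Suc.IH half_edge.map_comp o_def)
qed auto

lemma tree_ball_eq_mono: "tree_ball S s = tree_ball S t \<Longrightarrow> R \<le> S \<Longrightarrow> tree_ball R s = tree_ball R t"
  using tree_ball_tree_ball[of R S s] tree_ball_tree_ball[of R S t] by (simp add: min_def split: if_splits)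

lemma btree_eq_if_tree_balls_eq:
  assumes "\<And>R. tree_ball R s = tree_ball R t"
  shows "s = t"
  using assms
proof (coinduction arbitrary: s t rule: btree.coinduct)
  case (Eq_btree s t)
  have col: "colour s = colour t"
    using Eq_btree[rule_format, of 0] by simp
  have m: "map (map_half_edge (tree_ball R)) (halves s) = map (map_half_edge (tree_ball R)) (halves t)" for R
    using Eq_btree[rule_format, of "Suc R"] by simp
  have len: "length (halves s) = length (halves t)"
    using m[of 0] map_eq_imp_length_eq by blast
  have nth: "map_half_edge (tree_ball R) (halves s ! i) = map_half_edge (tree_ball R) (halves t ! i)"
    if "i < length (halves s)" for i R
    using arg_cong[OF m[of R], of "\<lambda>l. l ! i"] that len by simp
  have "rel_half_edge (\<lambda>s t. \<forall>R. tree_ball R s = tree_ball R t) (halves s ! i) (halves t ! i)"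
    if "i < length (halves s)" for i
    using nth[OF that] by (cases "halves s ! i"; cases "halves t ! i") auto
  with col len show ?case
    by (simp add: list_all2_conv_all_nth)
qed

text \<open>The supremum is infinite iff all balls agree.\<close>

definition d_loc :: "btree \<Rightarrow> btree \<Rightarrow> real" where
  "d_loc s t =
     (if \<forall>R. tree_ball R s = tree_ball R t then 0
      else inverse (1 + real (Sup {R. tree_ball R s = tree_ball R t})))"

lemma d_loc_less_iff: "d_loc s t < inverse (1 + real R) \<longleftrightarrow> tree_ball (Suc R) s = tree_ball (Suc R) t"
proof (cases "\<forall>R. tree_ball R s = tree_ball R t")
  case True
  then show ?thesis by (simp add: d_loc_def)
next
  case False
  define A where "A = {R. tree_ball R s = tree_ball R t}"
  from False obtain N where N: "tree_ball N s \<noteq> tree_ball N t" by blast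
  have bd: "k < N" if "k \<in> A" for k
    using that N tree_ball_eq_mono[of k s t N] unfolding A_def by (cases "k < N") auto
  then have fin: "finite A" by (meson bounded_nat_set_is_finite)
  have "d_loc s t < inverse (1 + real R) \<longleftrightarrow> R < Sup A"
    unfolding d_loc_def if_not_P[OF False] A_def[symmetric] by (simp add: field_simps)
  also have "\<dots> \<longleftrightarrow> Suc R \<in> A"
  proof
    assume "R < Sup A"
    then have "A \<noteq> {}" by auto
    then have "Sup A \<in> A" using fin by (simp add: Sup_nat_def)
    with \<open>R < Sup A\<close> show "Suc R \<in> A"
      unfolding A_def using tree_ball_eq_mono[of "Sup A" s t "Suc R"] by (simp add: A_def)
  next
    assume "Suc R \<in> A"
    then have "Suc R \<le> Sup A" using fin by (intro cSup_upper) auto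
    then show "R < Sup A" by simp
  qed
  finally show ?thesis by (simp add: A_def)
qed

lemma d_loc_nonneg: "d_loc s t \<ge> 0"
  by (simp add: d_loc_def)

lemma d_loc_commute: "d_loc s t = d_loc t s"
proof -
  have "(\<lambda>R. tree_ball R s = tree_ball R t) = (\<lambda>R. tree_ball R t = tree_ball R s)" by (auto simp: fun_eq_iff)
  then show ?thesis unfolding d_loc_def by (rule arg_cong)
qed

lemma d_loc_eq_0_iff: "d_loc s t = 0 \<longleftrightarrow> s = t"
proof
  assume "d_loc s t = 0"
  then have "\<forall>R. tree_ball R s = tree_ball R t"
    by (auto simp: d_loc_def split: if_splits)
  then show "s = t" using btree_eq_if_tree_balls_eq by blast
qed (simp add: d_loc_def)

lemma d_loc_values: "d_loc s t = 0 \<or> (\<exists>R. d_loc s t = inverse (1 + real R))"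
  unfolding d_loc_def by auto

lemma d_loc_ultrametric: "d_loc s u \<le> max (d_loc s t) (d_loc t u)"
proof (rule ccontr)
  assume "\<not> ?thesis"
  then have lt: "d_loc s t < d_loc s u" "d_loc t u < d_loc s u" by auto
  then obtain R where R: "d_loc s u = inverse (1 + real R)"
    using d_loc_values[of s u] d_loc_nonneg[of s t] by auto
  from lt have "tree_ball (Suc R) s = tree_ball (Suc R) u"
    unfolding R d_loc_less_iff by simp
  then have "d_loc s u < inverse (1 + real R)" unfolding d_loc_less_iff .
  with R show False by simp
qed

instantiation btree :: metric_space
begin

definition dist_btree :: "btree \<Rightarrow> btree \<Rightarrow> real" where
  "dist_btree = d_loc"

definition uniformity_btree :: "(btree \<times> btree) filter" where
  "uniformity_btree = (INF e\<in>{0<..}. principal {(x, y). dist x y < e})"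

definition open_btree :: "btree set \<Rightarrow> bool" where
  "open_btree U \<longleftrightarrow> (\<forall>x\<in>U. eventually (\<lambda>(x', y). x' = x \<longrightarrow> y \<in> U) uniformity)"

instance
proof
  fix x y z :: btree
  show "dist x y = 0 \<longleftrightarrow> x = y" by (simp add: dist_btree_def d_loc_eq_0_iff)
  show "dist x y \<le> dist x z + dist y z"
    using d_loc_ultrametric[of x y z] d_loc_nonneg[of x z] d_loc_nonneg[of z y]
    by (auto simp: dist_btree_def d_loc_commute[of y z])
qed (simp_all add: uniformity_btree_def open_btree_def)

end

text \<open>The space of all trees is complete, so the closure of a set of trees is its completion.\<close>

primcorec limit_tree :: "(nat \<Rightarrow> btree) \<Rightarrow> btree" where
  "colour (limit_tree y) = colour (y 0)"
| "halves (limit_tree y) =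
     map (map_half_edge limit_tree)
       (map (\<lambda>i. map_half_edge (\<lambda>_ R. case halves (y (Suc R)) ! i of Edge u \<Rightarrow> u | Stem \<Rightarrow> y 0)
                   (halves (y 1) ! i))
         [0..<length (halves (y 1))])"

lemma tree_ball_limit_tree:
  assumes "\<And>R S. R \<le> S \<Longrightarrow> tree_ball R (y S) = tree_ball R (y R)"
  shows "tree_ball R (limit_tree y) = tree_ball R (y R)"
  using assms
proof (induction R arbitrary: y)
  case 0
  then show ?case by simp
next
  case (Suc R)
  have col: "colour (y S) = colour (y 0)" for S
    using Suc.prems[of 0 S] by simp
  have m: "map (map_half_edge (tree_ball k)) (halves (y S)) = map (map_half_edge (tree_ball k)) (halves (y (Suc k)))"
    if "Suc k \<le> S" for k S
    using Suc.prems[OF that] by simp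
  have len: "length (halves (y S)) = length (halves (y 1))" if "1 \<le> S" for S
    using m[of 0 S] that by (metis One_nat_def length_map)
  have nth: "map_half_edge (tree_ball k) (halves (y S) ! i) =
             map_half_edge (tree_ball k) (halves (y (Suc k)) ! i)"
    if "Suc k \<le> S" "i < length (halves (y 1))" for k S i
    using arg_cong[OF m[OF that(1)], of "\<lambda>l. l ! i"] that len[of S] len[of "Suc k"] by simp
  have len_lim: "length (halves (limit_tree y)) = length (halves (y 1))" by simp
  have "map_half_edge (tree_ball R) (halves (limit_tree y) ! i) =
        map_half_edge (tree_ball R) (halves (y (Suc R)) ! i)" if i: "i < length (halves (y 1))" for i
  proof (cases "halves (y 1) ! i")
    case Stem
    then have "halves (y (Suc R)) ! i = Stem"
      using nth[of 0 "Suc R" i] i by (cases "halves (y (Suc R)) ! i") auto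
    with Stem i show ?thesis by simp
  next
    case (Edge u)
    define z where "z = (\<lambda>R. case halves (y (Suc R)) ! i of Edge u \<Rightarrow> u | Stem \<Rightarrow> y 0)"
    have z: "halves (y (Suc S)) ! i = Edge (z S)" for S
      using nth[of 0 "Suc S" i] i Edge unfolding z_def by (cases "halves (y (Suc S)) ! i") auto
    have "tree_ball R (z S) = tree_ball R (z R)" if "R \<le> S" for R S
      using nth[of R "Suc S" i] that i by (simp add: z)
    then have "tree_ball R (limit_tree z) = tree_ball R (z R)" by (rule Suc.IH)
    with Edge i show ?thesis by (simp add: z flip: z_def)
  qed
  then have "map (map_half_edge (tree_ball R)) (halves (limit_tree y)) =
             map (map_half_edge (tree_ball R)) (halves (y (Suc R)))"
    using len[of "Suc R"] by (intro nth_equalityI) (simp_all del: limit_tree.simps(2) add: len_lim)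
  then show ?case
    using col[of "Suc R"] by simp
qed

instance btree :: complete_space
proof
  fix X :: "nat \<Rightarrow> btree"
  assume X: "Cauchy X"
  have "\<exists>N. \<forall>m\<ge>N. \<forall>n\<ge>N. tree_ball (Suc R) (X m) = tree_ball (Suc R) (X n)" for R
    using X unfolding Cauchy_def dist_btree_def d_loc_less_iff[symmetric] by simp
  then have "\<forall>R. \<exists>N. \<forall>m\<ge>N. \<forall>n\<ge>N. tree_ball R (X m) = tree_ball R (X n)"
    by (metis tree_ball_eq_mono le_SucI order_refl)
  then obtain N where N: "\<And>R m n. m \<ge> N R \<Longrightarrow> n \<ge> N R \<Longrightarrow> tree_ball R (X m) = tree_ball R (X n)"
    by metis
  define y where "y R = X (\<Sum>k\<le>R. N k)" for R
  have le: "N R \<le> (\<Sum>k\<le>S. N k)" if "R \<le> S" for R S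
    using that by (intro member_le_sum) auto
  have "tree_ball R (y S) = tree_ball R (y R)" if "R \<le> S" for R S
    unfolding y_def using that by (intro N le) auto
  then have L: "tree_ball R (limit_tree y) = tree_ball R (y R)" for R
    by (rule tree_ball_limit_tree)
  have "X \<longlonglongrightarrow> limit_tree y"
  proof (rule metric_LIMSEQ_I)
    fix e :: real assume "e > 0"
    then obtain R where R: "inverse (1 + real R) < e"
      using reals_Archimedean[of e] by auto
    have "dist (X n) (limit_tree y) < inverse (1 + real R)" if "n \<ge> N (Suc R)" for n
      unfolding dist_btree_def d_loc_less_iff L y_def using that by (intro N le) auto
    with R show "\<exists>no. \<forall>n\<ge>no. dist (X n) (limit_tree y) < e"
      by (meson order.strict_trans)
  qed
  then show "convergent X" by (auto simp: convergent_def)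
qed

definition trees_completion :: "nat \<Rightarrow> btree set" where
  "trees_completion d = closure (trees d)"

definition infinite_trees :: "nat \<Rightarrow> btree set" where
  "infinite_trees d = trees_completion d - trees d"

definition adjacent :: "btree \<Rightarrow> nat list \<Rightarrow> nat list \<Rightarrow> bool" where
  "adjacent t u v \<longleftrightarrow> u \<in> verts t \<and> v \<in> verts t \<and> (u \<in> children t v \<or> v \<in> children t u)"

definition spine :: "btree \<Rightarrow> (nat \<Rightarrow> nat list) \<Rightarrow> bool" where
  "spine t p \<longleftrightarrow> p 0 = [] \<and> (\<forall>k. adjacent t (p k) (p (Suc k))) \<and> inj p"

definition single_spine :: "btree \<Rightarrow> bool" where
  "single_spine t \<longleftrightarrow> (\<exists>!p. spine t p)"

text \<open>A charge function has the vertices as its domain; extensionality makes its values elsewhere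
  irrelevant for uniqueness.\<close>

definition charge_function :: "btree \<Rightarrow> (nat list \<Rightarrow> int) \<Rightarrow> bool" where
  "charge_function t c \<longleftrightarrow>
     c \<in> extensional (verts t) \<and> c [] = 0 \<and>
     (\<forall>v\<in>verts t. c v = int (num_closing t v) - int (num_opening t v) + (\<Sum>u\<in>children t v. c u))"

definition infinite_well_charged :: "btree \<Rightarrow> bool" where
  "infinite_well_charged t \<longleftrightarrow>
     (\<exists>!c. charge_function t c) \<and> (\<forall>c. charge_function t c \<longrightarrow> charges_bounded t c)"

definition borel_completion :: "nat \<Rightarrow> btree measure" where
  "borel_completion d = restrict_space borel (trees_completion d)"

definition unif_trees :: "nat \<Rightarrow> nat \<Rightarrow> btree measure" where
  "unif_trees d n = distr (uniform_count_measure (trees_n d n)) (borel_completion d) (\<lambda>t. t)"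

definition weak_conv_on ::
  "'a::topological_space set \<Rightarrow> (nat \<Rightarrow> 'a measure) \<Rightarrow> 'a measure \<Rightarrow> bool" where
  "weak_conv_on S M N \<longleftrightarrow>
     (\<forall>f :: 'a \<Rightarrow> real. continuous_on S f \<and> bounded (f ` S) \<longrightarrow>
        (\<lambda>n. \<integral>x. f x \<partial>M n) \<longlonglongrightarrow> (\<integral>x. f x \<partial>N))"

end

theory Submission
  imports Defs "HOL-Computational_Algebra.Polynomial_FPS" "HOL-Real_Asymp.Real_Asymp"
begin

text \<open>
  Write \<open>m = d - 1\<close>. In a \<open>d\<close>-regular tree, edges and stems of a subtree
  are tied together by counting half-edges, and this makes well-chargedness extremely rigid.
  Reasoning from the leaves upwards, every white vertex must have charge exactly \<open>m\<close>,
  every black vertex other than the root must have charge \<open>1\<close>, and every black vertex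
  must have exactly one white child (\<open>slots_if_admissible\<close>). Such a tree is therefore a
  position \<open>r \<le> m\<close> at the root together with an \<open>m\<close>-ary tree of white
  vertices, in which every edge carries one of \<open>m\<close> labels, the position of the white
  child around the intermediate black vertex (\<open>trees_n_Suc\<close>). Each of the
  \<open>m\<close> slots below a white vertex is, independently of the others, a stem or such an
  edge, so their generating function satisfies \<open>G = 1 + m z G\<^sup>m\<close>
  (\<open>slot_gf_UNIV\<close>).

  The powers of \<open>G\<close> have explicit coefficients (\<open>coef_formula\<close>), which
  give \<open>[z\<^sup>n](p G\<^sup>k) / [z\<^sup>n]G \<longlonglongrightarrow> p(\<rho>) k
  \<tau>\<^sup>k\<^sup>-\<^sup>1\<close> for every polynomial \<open>p\<close>
  (\<open>poly_power_limit\<close>), where \<open>\<rho>\<close> is the radius of convergence and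
  \<open>\<tau> = G(\<rho>)\<close>. In other words, the limit of the ratio is the derivative at
  \<open>\<tau>\<close> of the polynomial in \<open>G\<close> with coefficients evaluated at \<open>\<rho>\<close>. Prescribing a ball of even radius
  leaves a number of free slots, so its generating function has the form \<open>p G\<^sup>k\<close>
  (\<open>exploration_series_ball\<close>), and the probabilities of all balls converge.

  There are finitely many balls of each radius, so the completion is compact. The limits of the
  probabilities define a finitely additive function on the algebra of events that depend on a ball;
  by compactness it is continuous at the empty set, hence it extends to a probability measure
  (\<open>limit_measure_exists\<close>). Weak convergence follows because continuous functions on a
  compact space are uniformly continuous and thus nearly constant on balls
  (\<open>weak_conv_on_if_balls_converge\<close>).

  It remains to identify the support. A limiting tree has vertices at every height, since a tree
  with many vertices cannot lie in a fixed ball. Two disjoint branches of height \<open>2 k\<close>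
  above the same vertex have a generating function \<open>z\<^sup>a G\<^sup>r (G -
  g\<^sub>k)\<^sup>2\<close>, where \<open>g\<^sub>k\<close> is the polynomial of the slots of
  smaller height (\<open>forest_gf_forked\<close>). As \<open>g\<^sub>k(\<rho>)\<close> tends to
  \<open>\<tau>\<close>, the derivative of this double zero vanishes in the limit, so almost surely
  no vertex has two children with infinite subtrees; by Koenig's lemma this means that there is a
  single spine (\<open>single_spine_iff\<close>). Finally the local charge identities survive in the
  completion: giving the root charge \<open>0\<close>, the other black vertices charge
  \<open>1\<close> and the white vertices charge \<open>m\<close> is a charge function of every tree
  of the completion (\<open>canonical_charge_function\<close>), and it is unique if there is a
  single spine, because the difference of two charge functions can only be nonzero along infinite
  paths (\<open>unique_charge_function\<close>).
\<close>

section \<open>Vertices and additive functions of a tree\<close>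

lemma not_Black_iff [simp]: "c \<noteq> Black \<longleftrightarrow> c = White"
  by (cases c) auto

lemma not_White_iff [simp]: "c \<noteq> White \<longleftrightarrow> c = Black"
  by (cases c) auto

lemma Nil_in_verts [simp]: "[] \<in> verts t"
  by (simp add: verts_def)

lemma Cons_in_verts:
  "i # v \<in> verts t \<longleftrightarrow> i < length (halves t) \<and> (\<exists>u. halves t ! i = Edge u \<and> v \<in> verts u)"
  by (auto simp: verts_def split: half_edge.splits)

lemma subtree_Nil [simp]: "subtree t [] = t"
  by (simp add: subtree_def)

lemma subtree_Cons:
  "i < length (halves t) \<Longrightarrow> halves t ! i = Edge u \<Longrightarrow> subtree t (i # v) = subtree u v"
  by (simp add: subtree_def)

lemma append_in_verts: "v @ w \<in> verts t \<longleftrightarrow> v \<in> verts t \<and> w \<in> verts (subtree t v)"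
  by (induction v arbitrary: t) (auto simp: Cons_in_verts subtree_Cons)

lemma subtree_append: "v \<in> verts t \<Longrightarrow> subtree t (v @ w) = subtree (subtree t v) w"
  by (induction v arbitrary: t) (auto simp: Cons_in_verts subtree_Cons)

lemma snoc_in_verts:
  "v @ [i] \<in> verts t \<longleftrightarrow> v \<in> verts t \<and> i < length (halves (subtree t v)) \<and>
     (\<exists>u. halves (subtree t v) ! i = Edge u)"
  by (simp add: append_in_verts Cons_in_verts)

lemma verts_unfold:
  "verts t = insert [] (\<Union>i<length (halves t).
     (#) i ` (case halves t ! i of Stem \<Rightarrow> {} | Edge u \<Rightarrow> verts u))"
  (is "_ = ?R")
proof (rule set_eqI)
  fix v
  show "v \<in> verts t \<longleftrightarrow> v \<in> ?R"
  proof (cases v)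
    case (Cons i w)
    have "v \<in> ?R \<longleftrightarrow> (\<exists>j<length (halves t). i = j \<and>
        w \<in> (case halves t ! j of Stem \<Rightarrow> {} | Edge u \<Rightarrow> verts u))"
      unfolding Cons by blast
    then show ?thesis by (auto simp: Cons Cons_in_verts split: half_edge.splits)
  qed simp
qed

lemma finite_verts_iff:
  "finite (verts t) \<longleftrightarrow> (\<forall>u. Edge u \<in> set (halves t) \<longrightarrow> finite (verts u))"
proof -
  have "finite (verts t) \<longleftrightarrow> (\<forall>i<length (halves t).
     finite (case halves t ! i of Stem \<Rightarrow> {} | Edge u \<Rightarrow> verts u))"
    by (subst verts_unfold) (auto simp: finite_image_iff)
  also have "\<dots> \<longleftrightarrow> (\<forall>u. Edge u \<in> set (halves t) \<longrightarrow> finite (verts u))"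
    by (auto simp: in_set_conv_nth split: half_edge.splits)
  finally show ?thesis .
qed

text \<open>Charges and numbers of black vertices are sums of a local function over all subtrees. This
  recursion turns them into functions that can be treated by induction on the tree.\<close>

lemma sum_verts_unfold:
  fixes f :: "btree \<Rightarrow> 'a :: comm_monoid_add"
  assumes "finite (verts t)"
  shows "(\<Sum>v\<in>verts t. f (subtree t v)) =
    f t + sum_list (map (case_half_edge 0 (\<lambda>u. \<Sum>v\<in>verts u. f (subtree u v))) (halves t))"
proof -
  define V where "V i = (case halves t ! i of Stem \<Rightarrow> {} | Edge u \<Rightarrow> verts u)" for i
  have fin: "finite (V i)" if "i < length (halves t)" for i
    using assms nth_mem[OF that]
    by (cases "halves t ! i") (auto simp: V_def finite_verts_iff[of t])
  have "(\<Sum>v\<in>verts t. f (subtree t v)) =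
    f t + (\<Sum>v\<in>(\<Union>i<length (halves t). (#) i ` V i). f (subtree t v))"
  proof -
    have "verts t = insert [] (\<Union>i<length (halves t). (#) i ` V i)"
      unfolding V_def by (rule verts_unfold)
    moreover have "finite (\<Union>i<length (halves t). (#) i ` V i)" using fin by blast
    moreover have "[] \<notin> (\<Union>i<length (halves t). (#) i ` V i)" by blast
    ultimately show ?thesis by simp
  qed
  also have "(\<Sum>v\<in>(\<Union>i<length (halves t). (#) i ` V i). f (subtree t v)) =
    (\<Sum>i<length (halves t). \<Sum>v\<in>(#) i ` V i. f (subtree t v))"
    by (rule sum.UNION_disjoint) (auto simp: fin)
  also have "\<dots> = (\<Sum>i<length (halves t).
      case_half_edge 0 (\<lambda>u. \<Sum>v\<in>verts u. f (subtree u v)) (halves t ! i))"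
    by (intro sum.cong refl, subst sum.reindex)
       (auto simp: V_def subtree_Cons split: half_edge.splits)
  also have "\<dots> = sum_list (map (case_half_edge 0 (\<lambda>u. \<Sum>v\<in>verts u. f (subtree u v))) (halves t))"
    by (simp add: sum_list_sum_nth atLeast0LessThan)
  finally show ?thesis .
qed

lemma all_verts_unfold:
  "(\<forall>v\<in>verts t. Q (subtree t v)) \<longleftrightarrow>
     Q t \<and> (\<forall>u. Edge u \<in> set (halves t) \<longrightarrow> (\<forall>v\<in>verts u. Q (subtree u v)))"
  (is "?L \<longleftrightarrow> ?R")
proof
  assume L: ?L
  have "Q (subtree u v)" if u: "Edge u \<in> set (halves t)" "v \<in> verts u" for u v
  proof -
    obtain i where "i < length (halves t)" "halves t ! i = Edge u"
      using u(1) unfolding in_set_conv_nth by blast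
    then show ?thesis
      using L[rule_format, of "i # v"] u(2) by (simp add: Cons_in_verts subtree_Cons)
  qed
  moreover have "Q t" using L[rule_format, of "[]"] by simp
  ultimately show ?R by blast
next
  assume R: ?R
  show ?L
  proof
    fix v assume v: "v \<in> verts t"
    show "Q (subtree t v)"
    proof (cases v)
      case (Cons i w)
      with v obtain u where "i < length (halves t)" "halves t ! i = Edge u" "w \<in> verts u"
        by (auto simp: Cons_in_verts)
      then show ?thesis using R nth_mem[of i "halves t"] by (simp add: Cons subtree_Cons)
    qed (use R in simp)
  qed
qed

text \<open>A stem contributes the sign of the colour of its vertex, an edge the charge of the child, so
  that the charge is a single sum over the half-edges around the root.\<close>

lemma charge_unfold:
  assumes "finite (verts t)"
  shows "charge t =
    sum_list (map (case_half_edge (if colour t = White then 1 else - 1) charge) (halves t))"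
proof -
  define g where "g u = (if colour u = White then 1 else - 1) * int (count_list (halves u) Stem)" for u
  have charge: "charge u = (\<Sum>v\<in>verts u. g (subtree u v))" for u
  proof -
    have "charge u = (\<Sum>v\<in>verts u. int (num_closing u v) - int (num_opening u v))"
      by (simp only: charge_def of_nat_sum sum_subtractf)
    also have "\<dots> = (\<Sum>v\<in>verts u. g (subtree u v))"
      by (intro sum.cong refl) (simp add: num_closing_def num_opening_def num_stems_def g_def)
    finally show ?thesis .
  qed
  have "charge t = g t + sum_list (map (case_half_edge 0 charge) (halves t))"
    using sum_verts_unfold[OF assms, of g] by (simp flip: charge)
  also have "(s :: int) * int (count_list hs Stem) + sum_list (map (case_half_edge 0 charge) hs) =
      sum_list (map (case_half_edge s charge) hs)" for s hs
    by (induction hs) (auto simp: algebra_simps split: half_edge.splits)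
  then have "g t + sum_list (map (case_half_edge 0 charge) (halves t)) =
     sum_list (map (case_half_edge (if colour t = White then 1 else - 1) charge) (halves t))"
    unfolding g_def by blast
  finally show ?thesis .
qed

definition num_black :: "btree \<Rightarrow> nat" where
  "num_black t = card {v \<in> verts t. colour_at t v = Black}"

text \<open>The size of a tree hanging from a half-edge, with a stem counted as an empty tree. Sizes of
  lists of half-edges then add up, which is what generating functions need.\<close>

definition weight :: "btree half_edge \<Rightarrow> nat" where
  "weight = case_half_edge 0 num_black"

lemma num_black_unfold:
  assumes "finite (verts t)"
  shows "num_black t = (if colour t = Black then 1 else 0) + sum_list (map weight (halves t))"
proof -
  have nb: "num_black u = (\<Sum>v\<in>verts u. if colour (subtree u v) = Black then 1 else 0)"
    if "finite (verts u)" for u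
    using that unfolding num_black_def by (simp add: sum.If_cases Int_def)
  have "num_black t = (if colour t = Black then 1 else 0) +
     sum_list (map (case_half_edge 0 (\<lambda>u. \<Sum>v\<in>verts u. if colour (subtree u v) = Black then 1 else 0)) (halves t))"
    unfolding nb[OF assms]
    by (rule sum_verts_unfold[OF assms, of "\<lambda>u. if colour u = Black then 1 else 0"])
  also have "map (case_half_edge 0 (\<lambda>u. \<Sum>v\<in>verts u. if colour (subtree u v) = Black then 1 else 0)) (halves t)
     = map weight (halves t)"
  proof (rule map_cong[OF refl])
    fix x assume x: "x \<in> set (halves t)"
    show "case_half_edge 0 (\<lambda>u. \<Sum>v\<in>verts u. if colour (subtree u v) = Black then 1 else 0) x = weight x"
    proof (cases x)
      case (Edge u)
      then have "finite (verts u)" using assms x by (simp add: finite_verts_iff[of t])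
      from nb[OF this] show ?thesis by (simp add: Edge weight_def)
    qed (simp add: weight_def)
  qed
  finally show ?thesis .
qed

lemma card_verts_child_less:
  assumes "finite (verts t)" "Edge u \<in> set (halves t)"
  shows "card (verts u) < card (verts t)"
proof -
  obtain i where i: "i < length (halves t)" "halves t ! i = Edge u"
    using assms(2) unfolding in_set_conv_nth by blast
  have "card (verts u) = card ((#) i ` verts u)"
    by (simp add: card_image)
  also have "\<dots> < card (verts t)"
  proof (rule psubset_card_mono[OF assms(1)])
    have "(#) i ` verts u \<subseteq> verts t" using i by (auto simp: Cons_in_verts)
    moreover have "[] \<in> verts t - (#) i ` verts u" by auto
    ultimately show "(#) i ` verts u \<subset> verts t" by blast
  qed
  finally show ?thesis .
qed

section \<open>The shape of well-charged regular trees\<close>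

text \<open>The only shape of a black vertex in a well-charged tree: a single edge, at position
  \<open>q\<close> among \<open>k\<close> half-edges. The root has \<open>k = d\<close>; any
  other black vertex has \<open>k = d - 1\<close>, as the edge to its parent is not listed.\<close>

definition black_vertex :: "nat \<Rightarrow> nat \<Rightarrow> btree \<Rightarrow> btree" where
  "black_vertex k q w = Vertex Black ((replicate k Stem)[q := Edge w])"

lemma colour_black_vertex [simp]: "colour (black_vertex k q w) = Black"
  by (simp add: black_vertex_def)

lemma halves_black_vertex: "halves (black_vertex k q w) = (replicate k Stem)[q := Edge w]"
  by (simp add: black_vertex_def)

lemma length_halves_black_vertex [simp]: "length (halves (black_vertex k q w)) = k"
  by (simp add: black_vertex_def)

lemma nth_halves_black_vertex:
  "i < k \<Longrightarrow> halves (black_vertex k q w) ! i = (if i = q then Edge w else Stem)"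
  by (simp add: black_vertex_def nth_list_update)

lemma black_vertex_eq_iff:
  assumes "q < k"
  shows "black_vertex k q w = black_vertex k r w' \<longleftrightarrow> q = r \<and> w = w'"
proof
  assume eq: "black_vertex k q w = black_vertex k r w'"
  then have "Edge w = (if q = r then Edge w' else Stem)"
    using nth_halves_black_vertex[OF assms, of q w] nth_halves_black_vertex[OF assms, of r w'] by metis
  then show "q = r \<and> w = w'" by (simp split: if_splits)
qed simp

lemma Edge_in_black_vertex: 
  assumes "q < k"
  shows "Edge u \<in> set (halves (black_vertex k q w)) \<longleftrightarrow> u = w"
  using assms by (auto simp: in_set_conv_nth nth_halves_black_vertex split: if_splits)

lemma sum_list_one_edge:
  fixes f :: "'a half_edge \<Rightarrow> 'b :: comm_ring_1"
  assumes "q < k"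
  shows "sum_list (map f ((replicate k Stem)[q := Edge w])) = of_nat (k - 1) * f Stem + f (Edge w)"
  using assms
proof (induction k arbitrary: q)
  case (Suc k)
  show ?case
  proof (cases q)
    case 0 then show ?thesis by (simp add: sum_list_replicate)
  next
    case (Suc r)
    with Suc.IH[of r] Suc.prems show ?thesis by (cases k) (auto simp: algebra_simps)
  qed
qed simp

lemma weight_one_edge: 
  assumes "q < k"
  shows "sum_list (map weight ((replicate k Stem)[q := Edge w])) = num_black w"
proof -
  have "int (sum_list (map weight ((replicate k Stem)[q := Edge w]))) =
     sum_list (map (\<lambda>x. int (weight x)) ((replicate k Stem)[q := Edge w]))"
    (is "int (sum_list (map _ ?xs)) = _")
    by (induct ("?xs")) (simp_all only: list.map sum_list.Cons sum_list.Nil of_nat_add of_nat_0)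
  also have "\<dots> = int (num_black w)"
    by (subst sum_list_one_edge[OF assms]) (simp add: weight_def)
  finally show ?thesis by simp
qed

lemma charge_black_vertex:
  assumes "q < k" "finite (verts w)"
  shows "charge (black_vertex k q w) = charge w - int (k - 1)"
proof -
  have "finite (verts (black_vertex k q w))"
    using assms by (auto simp: finite_verts_iff[of "black_vertex k q w"] Edge_in_black_vertex)
  from charge_unfold[OF this] show ?thesis
    by (simp only: halves_black_vertex sum_list_one_edge[OF assms(1)]) simp
qed

lemma num_black_black_vertex:
  assumes "q < k" "finite (verts w)"
  shows "num_black (black_vertex k q w) = Suc (num_black w)"
proof -
  have "finite (verts (black_vertex k q w))"
    using assms by (auto simp: finite_verts_iff[of "black_vertex k q w"] Edge_in_black_vertex)
  from num_black_unfold[OF this] show ?thesis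
    by (simp only: halves_black_vertex weight_one_edge[OF assms(1)]) simp
qed

lemma one_edge_if_count:
  assumes "length (filter (\<lambda>x. x \<noteq> Stem) hs) = 1"
  shows "\<exists>q w. q < length hs \<and> hs = (replicate (length hs) Stem)[q := Edge w]"
  using assms
proof (induction hs)
  case (Cons x hs)
  show ?case
  proof (cases x)
    case Stem
    with Cons obtain q w where "q < length hs" "hs = (replicate (length hs) Stem)[q := Edge w]"
      by auto
    then show ?thesis using Stem by (intro exI[of _ "Suc q"] exI[of _ w]) auto
  next
    case (Edge u)
    with Cons.prems have "\<forall>y\<in>set hs. y = Stem" by (auto simp: filter_empty_conv)
    then have "hs = replicate (length hs) Stem" by (simp add: replicate_eqI)
    then show ?thesis using Edge by (intro exI[of _ 0] exI[of _ u]) auto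
  qed
qed simp

text \<open>If all white children of a black vertex have the same charge \<open>a\<close>, its charge is
  an affine function of the number of its children, with slope \<open>a + 1\<close> since each
  child takes the place of an opening stem. With \<open>a = d - 1\<close> the bound on the
  charge leaves at most one child.\<close>

lemma sum_list_const_edges:
  fixes a :: int
  assumes "\<forall>u. Edge u \<in> set hs \<longrightarrow> f u = a"
  shows "sum_list (map (case_half_edge (- 1) f) hs) =
    (a + 1) * int (length (filter (\<lambda>x. x \<noteq> Stem) hs)) - int (length hs)"
  using assms by (induction hs) (auto simp: algebra_simps split: half_edge.splits)

text \<open>The half-edges that may follow a white vertex: a stem, or an edge to a black vertex with a
  single white child whose own \<open>m\<close> half-edges are again slots.\<close>

inductive slot :: "nat \<Rightarrow> btree half_edge \<Rightarrow> bool" for m where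
  Stem: "slot m Stem"
| Edge: "q < m \<Longrightarrow> length l = m \<Longrightarrow> \<forall>x\<in>set l. slot m x \<Longrightarrow>
     slot m (Edge (black_vertex m q (Vertex White l)))"

text \<open>What regularity, proper colouring and well-chargedness require at one vertex. The number
  \<open>k\<close> of listed half-edges is a parameter because it is \<open>d\<close> at the
  root and \<open>d - 1\<close> elsewhere.\<close>

definition admissible :: "nat \<Rightarrow> btree \<Rightarrow> bool" where
  "admissible k u \<longleftrightarrow> length (halves u) = k \<and>
     (\<forall>y. Edge y \<in> set (halves u) \<longrightarrow> colour y \<noteq> colour u) \<and>
     (colour u = Black \<longrightarrow> charge u \<le> 1) \<and> (colour u = White \<longrightarrow> charge u \<ge> 0)"

lemma admissible_childD: "admissible k u \<Longrightarrow> Edge y \<in> set (halves u) \<Longrightarrow> colour y \<noteq> colour u"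
  by (simp add: admissible_def)

text \<open>The rigidity of well-charged trees, by induction from the leaves. A black vertex with
  \<open>j\<close> white children, all of charge \<open>m\<close>, has charge \<open>(m + 1) j
  - m \<le> 1\<close>, so \<open>j \<le> 1\<close>. The case \<open>j = 0\<close> gives charge
  \<open>- m\<close>; it cannot be excluded at the vertex itself, but a white parent with such
  a child would have negative charge. Hence the \<open>m\<close> half-edges of a white vertex
  contribute \<open>1\<close> each.\<close>

lemma slots_if_admissible:
  assumes "finite (verts u)" "\<forall>v\<in>verts u. admissible m (subtree u v)"
  shows "(colour u = White \<longrightarrow> (\<forall>x\<in>set (halves u). slot m x) \<and> charge u = int m) \<and>
    (colour u = Black \<longrightarrow> slot m (Edge u) \<and> charge u = 1 \<or> charge u = - int m)"
  using assms
proof (induction "card (verts u)" arbitrary: u rule: less_induct)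
  case less
  have adm: "admissible m u" and adm': "\<And>y. Edge y \<in> set (halves u) \<Longrightarrow> \<forall>v\<in>verts y. admissible m (subtree y v)"
    using less.prems(2) unfolding all_verts_unfold[of u] by auto
  have fin: "finite (verts y)" if "Edge y \<in> set (halves u)" for y
    using less.prems(1) that by (simp add: finite_verts_iff[of u])
  have IH: "(colour y = White \<longrightarrow> (\<forall>x\<in>set (halves y). slot m x) \<and> charge y = int m) \<and>
    (colour y = Black \<longrightarrow> slot m (Edge y) \<and> charge y = 1 \<or> charge y = - int m)"
    if "Edge y \<in> set (halves u)" for y
    using less.hyps[OF card_verts_child_less[OF less.prems(1) that]] fin[OF that] adm'[OF that] .
  have len: "length (halves u) = m" using adm by (simp add: admissible_def)
  show ?case
  proof (cases "colour u")
    case White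
    have ch: "charge u = sum_list (map (case_half_edge 1 charge) (halves u))"
      using charge_unfold[OF less.prems(1)] White by simp
    have col: "colour y = Black" if "Edge y \<in> set (halves u)" for y
      using admissible_childD[OF adm that] White by simp
    have le: "case_half_edge 1 charge x \<le> 1" if "x \<in> set (halves u)" for x
      using IH col that by (fastforce split: half_edge.splits)
    have le': "sum_list (map (case_half_edge 1 charge) hs) \<le> int (length hs)"
      if "set hs \<subseteq> set (halves u)" for hs
      using that le by (induction hs) force+
    have good: "slot m (Edge y) \<and> charge y = 1" if y: "Edge y \<in> set (halves u)" for y
    proof (rule ccontr)
      assume neg: "\<not> ?thesis"
      have c: "charge y = - int m" using IH[OF y] col[OF y] neg by auto
      obtain l1 l2 where l: "halves u = l1 @ Edge y # l2" using split_list[OF y] by blast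
      have "charge u \<le> int (length l1) + int (length l2) - int m"
        unfolding ch using c add_mono[OF le'[of l1] le'[of l2]] l by auto
      also have "\<dots> < 0" using len l by simp
      finally show False using adm White by (simp add: admissible_def)
    qed
    have "case_half_edge 1 charge x = 1" if "x \<in> set (halves u)" for x
      using good that by (auto split: half_edge.splits)
    then have "map (case_half_edge 1 charge) (halves u) = map (\<lambda>_. 1) (halves u)"
      by (intro map_cong) auto
    then have "charge u = int m"
      unfolding ch using len by (simp only: sum_list_triv)
    moreover have "slot m x" if "x \<in> set (halves u)" for x
      using good that by (cases x) (auto intro: slot.Stem)
    ultimately show ?thesis using White by simp
  next
    case Black
    have col: "colour y = White" if "Edge y \<in> set (halves u)" for y
      using admissible_childD[OF adm that] Black by simp
    define j where "j = length (filter (\<lambda>x. x \<noteq> Stem) (halves u))"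
    have ch: "charge u = (int m + 1) * int j - int m"
      using charge_unfold[OF less.prems(1)] Black IH col
        sum_list_const_edges[of "halves u" charge "int m"] by (simp add: j_def len)
    moreover have "charge u \<le> 1" using adm Black by (simp add: admissible_def)
    ultimately have "(int m + 1) * int j \<le> (int m + 1) * 1" by (simp add: algebra_simps)
    then have "j \<le> 1" by (subst (asm) mult_le_cancel_left_pos) auto
    then consider "j = 0" | "j = 1" by linarith
    then show ?thesis
    proof cases
      case 1
      then show ?thesis using ch Black by simp
    next
      case 2
      obtain q w where qw: "q < m" "halves u = (replicate m Stem)[q := Edge w]"
        using one_edge_if_count[of "halves u"] 2 len j_def by auto
      then have u: "u = black_vertex m q w"
        using Black by (cases u) (simp add: black_vertex_def)
      have w: "Edge w \<in> set (halves u)" using qw u using Edge_in_black_vertex by blast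
      have wc: "colour w = White" using col[OF w] .
      have "length (halves w) = m" 
        using adm'[OF w] unfolding all_verts_unfold[of w] by (simp add: admissible_def)
      with IH[OF w] wc have "slot m (Edge (black_vertex m q (Vertex White (halves w))))"
        using qw by (intro slot.Edge) auto
      also have "Vertex White (halves w) = w" using wc by (cases w) simp
      finally show ?thesis using u ch 2 Black by simp
    qed
  qed
qed

text \<open>The part of a ball of radius 1 that enters the equation for a charge function at its centre.\<close>

definition half_colours :: "btree \<Rightarrow> colour half_edge list" where
  "half_colours u = map (map_half_edge colour) (halves u)"

text \<open>The consequences of rigidity for one vertex. They only involve a ball of radius 1 and
  therefore pass to limits of trees, whereas charges of subtrees do not.\<close>

definition regular_shape :: "nat \<Rightarrow> btree \<Rightarrow> bool" where
  "regular_shape m u \<longleftrightarrow>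
     (colour u = Black \<longrightarrow> (\<exists>q<m. half_colours u = (replicate m Stem)[q := Edge White])) \<and>
     (colour u = White \<longrightarrow> length (half_colours u) = m \<and> Edge White \<notin> set (half_colours u))"

text \<open>The induction step at a white vertex for the converse of \<open>slots_if_admissible\<close>.
  It also covers the child of the root.\<close>

lemma white_vertex_of_slots:
  assumes "length l = m"
    and "\<And>u. Edge u \<in> set l \<Longrightarrow> finite (verts u) \<and> colour u = Black \<and> charge u = 1 \<and>
        (\<forall>v\<in>verts u. admissible m (subtree u v) \<and> regular_shape m (subtree u v))"
  shows "finite (verts (Vertex White l))" "charge (Vertex White l) = int m"
    "\<forall>v\<in>verts (Vertex White l). admissible m (subtree (Vertex White l) v) \<and> regular_shape m (subtree (Vertex White l) v)"
proof -
  show fin: "finite (verts (Vertex White l))"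
    using assms(2) by (auto simp: finite_verts_iff[of "Vertex White l"])
  have "map (case_half_edge 1 charge) l = map (\<lambda>_. 1) l"
    using assms(2) by (auto split: half_edge.splits)
  then have "sum_list (map (case_half_edge 1 charge) l) = int m"
    using assms(1) by (simp only: sum_list_triv)
  then show ch: "charge (Vertex White l) = int m"
    using charge_unfold[OF fin] by simp
  have "colour y = Black" if "Edge y \<in> set l" for y using assms(2)[OF that] by simp
  have "Edge White \<notin> map_half_edge colour ` set l"
  proof -
    have "map_half_edge colour x \<noteq> Edge White" if "x \<in> set l" for x
    proof (cases x)
      case (Edge u)
      then show ?thesis using assms(2)[of u] that by simp
    qed simp
    then show ?thesis by (metis imageE)
  qed
  then have "admissible m (Vertex White l)" "regular_shape m (Vertex White l)"
    using assms ch by (auto simp: admissible_def regular_shape_def half_colours_def)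
  then show "\<forall>v\<in>verts (Vertex White l). admissible m (subtree (Vertex White l) v) \<and> regular_shape m (subtree (Vertex White l) v)"
    using assms(2) by (subst all_verts_unfold[of "Vertex White l"]) auto
qed

lemma slot_properties:
  assumes "slot m x" "x = Edge u"
  shows "finite (verts u) \<and> colour u = Black \<and> charge u = 1 \<and>
    (\<forall>v\<in>verts u. admissible m (subtree u v) \<and> regular_shape m (subtree u v))"
  using assms
proof (induction arbitrary: u rule: slot.induct)
  case (Edge q l)
  let ?w = "Vertex White l"
  have w: "finite (verts ?w)" "charge ?w = int m"
    "\<forall>v\<in>verts ?w. admissible m (subtree ?w v) \<and> regular_shape m (subtree ?w v)"
    using white_vertex_of_slots[of l m] Edge.hyps Edge.IH by blast+
  have u: "u = black_vertex m q ?w" using Edge.prems by simp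
  have fin: "finite (verts u)"
    using w(1) Edge.hyps unfolding u by (subst finite_verts_iff) (auto simp: Edge_in_black_vertex)
  have ch: "charge u = 1" using charge_black_vertex[OF Edge.hyps(1) w(1)] w(2) Edge.hyps(1) u by simp
  have "half_colours u = (replicate m Stem)[q := Edge White]"
    unfolding u half_colours_def halves_black_vertex by (simp add: map_update)
  then have "admissible m u" "regular_shape m u"
    using ch Edge.hyps(1) by (auto simp: admissible_def regular_shape_def u Edge_in_black_vertex)
  then have "\<forall>v\<in>verts u. admissible m (subtree u v) \<and> regular_shape m (subtree u v)"
    using w(3) Edge.hyps(1) by (subst all_verts_unfold) (auto simp: u Edge_in_black_vertex)
  then show ?case using fin ch u by simp
qed simp

lemma regular_iff:
  "regular (Suc m) t \<longleftrightarrow> length (halves t) = Suc m \<and>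
     (\<forall>u. Edge u \<in> set (halves t) \<longrightarrow> (\<forall>v\<in>verts u. length (halves (subtree u v)) = m))"
  (is "?L \<longleftrightarrow> ?R")
proof
  assume L: ?L
  have "length (halves (subtree u v)) = m" if u: "Edge u \<in> set (halves t)" "v \<in> verts u" for u v
  proof -
    obtain i where "i < length (halves t)" "halves t ! i = Edge u"
      using u(1) unfolding in_set_conv_nth by blast
    then show ?thesis using L u(2)
      unfolding regular_def by (auto simp: degree_def Cons_in_verts subtree_Cons dest!: bspec[of _ _ "i # v"])
  qed
  moreover have "length (halves t) = Suc m"
    using L unfolding regular_def by (auto simp: degree_def dest!: bspec[of _ _ "[]"])
  ultimately show ?R by blast
next
  assume R: ?R
  show ?L unfolding regular_def
  proof
    fix v assume v: "v \<in> verts t"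
    show "degree t v = Suc m"
    proof (cases v)
      case (Cons i w)
      with v obtain u where "i < length (halves t)" "halves t ! i = Edge u" "w \<in> verts u"
        by (auto simp: Cons_in_verts)
      then show ?thesis using R nth_mem[of i "halves t"] by (simp add: Cons subtree_Cons degree_def)
    qed (use R in \<open>simp add: degree_def\<close>)
  qed
qed

lemma properly_coloured_iff:
  "properly_coloured t \<longleftrightarrow>
     (\<forall>v\<in>verts t. \<forall>y. Edge y \<in> set (halves (subtree t v)) \<longrightarrow> colour y \<noteq> colour (subtree t v))"
proof -
  have "(\<forall>u\<in>children t v. colour_at t u \<noteq> colour_at t v) \<longleftrightarrow>
     (\<forall>y. Edge y \<in> set (halves (subtree t v)) \<longrightarrow> colour y \<noteq> colour (subtree t v))"
    if v: "v \<in> verts t" for v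
  proof -
    have "children t v = (\<lambda>i. v @ [i]) ` {i. i < length (halves (subtree t v)) \<and>
        (\<exists>y. halves (subtree t v) ! i = Edge y)}"
      using v by (auto simp: children_def snoc_in_verts)
    then have "(\<forall>u\<in>children t v. colour_at t u \<noteq> colour_at t v) \<longleftrightarrow>
      (\<forall>i y. i < length (halves (subtree t v)) \<longrightarrow> halves (subtree t v) ! i = Edge y \<longrightarrow>
         colour_at t (v @ [i]) \<noteq> colour_at t v)" by auto
    also have "\<dots> \<longleftrightarrow> (\<forall>i y. i < length (halves (subtree t v)) \<longrightarrow> halves (subtree t v) ! i = Edge y \<longrightarrow>
         colour y \<noteq> colour_at t v)"
      using v by (simp add: subtree_append subtree_Cons)
    also have "\<dots> \<longleftrightarrow> (\<forall>y. Edge y \<in> set (halves (subtree t v)) \<longrightarrow> colour y \<noteq> colour (subtree t v))"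
      unfolding in_set_conv_nth by blast
    finally show ?thesis .
  qed
  then show ?thesis unfolding properly_coloured_def by (rule ball_cong[OF refl])
qed

lemma well_charged_iff:
  "well_charged t \<longleftrightarrow> (\<forall>v\<in>verts t. (colour (subtree t v) = Black \<longrightarrow> charge (subtree t v) \<le> 1) \<and>
     (colour (subtree t v) = White \<longrightarrow> charge (subtree t v) \<ge> 0))"
  by (simp add: well_charged_def charges_bounded_def)

text \<open>Splits \<open>admissible\<close> below the root into the separate global conditions.\<close>

lemma all_ball_conj:
  "(\<forall>u. E u \<longrightarrow> (\<forall>v\<in>V u. A u v \<and> B u v)) \<longleftrightarrow>
     (\<forall>u. E u \<longrightarrow> (\<forall>v\<in>V u. A u v)) \<and> (\<forall>u. E u \<longrightarrow> (\<forall>v\<in>V u. B u v))"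
  by blast

text \<open>All global conditions become local ones, separated according to whether they concern the
  root, so that \<open>slots_if_admissible\<close> applies to the subtrees of its children.\<close>

lemma trees_n_iff_admissible:
  "t \<in> trees_n (Suc m) n \<longleftrightarrow> finite (verts t) \<and> colour t = Black \<and> charge t = 0 \<and> num_black t = n \<and>
     admissible (Suc m) t \<and>
     (\<forall>u. Edge u \<in> set (halves t) \<longrightarrow> (\<forall>v\<in>verts u. admissible m (subtree u v)))"
proof -
  have pc: "properly_coloured t \<longleftrightarrow> (\<forall>y. Edge y \<in> set (halves t) \<longrightarrow> colour y \<noteq> colour t) \<and>
      (\<forall>u. Edge u \<in> set (halves t) \<longrightarrow> (\<forall>v\<in>verts u.
        \<forall>y. Edge y \<in> set (halves (subtree u v)) \<longrightarrow> colour y \<noteq> colour (subtree u v)))"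
    unfolding properly_coloured_iff
    by (rule all_verts_unfold[of t "\<lambda>s. \<forall>y. Edge y \<in> set (halves s) \<longrightarrow> colour y \<noteq> colour s"])
  have wc: "well_charged t \<longleftrightarrow> (colour t = Black \<longrightarrow> charge t \<le> 1) \<and> (colour t = White \<longrightarrow> charge t \<ge> 0) \<and>
      (\<forall>u. Edge u \<in> set (halves t) \<longrightarrow> (\<forall>v\<in>verts u.
        (colour (subtree u v) = Black \<longrightarrow> charge (subtree u v) \<le> 1) \<and>
        (colour (subtree u v) = White \<longrightarrow> charge (subtree u v) \<ge> 0)))"
    unfolding well_charged_iff
    by (subst all_verts_unfold[of t "\<lambda>s. (colour s = Black \<longrightarrow> charge s \<le> 1) \<and> (colour s = White \<longrightarrow> charge s \<ge> 0)"])
       (rule conj_assoc)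
  show ?thesis
    unfolding trees_n_def mem_Collect_eq regular_iff pc wc num_black_def[symmetric] admissible_def
      all_ball_conj
    by (rule iffI; elim conjE; intro conjI; assumption)
qed

text \<open>At the root, charge \<open>0\<close> reads \<open>d j - d = 0\<close> for the number
  \<open>j\<close> of children. So the root has a single white child as well, and what remains
  is a list of \<open>m\<close> slots without any further constraint than the total size.\<close>

lemma trees_n_Suc:
  "trees_n (Suc m) (Suc n) =
    (\<lambda>(r, l). black_vertex (Suc m) r (Vertex White l)) `
      ({..m} \<times> {l. length l = m \<and> (\<forall>x\<in>set l. slot m x) \<and> sum_list (map weight l) = n})"
  (is "_ = ?R")
proof (rule set_eqI, rule iffI)
  fix t assume "t \<in> trees_n (Suc m) (Suc n)"
  then have fin: "finite (verts t)" and t: "colour t = Black" "charge t = 0" "num_black t = Suc n"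
    "admissible (Suc m) t" and adm: "\<And>u. Edge u \<in> set (halves t) \<Longrightarrow> \<forall>v\<in>verts u. admissible m (subtree u v)"
    unfolding trees_n_iff_admissible by blast+
  have len: "length (halves t) = Suc m" using t(4) by (simp add: admissible_def)
  have col: "colour y = White" if "Edge y \<in> set (halves t)" for y
    using admissible_childD[OF t(4) that] t(1) by simp
  have finc: "finite (verts y)" if "Edge y \<in> set (halves t)" for y
    using fin that by (simp add: finite_verts_iff[of t])
  have ch: "charge y = int m \<and> (\<forall>x\<in>set (halves y). slot m x)" if "Edge y \<in> set (halves t)" for y
    using slots_if_admissible[OF finc[OF that] adm[OF that]] col[OF that] by simp
  define j where "j = length (filter (\<lambda>x. x \<noteq> Stem) (halves t))"
  have "(int m + 1) * int j - int (Suc m) = 0"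
    using charge_unfold[OF fin] t ch sum_list_const_edges[of "halves t" charge "int m"] len
    by (simp add: j_def)
  then have "(int m + 1) * int j = (int m + 1) * 1" by simp
  then have "j = 1" by (subst (asm) mult_cancel_left) auto
  then obtain q w where qw: "q < Suc m" "halves t = (replicate (Suc m) Stem)[q := Edge w]"
    using one_edge_if_count[of "halves t"] len j_def by auto
  then have tw: "t = black_vertex (Suc m) q w"
    using t(1) by (cases t) (simp add: black_vertex_def)
  have w: "Edge w \<in> set (halves t)" using qw tw using Edge_in_black_vertex by blast
  have ww: "w = Vertex White (halves w)" using col[OF w] by (cases w) simp
  have lw: "length (halves w) = m" 
    using adm[OF w] unfolding all_verts_unfold[of w] by (simp add: admissible_def)
  have "num_black w = n" using num_black_black_vertex[OF qw(1) finc[OF w]] t(3) tw by simp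
  then have "sum_list (map weight (halves w)) = n" using num_black_unfold[OF finc[OF w]] col[OF w] by simp
  then show "t \<in> ?R" using tw ww lw ch[OF w] qw(1)
    by (intro image_eqI[of _ _ "(q, halves w)"]) auto
next
  fix t assume "t \<in> ?R"
  then obtain z where z: "z \<in> {..m} \<times> {l. length l = m \<and> (\<forall>x\<in>set l. slot m x) \<and> sum_list (map weight l) = n}"
    "t = (case z of (r, l) \<Rightarrow> black_vertex (Suc m) r (Vertex White l))" by blast
  obtain r l where rl: "z = (r, l)" by (cases z)
  then have r: "r < Suc m" and l: "length l = m" "\<forall>x\<in>set l. slot m x" "sum_list (map weight l) = n"
    and t: "t = black_vertex (Suc m) r (Vertex White l)" using z by auto
  let ?w = "Vertex White l"
  have w: "finite (verts ?w)" "charge ?w = int m"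
    "\<forall>v\<in>verts ?w. admissible m (subtree ?w v) \<and> regular_shape m (subtree ?w v)"
    using white_vertex_of_slots[of l m] l slot_properties by blast+
  have fin: "finite (verts t)"
    using w(1) r unfolding t by (subst finite_verts_iff) (auto simp: Edge_in_black_vertex)
  have ch: "charge t = 0" using charge_black_vertex[OF r w(1)] w(2) t by simp
  have "num_black t = Suc n"
    using num_black_black_vertex[OF r w(1)] num_black_unfold[OF w(1)] l(3) t by simp
  moreover have "admissible (Suc m) t" using ch r by (auto simp: admissible_def t Edge_in_black_vertex)
  ultimately show "t \<in> trees_n (Suc m) (Suc n)"
    using fin ch w r unfolding trees_n_iff_admissible by (auto simp: t Edge_in_black_vertex)
qed

section \<open>Generating functions of forests\<close>

definition forests :: "nat \<Rightarrow> nat \<Rightarrow> btree half_edge list set" where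
  "forests m n = {l. (\<forall>x\<in>set l. slot m x) \<and> sum_list (map weight l) = n}"

text \<open>Only lists of slots are counted, so statements about \<open>forest_gf\<close> may ignore
  other members of \<open>X\<close>. Since infinite sets have cardinality \<open>0\<close>,
  the definition is meaningful for sets of lists of a fixed length.\<close>

definition forest_gf :: "nat \<Rightarrow> btree half_edge list set \<Rightarrow> real fps" where
  "forest_gf m X = Abs_fps (\<lambda>n. real (card (X \<inter> forests m n)))"

definition slot_gf :: "nat \<Rightarrow> btree half_edge set \<Rightarrow> real fps" where
  "slot_gf m Y = forest_gf m ((\<lambda>x. [x]) ` Y)"

definition branch :: "nat \<Rightarrow> nat \<Rightarrow> btree half_edge list \<Rightarrow> btree half_edge" where
  "branch m q l = Edge (black_vertex m q (Vertex White l))"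

lemma branch_eq_iff [simp]: "q < m \<Longrightarrow> branch m q l = branch m r l' \<longleftrightarrow> q = r \<and> l = l'"
  by (auto simp: branch_def black_vertex_eq_iff)

lemma branch_neq_Stem [simp]: "branch m q l \<noteq> Stem" "Stem \<noteq> branch m q l"
  by (simp_all add: branch_def)

lemma slot_cases:
  assumes "slot m x"
  obtains "x = Stem"
    | q l where "x = branch m q l" "q < m" "length l = m" "\<forall>y\<in>set l. slot m y"
  using assms unfolding branch_def by cases auto

lemma slot_branch_iff:
  assumes "q < m" "length l = m"
  shows "slot m (branch m q l) \<longleftrightarrow> (\<forall>x\<in>set l. slot m x)"
proof
  assume "slot m (branch m q l)"
  then show "\<forall>x\<in>set l. slot m x" using assms by (elim slot_cases) auto
next
  assume "\<forall>x\<in>set l. slot m x"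
  then show "slot m (branch m q l)" unfolding branch_def using assms by (intro slot.Edge)
qed

lemma slot_Stem [simp]: "slot m Stem" by (rule slot.Stem)

lemma weight_Stem [simp]: "weight Stem = 0" by (simp add: weight_def)

lemma weight_branch:
  assumes "q < m" "\<forall>x\<in>set l. slot m x"
  shows "weight (branch m q l) = Suc (sum_list (map weight l))"
proof -
  have fin: "finite (verts (Vertex White l))"
    using assms(2) slot_properties by (subst finite_verts_iff) fastforce
  from num_black_unfold[OF fin] num_black_black_vertex[OF assms(1) fin] show ?thesis
    by (simp add: branch_def weight_def)
qed

text \<open>By induction on the size: a nonempty slot is a position and a list of \<open>m\<close> slots
  of smaller size.\<close>

lemma finite_slots: "finite {x. slot m x \<and> weight x \<le> n}"
proof (induction n)
  case 0
  have "{x. slot m x \<and> weight x \<le> 0} \<subseteq> {Stem}"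
    by (auto elim!: slot_cases simp: weight_branch)
  then show ?case by (rule finite_subset) simp
next
  case (Suc n)
  let ?L = "{l. set l \<subseteq> {x. slot m x \<and> weight x \<le> n} \<and> length l = m}"
  have "{x. slot m x \<and> weight x \<le> Suc n} \<subseteq> insert Stem ((\<lambda>(q, l). branch m q l) ` ({..<m} \<times> ?L))"
  proof
    fix x assume "x \<in> {x. slot m x \<and> weight x \<le> Suc n}"
    then have x: "slot m x" "weight x \<le> Suc n" by auto
    from x(1) show "x \<in> insert Stem ((\<lambda>(q, l). branch m q l) ` ({..<m} \<times> ?L))"
    proof (cases rule: slot_cases)
      case (2 q l)
      have "weight y \<le> n" if "y \<in> set l" for y
        using member_le_sum_list[of "weight y" "map weight l"] that x(2) 2 by (auto simp: weight_branch)
      then show ?thesis using 2 by (intro insertI2 image_eqI[of _ _ "(q, l)"]) auto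
    qed simp
  qed
  moreover have "finite ?L" by (rule finite_lists_length_eq[OF Suc])
  ultimately show ?case by (meson finite_SigmaI finite_imageI finite_insert finite_lessThan finite_subset)
qed

lemma finite_forests:
  assumes "X \<subseteq> {l. length l = k}"
  shows "finite (X \<inter> forests m n)"
proof (rule finite_subset)
  show "X \<inter> forests m n \<subseteq> {l. set l \<subseteq> {x. slot m x \<and> weight x \<le> n} \<and> length l = k}"
    using assms by (auto simp: forests_def intro!: member_le_sum_list)
  show "finite \<dots>" by (rule finite_lists_length_eq[OF finite_slots])
qed

lemma forest_gf_cong: "(\<And>l. \<forall>x\<in>set l. slot m x \<Longrightarrow> l \<in> X \<longleftrightarrow> l \<in> Y) \<Longrightarrow> forest_gf m X = forest_gf m Y"
  unfolding forest_gf_def by (rule arg_cong[of _ _ Abs_fps], intro ext arg_cong[of _ _ "\<lambda>A. real (card A)"])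
    (auto simp: forests_def)

lemma slot_gf_cong: "(\<And>x. slot m x \<Longrightarrow> x \<in> X \<longleftrightarrow> x \<in> Y) \<Longrightarrow> slot_gf m X = slot_gf m Y"
  unfolding slot_gf_def by (rule forest_gf_cong) auto

lemma forest_gf_empty [simp]: "forest_gf m {} = 0" "slot_gf m {} = 0"
  by (simp_all add: forest_gf_def slot_gf_def fps_eq_iff)

lemma forest_gf_Un:
  assumes "X \<inter> Y = {}" "X \<subseteq> {l. length l = k}" "Y \<subseteq> {l. length l = k}"
  shows "forest_gf m (X \<union> Y) = forest_gf m X + forest_gf m Y"
proof (rule fps_ext)
  fix n
  have "card ((X \<union> Y) \<inter> forests m n) = card (X \<inter> forests m n) + card (Y \<inter> forests m n)"
    unfolding Int_Un_distrib2 using assms by (intro card_Un_disjoint finite_forests) auto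
  then show "fps_nth (forest_gf m (X \<union> Y)) n = fps_nth ((forest_gf m X + forest_gf m Y)) n" by (simp add: forest_gf_def)
qed

lemma slot_gf_Un: "X \<inter> Y = {} \<Longrightarrow> slot_gf m (X \<union> Y) = slot_gf m X + slot_gf m Y"
  unfolding slot_gf_def image_Un by (rule forest_gf_Un[of _ _ 1]) auto

lemma slot_gf_UN:
  assumes "finite I" "\<And>i j. i \<in> I \<Longrightarrow> j \<in> I \<Longrightarrow> i \<noteq> j \<Longrightarrow> Y i \<inter> Y j = {}"
  shows "slot_gf m (\<Union>i\<in>I. Y i) = (\<Sum>i\<in>I. slot_gf m (Y i))"
  using assms
proof (induction I rule: finite_induct)
  case (insert i I)
  have "slot_gf m (Y i \<union> (\<Union>j\<in>I. Y j)) = slot_gf m (Y i) + slot_gf m (\<Union>j\<in>I. Y j)"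
    using insert by (intro slot_gf_Un) fastforce
  with insert show ?case by simp
qed simp

lemma forest_gf_Nil: "forest_gf m {[]} = 1"
proof (rule fps_ext)
  fix n
  have "{[]} \<inter> forests m n = (if n = 0 then {[]} else {})" by (auto simp: forests_def)
  then show "fps_nth (forest_gf m {[]}) n = fps_nth (1) n" by (simp add: forest_gf_def)
qed

lemma slot_gf_Stem: "slot_gf m {Stem} = 1"
proof (rule fps_ext)
  fix n
  have "{[Stem]} \<inter> forests m n = (if n = 0 then {[Stem]} else {})" by (auto simp: forests_def)
  then show "fps_nth (slot_gf m {Stem}) n = fps_nth (1) n" by (simp add: forest_gf_def slot_gf_def)
qed

text \<open>Sizes are additive, so the number of lists of size \<open>n\<close> is the convolution over
  the size of the first half-edge.\<close>

lemma forest_gf_set_Cons: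
  assumes L: "L \<subseteq> {l. length l = k}"
  shows "forest_gf m (set_Cons Y L) = slot_gf m Y * forest_gf m L"
proof (rule fps_ext)
  fix n
  let ?A = "\<lambda>i. ((\<lambda>x. [x]) ` Y) \<inter> forests m i" and ?B = "\<lambda>i. L \<inter> forests m i"
  have fin: "finite (?A i)" "finite (?B i)" for i
    using L finite_forests[of "(\<lambda>x. [x]) ` Y" 1] by (auto intro: finite_forests)
  have eq: "set_Cons Y L \<inter> forests m n = (\<Union>i\<in>{0..n}. (\<lambda>(a, b). a @ b) ` (?A i \<times> ?B (n - i)))"
    (is "?l = ?r")
  proof
    show "?l \<subseteq> ?r"
    proof
      fix l assume "l \<in> ?l"
      then obtain x l' where l: "l = x # l'" "x \<in> Y" "l' \<in> L" "l \<in> forests m n"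
        by (auto simp: set_Cons_def)
      then have "([x], l') \<in> ?A (weight x) \<times> ?B (n - weight x)" "weight x \<le> n"
        by (auto simp: forests_def)
      then show "l \<in> ?r" using l(1) by (intro UN_I[of "weight x"] image_eqI[of _ _ "([x], l')"]) auto
    qed
    show "?r \<subseteq> ?l" by (auto simp: set_Cons_def forests_def)
  qed
  have "card (set_Cons Y L \<inter> forests m n) =
      (\<Sum>i\<in>{0..n}. card ((\<lambda>(a, b). a @ b) ` (?A i \<times> ?B (n - i))))"
    unfolding eq
  proof (rule card_UN_disjoint)
    show "\<forall>i\<in>{0..n}. finite ((\<lambda>(a, b). a @ b) ` (?A i \<times> ?B (n - i)))"
      using fin by blast
  qed (auto simp: forests_def)
  also have "\<dots> = (\<Sum>i\<in>{0..n}. card (?A i) * card (?B (n - i)))"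
    by (intro sum.cong refl, subst card_image) (auto simp: inj_on_def card_cartesian_product)
  finally show "fps_nth (forest_gf m (set_Cons Y L)) n = fps_nth ((slot_gf m Y * forest_gf m L)) n"
    by (simp add: forest_gf_def slot_gf_def fps_mult_nth)
qed

lemma listset_subset: "listset Ys \<subseteq> {l. length l = length Ys}"
  by (induction Ys) (auto simp: set_Cons_def)

lemma in_listset: "l \<in> listset Ys \<longleftrightarrow> list_all2 (\<in>) l Ys"
proof (induction Ys arbitrary: l)
  case (Cons Y Ys)
  then show ?case by (cases l) (auto simp: set_Cons_def)
qed simp

lemma forest_gf_listset: "forest_gf m (listset Ys) = prod_list (map (slot_gf m) Ys)"
  by (induction Ys) (simp_all add: forest_gf_Nil forest_gf_set_Cons[OF listset_subset])

lemma forest_gf_product: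
  "forest_gf m {l. length l = k \<and> (\<forall>i<k. l ! i \<in> Y i)} = (\<Prod>i<k. slot_gf m (Y i))"
proof -
  have "{l. length l = k \<and> (\<forall>i<k. l ! i \<in> Y i)} = listset (map Y [0..<k])"
    by (auto simp: in_listset list_all2_conv_all_nth)
  moreover have "prod_list (map f [0..<k]) = (\<Prod>i<k. f i)" for f :: "nat \<Rightarrow> real fps"
    by (induction k) (auto simp: mult.commute)
  ultimately show ?thesis by (simp add: forest_gf_listset o_def)
qed

lemma forest_gf_all_in: "forest_gf m {l. length l = k \<and> set l \<subseteq> Y} = slot_gf m Y ^ k"
proof -
  have "{l. length l = k \<and> set l \<subseteq> Y} = {l. length l = k \<and> (\<forall>i<k. l ! i \<in> Y)}"
    by (auto simp: set_conv_nth)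
  then show ?thesis using forest_gf_product[of m k "\<lambda>_. Y"] by simp
qed

lemma slot_gf_branch:
  assumes "q < m" "X \<subseteq> {l. length l = m}"
  shows "slot_gf m (branch m q ` X) = fps_X * forest_gf m X"
proof (rule fps_ext)
  fix n
  have "(\<lambda>x. [x]) ` branch m q ` X \<inter> forests m n =
      (case n of 0 \<Rightarrow> {} | Suc k \<Rightarrow> (\<lambda>l. [branch m q l]) ` (X \<inter> forests m k))"
    using assms by (auto simp: forests_def slot_branch_iff weight_branch split: nat.splits)
  moreover have "card ((\<lambda>l. [branch m q l]) ` (X \<inter> forests m k)) = card (X \<inter> forests m k)" for k
    using assms by (intro card_image) (auto simp: inj_on_def)
  ultimately show "fps_nth (slot_gf m (branch m q ` X)) n = fps_nth ((fps_X * forest_gf m X)) n"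
    by (simp add: slot_gf_def forest_gf_def split: nat.splits)
qed

lemma slot_gf_branches:
  assumes "X \<subseteq> {l. length l = m}"
  shows "slot_gf m (\<Union>q<m. branch m q ` X) = of_nat m * fps_X * forest_gf m X"
proof -
  have "slot_gf m (\<Union>q<m. branch m q ` X) = (\<Sum>q<m. slot_gf m (branch m q ` X))"
    by (rule slot_gf_UN) auto
  also have "\<dots> = (\<Sum>q<m. fps_X * forest_gf m X)"
    using assms by (intro sum.cong refl slot_gf_branch) auto
  finally show ?thesis by simp
qed

text \<open>The recursive equation for slots whose first generation is constrained to \<open>Y\<close>.
  With \<open>Y = UNIV\<close> it gives the equation for all slots, and iterating it from the
  stem enumerates slots of bounded height.\<close>

lemma slot_gf_Stem_or_branch:
  "slot_gf m (insert Stem (\<Union>q<m. branch m q ` {l. length l = m \<and> set l \<subseteq> Y})) =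
     1 + of_nat m * fps_X * slot_gf m Y ^ m"
proof -
  let ?B = "\<Union>q<m. branch m q ` {l. length l = m \<and> set l \<subseteq> Y}"
  have "slot_gf m ({Stem} \<union> ?B) = 1 + slot_gf m ?B"
    by (subst slot_gf_Un) (auto simp: slot_gf_Stem)
  also have "slot_gf m ?B = of_nat m * fps_X * slot_gf m Y ^ m"
    by (subst slot_gf_branches) (auto simp: forest_gf_all_in)
  finally show ?thesis by simp
qed

lemma slot_gf_UNIV: "slot_gf m UNIV = 1 + of_nat m * fps_X * slot_gf m UNIV ^ m"
proof -
  have "slot_gf m UNIV = slot_gf m (insert Stem (\<Union>q<m. branch m q ` {l. length l = m \<and> set l \<subseteq> UNIV}))"
    by (rule slot_gf_cong) (auto elim!: slot_cases)
  then show ?thesis using slot_gf_Stem_or_branch[of m UNIV] by simp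
qed

text \<open>Constraining some of the half-edges at given positions to \<open>D\<close> replaces as many
  factors of the product.\<close>

lemma forest_gf_marked:
  assumes "I \<subseteq> {..<k}"
  shows "forest_gf m {l. length l = k \<and> (\<forall>i\<in>I. l ! i \<in> D)} = slot_gf m D ^ card I * slot_gf m UNIV ^ (k - card I)"
proof -
  define Y where "Y i = (if i \<in> I then D else UNIV)" for i
  have "{l. length l = k \<and> (\<forall>i\<in>I. l ! i \<in> D)} = {l. length l = k \<and> (\<forall>i<k. l ! i \<in> Y i)}"
    using assms by (auto simp: Y_def)
  then have "forest_gf m {l. length l = k \<and> (\<forall>i\<in>I. l ! i \<in> D)} = (\<Prod>i<k. slot_gf m (Y i))"
    by (simp only: forest_gf_product)
  also have "\<dots> = (\<Prod>i<k. if i \<in> I then slot_gf m D else slot_gf m UNIV)"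
    by (intro prod.cong) (auto simp: Y_def)
  also have "\<dots> = slot_gf m D ^ card ({..<k} \<inter> I) * slot_gf m UNIV ^ card ({..<k} - I)"
    by (subst prod.If_cases) (auto simp: Diff_eq)
  also have "{..<k} \<inter> I = I" using assms by auto
  also have "card ({..<k} - I) = k - card I"
    using assms finite_subset[OF assms] by (subst card_Diff_subset) auto
  finally show ?thesis .
qed

section \<open>Coefficient asymptotics\<close>

text \<open>The asymptotic study only uses the functional equation of the generating function.\<close>

locale tree_series =
  fixes m :: nat and G :: "real fps"
  assumes m: "m \<ge> 2" and G: "G = 1 + of_nat m * fps_X * G ^ m"
begin

abbreviation coef :: "nat \<Rightarrow> nat \<Rightarrow> real" where
  "coef k n \<equiv> fps_nth (G ^ k) n"

text \<open>The first of \<open>k + 1\<close> slots is empty, or it is replaced by the \<open>m\<close>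
  slots of its white vertex.\<close>

lemma coef_rec: "coef (Suc k) (Suc n) = coef k (Suc n) + real m * coef (m + k) n"
proof -
  have "G ^ Suc k = G ^ k + of_nat m * (fps_X * G ^ (m + k))"
    by (subst (1) power_Suc, subst (1) G) (simp add: algebra_simps power_add)
  then show ?thesis by (simp add: fps_mult_of_nat_nth)
qed

lemma coef_0: "coef k 0 = 1"
proof -
  have "fps_nth G 0 = 1" by (subst G) simp
  then show ?thesis by (simp add: fps_nth_power_0)
qed

lemma le_mult_m: "n \<le> m * n + k" for n k :: nat
  using m by (cases m) auto

text \<open>The ballot-type numbers \<open>k / (m n + k) \<cdot> ((m n + k) choose n)\<close>, scaled by
  \<open>m\<^sup>n\<close>, satisfy the recurrence \<open>coef_rec\<close>; so no inversion of
  the functional equation is needed.\<close>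

lemma coef_formula: "real (m * n + k) * coef k n = real m ^ n * real k * real ((m * n + k) choose n)"
proof (induction n arbitrary: k)
  case 0
  then show ?case by (simp add: coef_0)
next
  case (Suc n)
  note IH = Suc
  show ?case
  proof (induction k)
    case 0
    then show ?case by simp
  next
    case (Suc k)
    define N where "N = m * Suc n + Suc k"
    define b where "b = real (N choose Suc n)"
    define b1 where "b1 = real ((N - 1) choose Suc n)"
    define b2 where "b2 = real ((N - 1) choose n)"
    have "N > 1" using m by (simp add: N_def)
    then have N1: "real (N - 1) > 0" "real N > 0" by auto
    have Nk: "real N = real m * real (Suc n) + real k + 1" "real (N - 1) = real N - 1"
      by (auto simp: N_def algebra_simps)
    have "Suc n \<le> N" using le_mult_m[of "Suc n" "Suc k"] by (simp add: N_def)
    have e1: "real (N - 1) * coef k (Suc n) = real m ^ Suc n * real k * b1"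
      using Suc by (simp add: N_def b1_def)
    have "m * n + (m + k) = N - 1" by (simp add: N_def)
    then have e2: "real (N - 1) * coef (m + k) n = real m ^ n * real (m + k) * b2"
      using IH[of "m + k"] unfolding b2_def by metis
    have "(N - Suc n) * (N choose Suc n) = N * ((N - 1) choose Suc n)"
      by (rule binomial_absorb_comp)
    then have b1: "real N * b1 = (real N - real (Suc n)) * b"
      unfolding b_def b1_def using \<open>Suc n \<le> N\<close> by (metis of_nat_mult of_nat_diff)
    have "Suc n * (N choose Suc n) = N * ((N - 1) choose n)"
      using Suc_times_binomial[of n "N - 1"] \<open>Suc n \<le> N\<close> by (cases N) auto
    then have b2: "real N * b2 = real (Suc n) * b"
      unfolding b_def b2_def by (metis of_nat_mult)
    \<comment> \<open>The factor \<open>N (N - 1)\<close> expresses both terms of the recurrence through the binomial coefficient \<open>b\<close>.\<close>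
    have "real (N - 1) * (real N * coef (Suc k) (Suc n)) =
        real N * (real (N - 1) * coef k (Suc n) + real m * (real (N - 1) * coef (m + k) n))"
      unfolding coef_rec by (simp add: algebra_simps)
    also have "\<dots> = real m ^ Suc n * (real k * (real N * b1) + real (m + k) * (real N * b2))"
      unfolding e1 e2 by (simp add: algebra_simps)
    also have "\<dots> = real m ^ Suc n * (real k * ((real N - real (Suc n)) * b) + real (m + k) * (real (Suc n) * b))"
      by (simp only: b1 b2)
    also have "\<dots> = real (N - 1) * (real m ^ Suc n * real (Suc k) * b)"
      unfolding Nk by (simp add: algebra_simps)
    finally have "real N * coef (Suc k) (Suc n) = real m ^ Suc n * real (Suc k) * b"
      using N1 by simp
    then show ?case unfolding b_def N_def .
  qed
qed

lemma coef_pos: "k \<ge> 1 \<Longrightarrow> coef k n > 0"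
proof -
  assume k: "k \<ge> 1"
  have "real (m * n + k) * coef k n > 0"
    unfolding coef_formula using k m le_mult_m[of n k] by (auto intro!: mult_pos_pos)
  moreover have "real (m * n + k) \<ge> 0" by simp
  ultimately show ?thesis by (metis mult_nonneg_nonpos not_less)
qed

text \<open>The values of \<open>G\<close> and of the variable at the dominant singularity. They are the
  double solution of \<open>y = 1 + m z y\<^sup>m\<close>, but enter below as limits of ratios
  of coefficients.\<close>

definition tau :: real where "tau = real m / (real m - 1)"
definition rho :: real where "rho = 1 / (real m ^ 2 * tau ^ (m - 1))"

lemma tau_gt_1: "tau > 1"
  using m by (simp add: tau_def field_simps)

lemma rho_pos: "rho > 0"
  using m tau_gt_1 by (simp add: rho_def)

lemma coef_ratio: "k \<ge> 1 \<Longrightarrow>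
  coef (Suc k) n / coef k n = (real k + 1) / real k * ((real m * real n + real k) / ((real m - 1) * real n + real k + 1))"
proof -
  assume k: "k \<ge> 1"
  define M where "M = m * n + k"
  define b where "b = real (M choose n)"
  have M: "M > 0" "n \<le> M" using k le_mult_m[of n k] by (auto simp: M_def)
  have b: "b > 0" using M by (simp add: b_def)
  have e1: "real M * coef k n = real m ^ n * real k * b"
    using coef_formula[of n k] by (simp add: M_def b_def)
  have e2: "real (Suc M) * coef (Suc k) n = real m ^ n * real (Suc k) * real (Suc M choose n)"
    using coef_formula[of n "Suc k"] by (simp add: M_def)
  have "(Suc M - n) * (Suc M choose n) = Suc M * (M choose n)"
    using binomial_absorb_comp[of "Suc M" n] by simp
  then have "(real (Suc M) - real n) * real (Suc M choose n) = real (Suc M) * b"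
    unfolding b_def using M by (metis le_SucI of_nat_diff of_nat_mult)
  then have e3: "real (Suc M choose n) = real (Suc M) * b / (real (Suc M) - real n)"
    using M by (simp add: field_simps)
  have c1: "coef k n = real m ^ n * real k * b / real M" using e1 M by (simp add: field_simps)
  have "coef (Suc k) n = real m ^ n * real (Suc k) * real (Suc M choose n) / real (Suc M)"
    using e2 by (simp add: field_simps)
  then have c2: "coef (Suc k) n = real m ^ n * real (Suc k) * b / (real (Suc M) - real n)"
    unfolding e3 by simp
  have "real (Suc M) - real n > 0" using M by simp
  then have "coef (Suc k) n / coef k n = real (Suc k) / real k * (real M / (real (Suc M) - real n))"
    unfolding c1 c2 using b m k M by (simp add: divide_simps)
  also have "real (Suc M) - real n = (real m - 1) * real n + real k + 1"
    by (simp add: M_def algebra_simps)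
  finally show ?thesis by (simp add: M_def add.commute)
qed

lemma coef_limit: "(\<lambda>n. coef k n / coef 1 n) \<longlonglongrightarrow> real k * tau ^ (k - 1)"
proof (induction k)
  case 0
  have "(\<lambda>n. coef 0 (Suc n) / coef 1 (Suc n)) \<longlonglongrightarrow> 0" by simp
  then show ?case by (subst (asm) filterlim_sequentially_Suc) simp
next
  case (Suc k)
  show ?case
  proof (cases "k = 0")
    case True
    have "coef 1 n > 0" for n by (rule coef_pos) simp
    then have "coef 1 n \<noteq> 0" for n by (metis less_irrefl)
    then show ?thesis using True by (simp add: tendsto_const)
  next
    case False
    define a where "a = real m - 1"
    have "a > 0" using m by (simp add: a_def)
    then have "(\<lambda>n. ((a + 1) * real n + real k) / (a * real n + real k + 1)) \<longlonglongrightarrow> (a + 1) / a"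
      by real_asymp (simp add: field_simps)
    then have "(\<lambda>n. (real m * real n + real k) / ((real m - 1) * real n + real k + 1)) \<longlonglongrightarrow> tau"
      by (simp add: a_def tau_def)
    then have "(\<lambda>n. coef (Suc k) n / coef k n) \<longlonglongrightarrow> (real k + 1) / real k * tau"
      using False by (subst coef_ratio) (auto simp only: intro!: tendsto_mult tendsto_const)
    from tendsto_mult[OF this Suc]
    have "(\<lambda>n. coef (Suc k) n / coef k n * (coef k n / coef 1 n)) \<longlonglongrightarrow>
        (real k + 1) / real k * tau * (real k * tau ^ (k - 1))" .
    moreover have "coef (Suc k) n / coef k n * (coef k n / coef 1 n) = coef (Suc k) n / coef 1 n" for n
      using coef_pos[of k n] False by simp
    moreover have "(real k + 1) / real k * tau * (real k * tau ^ (k - 1)) = real (Suc k) * tau ^ (Suc k - 1)"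
      using False by (cases k) (auto simp: field_simps)
    ultimately show ?thesis by (simp only:)
  qed
qed

text \<open>The recurrence with \<open>k = 0\<close> expresses a shift of the index by one through the
  \<open>m\<close>-th power, whose coefficients have been compared with those of
  \<open>G\<close> already.\<close>

lemma coef_shift_limit: "(\<lambda>n. coef 1 n / coef 1 (Suc n)) \<longlonglongrightarrow> rho"
proof -
  have "coef 1 (Suc n) = real m * coef m n" for n
    using coef_rec[of 0 n] by simp
  then have eq: "inverse (real m * (coef m n / coef 1 n)) = coef 1 n / coef 1 (Suc n)" for n
    by (metis inverse_divide times_divide_eq_right)
  have "(\<lambda>n. inverse (real m * (coef m n / coef 1 n))) \<longlonglongrightarrow> inverse (real m * (real m * tau ^ (m - 1)))"
    using m tau_gt_1 by (intro tendsto_intros coef_limit) auto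
  then show ?thesis
    unfolding eq by (simp add: rho_def field_simps power2_eq_square)
qed

lemma shift_limit:
  assumes "(\<lambda>n. fps_nth A n / coef 1 n) \<longlonglongrightarrow> L"
  shows "(\<lambda>n. fps_nth (fps_X * A) n / coef 1 n) \<longlonglongrightarrow> rho * L"
proof -
  have "(\<lambda>n. coef 1 n / coef 1 (Suc n) * (fps_nth A n / coef 1 n)) \<longlonglongrightarrow> rho * L"
    by (intro tendsto_mult coef_shift_limit assms)
  moreover have "coef 1 n / coef 1 (Suc n) * (fps_nth A n / coef 1 n) = fps_nth (fps_X * A) (Suc n) / coef 1 (Suc n)" for n
    using coef_pos[of 1 n] by simp
  ultimately show ?thesis by (subst filterlim_sequentially_Suc[symmetric]) simp
qed

text \<open>The limit is a linear functional of \<open>p G\<^sup>k\<close>: evaluation at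
  \<open>\<rho>\<close> of \<open>p\<close> and derivation at \<open>\<tau>\<close> of the
  power. The derivative expresses that, in a large forest, a single one of the
  \<open>k\<close> trees is large and the others keep their weight \<open>\<tau>\<close>. For
  \<open>k = 0\<close> the factor \<open>k\<close> makes the truncated exponent harmless.\<close>

lemma poly_power_limit:
  "(\<lambda>n. fps_nth (fps_of_poly p * G ^ k) n / coef 1 n) \<longlonglongrightarrow> poly p rho * (real k * tau ^ (k - 1))"
proof (induction p)
  case 0
  then show ?case by simp
next
  case (pCons a p)
  have "(\<lambda>n. a * (coef k n / coef 1 n) + fps_nth (fps_X * (fps_of_poly p * G ^ k)) n / coef 1 n)
     \<longlonglongrightarrow> a * (real k * tau ^ (k - 1)) + rho * (poly p rho * (real k * tau ^ (k - 1)))"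
    by (intro tendsto_add tendsto_mult tendsto_const coef_limit shift_limit pCons)
  moreover have "fps_of_poly (pCons a p) * G ^ k = fps_const a * G ^ k + fps_X * (fps_of_poly p * G ^ k)"
    by (simp add: fps_of_poly_pCons algebra_simps)
  ultimately show ?case by (simp add: algebra_simps add_divide_distrib)
qed

text \<open>Generating functions of slots of bounded height, by \<open>slot_gf_Stem_or_branch\<close>.\<close>

primrec low_poly :: "nat \<Rightarrow> real poly" where
  "low_poly 0 = 1"
| "low_poly (Suc k) = 1 + [:0, real m:] * low_poly k ^ m"

lemma rho_tau: "real m * rho * tau ^ m = tau - 1"
proof -
  have "tau ^ m = tau * tau ^ (m - 1)" using m by (cases m) auto
  then have "real m * rho * tau ^ m = tau / real m"
    using m tau_gt_1 by (simp add: rho_def power2_eq_square)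
  also have "\<dots> = tau - 1" using m by (simp add: tau_def field_simps)
  finally show ?thesis .
qed

text \<open>The map \<open>y \<mapsto> 1 + m \<rho> y\<^sup>m\<close> is convex and tangent to the
  diagonal at \<open>\<tau>\<close>. This criticality is the reason why the trees attached to
  the spine are finite.\<close>

lemma fixed_point_unique:
  assumes "0 \<le> x" "x \<le> tau" "x = 1 + real m * rho * x ^ m"
  shows "x = tau"
proof (rule ccontr)
  assume "x \<noteq> tau"
  \<comment> \<open>In terms of \<open>u\<close> the equation becomes the equality case of Bernoulli's inequality.\<close>
  define u where "u = x / tau"
  have u: "0 \<le> u" "u < 1" "x = u * tau"
    using assms \<open>x \<noteq> tau\<close> tau_gt_1 by (auto simp: u_def)
  have "u * tau - 1 = real m * rho * tau ^ m * u ^ m"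
    using assms(3) unfolding u(3) by (simp add: power_mult_distrib)
  also have "\<dots> = (tau - 1) * u ^ m" by (simp add: rho_tau)
  also have "tau - 1 = 1 / (real m - 1)" using m by (simp add: tau_def field_simps)
  finally have "u ^ m = 1 - real m * (1 - u)"
    using m by (simp add: tau_def field_simps)
  moreover have "1 - u ^ m = (1 - u) * (\<Sum>i<m. u ^ i)"
    by (rule one_diff_power_eq)
  ultimately have "(\<Sum>i<m. u ^ i) = real m" using u by simp
  moreover have "(\<Sum>i<m. u ^ i) < (\<Sum>i<m. 1)"
  proof (rule sum_strict_mono_ex1)
    show "\<forall>i\<in>{..<m}. u ^ i \<le> 1" using u by (simp add: power_le_one)
    show "\<exists>i\<in>{..<m}. u ^ i < 1" using u m by (intro bexI[of _ 1]) auto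
  qed simp
  ultimately show False by simp
qed

text \<open>The values at \<open>\<rho>\<close> are the iterates of a monotone map that starts below its
  fixed point \<open>\<tau>\<close>, so they increase to a fixed point, and there is no
  smaller one.\<close>

lemma low_poly_limit: "(\<lambda>k. poly (low_poly k) rho) \<longlonglongrightarrow> tau"
proof -
  define x where "x k = poly (low_poly k) rho" for k
  have x0: "x 0 = 1" and xS: "x (Suc k) = 1 + real m * rho * x k ^ m" for k
    by (simp_all add: x_def algebra_simps)
  have c: "real m * rho \<ge> 0" using rho_pos by simp
  have bd: "1 \<le> x k \<and> x k \<le> tau" for k
  proof (induction k)
    case (Suc k)
    have "x k ^ m \<le> tau ^ m" using Suc by (intro power_mono) auto
    then have "real m * rho * x k ^ m \<le> tau - 1"
      using mult_left_mono[OF _ c, of "x k ^ m" "tau ^ m"] by (simp add: rho_tau)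
    then show ?case using Suc c by (simp add: xS)
  qed (use tau_gt_1 x0 in simp)
  have inc: "x k \<le> x (Suc k)" for k
  proof (induction k)
    case (Suc k)
    have "x k ^ m \<le> x (Suc k) ^ m" using Suc bd[of k] by (intro power_mono) auto
    then show ?case using mult_left_mono[OF _ c, of "x k ^ m" "x (Suc k) ^ m"] by (simp add: xS[of "Suc k"] xS[of k])
  qed (use bd[of 1] x0 in simp)
  have "convergent x"
  proof (rule Bseq_monoseq_convergent)
    show "Bseq x" using bd by (intro BseqI'[of _ tau]) (simp add: abs_of_nonneg order_trans[OF zero_le_one])
    show "monoseq x" using inc by (simp add: monoseq_Suc)
  qed
  then obtain L where L: "x \<longlonglongrightarrow> L" by (auto simp: convergent_def)
  have "(\<lambda>k. x (Suc k)) \<longlonglongrightarrow> 1 + real m * rho * L ^ m"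
    unfolding xS by (intro tendsto_intros L)
  moreover have "(\<lambda>k. x (Suc k)) \<longlonglongrightarrow> L" using L by (rule LIMSEQ_Suc)
  ultimately have "L = 1 + real m * rho * L ^ m" using LIMSEQ_unique by blast
  moreover have "L \<le> tau" using bd by (intro LIMSEQ_le_const2[OF L]) auto
  moreover have "0 \<le> L" using bd by (intro LIMSEQ_le_const[OF L]) (auto intro: order_trans[OF zero_le_one])
  ultimately have "L = tau" by (intro fixed_point_unique)
  with L have "x \<longlonglongrightarrow> tau" by simp
  then show ?thesis unfolding x_def .
qed

text \<open>The functional of \<open>poly_power_limit\<close> applied to \<open>z\<^sup>j y\<^sup>r (y -
  g\<^sub>k)\<^sup>2\<close>.\<close>

definition two_deep_limit :: "nat \<Rightarrow> nat \<Rightarrow> nat \<Rightarrow> real" where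
  "two_deep_limit j r k = (let y = poly (low_poly k) rho in
     rho ^ j * (real (r + 2) * tau ^ (r + 1) - 2 * y * (real (r + 1) * tau ^ r) + y\<^sup>2 * (real r * tau ^ (r - 1))))"

lemma two_deep_coefficient_limit:
  "(\<lambda>n. fps_nth (fps_X ^ j * G ^ r * (G - fps_of_poly (low_poly k))\<^sup>2) n / coef 1 n) \<longlonglongrightarrow> two_deep_limit j r k"
proof -
  let ?p = "low_poly k" and ?z = "monom (1::real) j"
  have z: "fps_of_poly ?z = fps_X ^ j" by (simp add: fps_of_poly_monom')
  have eq: "fps_X ^ j * G ^ r * (G - fps_of_poly ?p)\<^sup>2 =
     fps_of_poly ?z * G ^ (r + 2) - fps_of_poly (2 * ?z * ?p) * G ^ (r + 1) + fps_of_poly (?z * ?p\<^sup>2) * G ^ r"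
    by (simp add: fps_of_poly_mult fps_of_poly_power z power2_eq_square algebra_simps fps_of_poly_numeral)
  have "(\<lambda>n. fps_nth (fps_of_poly ?z * G ^ (r + 2)) n / coef 1 n
      - fps_nth (fps_of_poly (2 * ?z * ?p) * G ^ (r + 1)) n / coef 1 n
      + fps_nth (fps_of_poly (?z * ?p\<^sup>2) * G ^ r) n / coef 1 n) \<longlonglongrightarrow>
    poly ?z rho * (real (r + 2) * tau ^ (r + 2 - 1)) - poly (2 * ?z * ?p) rho * (real (r + 1) * tau ^ (r + 1 - 1))
     + poly (?z * ?p\<^sup>2) rho * (real r * tau ^ (r - 1))"
    by (intro tendsto_add tendsto_diff poly_power_limit)
  then show ?thesis
    unfolding eq by (simp add: two_deep_limit_def Let_def poly_monom algebra_simps add_divide_distrib diff_divide_distrib)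
qed

text \<open>When \<open>g\<^sub>k(\<rho>)\<close> is replaced by \<open>\<tau>\<close>, the expression
  is the derivative at \<open>\<tau>\<close> of a polynomial with a double zero there.\<close>

lemma two_deep_limit_vanishes: "(\<lambda>k. two_deep_limit j r k) \<longlonglongrightarrow> 0"
proof -
  have "(\<lambda>k. two_deep_limit j r k) \<longlonglongrightarrow>
     rho ^ j * (real (r + 2) * tau ^ (r + 1) - 2 * tau * (real (r + 1) * tau ^ r) + tau\<^sup>2 * (real r * tau ^ (r - 1)))"
    unfolding two_deep_limit_def Let_def by (intro tendsto_intros low_poly_limit)
  moreover have "real (r + 2) * tau ^ (r + 1) - 2 * tau * (real (r + 1) * tau ^ r) + tau\<^sup>2 * (real r * tau ^ (r - 1)) = 0"
    by (cases r) (simp_all add: algebra_simps power2_eq_square)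
  ultimately show ?thesis by simp
qed

end

section \<open>Limits of measures in the local topology\<close>

lemma dist_btree_less_iff:
  fixes s t :: btree
  shows "dist s t < inverse (1 + real R) \<longleftrightarrow> tree_ball (Suc R) s = tree_ball (Suc R) t"
  by (simp add: dist_btree_def d_loc_less_iff)

lemma ex_radius: "e > 0 \<Longrightarrow> \<exists>R. inverse (1 + real R) < e"
  using reals_Archimedean[of e] by auto

lemma tree_ball_Suc_eqD: "tree_ball (Suc R) s = tree_ball (Suc R) t \<Longrightarrow> tree_ball R s = tree_ball R t"
  by (metis tree_ball_eq_mono le_SucI order_refl)

lemma closure_iff_tree_balls: "T \<in> closure A \<longleftrightarrow> (\<forall>R. \<exists>t\<in>A. tree_ball R T = tree_ball R t)"
proof
  assume T: "T \<in> closure A"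
  show "\<forall>R. \<exists>t\<in>A. tree_ball R T = tree_ball R t"
  proof
    fix R
    from T obtain t where "t \<in> A" "dist t T < inverse (1 + real R)"
      unfolding closure_approachable by (metis inverse_positive_iff_positive of_nat_0_le_iff add_pos_nonneg zero_less_one)
    then show "\<exists>t\<in>A. tree_ball R T = tree_ball R t"
      unfolding dist_btree_less_iff by (metis tree_ball_Suc_eqD)
  qed
next
  assume R: "\<forall>R. \<exists>t\<in>A. tree_ball R T = tree_ball R t"
  show "T \<in> closure A"
    unfolding closure_approachable
  proof (intro allI impI)
    fix e :: real assume "e > 0"
    then obtain R where R': "inverse (1 + real R) < e" using ex_radius by blast
    obtain t where "t \<in> A" "tree_ball (Suc R) T = tree_ball (Suc R) t" using R by blast
    then show "\<exists>y\<in>A. dist y T < e" using R' dist_btree_less_iff[of t T R] by (metis order.strict_trans)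
  qed
qed

text \<open>The clopen events that depend on a ball of radius \<open>R\<close> only. They form an
  algebra that generates the topology.\<close>

definition ball_determined :: "nat \<Rightarrow> btree set \<Rightarrow> bool" where
  "ball_determined R X \<longleftrightarrow> (\<forall>s t. tree_ball R s = tree_ball R t \<longrightarrow> (s \<in> X \<longleftrightarrow> t \<in> X))"

lemma ball_determinedD:
  assumes "ball_determined R X" "tree_ball R s = tree_ball R t"
  shows "s \<in> X \<longleftrightarrow> t \<in> X"
  by (rule assms(1)[unfolded ball_determined_def, rule_format, OF assms(2)])

lemma ball_determined_mono:
  assumes "ball_determined R X" "R \<le> S"
  shows "ball_determined S X"
  unfolding ball_determined_def
proof (intro allI impI)
  fix s t assume "tree_ball S s = tree_ball S t"
  then show "s \<in> X \<longleftrightarrow> t \<in> X"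
    by (rule ball_determinedD[OF assms(1) tree_ball_eq_mono[OF _ assms(2)]])
qed

lemma ball_determined_Compl:
  assumes "ball_determined R X"
  shows "ball_determined R (- X)"
  unfolding ball_determined_def Compl_iff
proof (intro allI impI)
  fix s t assume "tree_ball R s = tree_ball R t"
  from ball_determinedD[OF assms this] show "(s \<notin> X) = (t \<notin> X)" by simp
qed

lemma ball_determined_Int:
  assumes "ball_determined R X" "ball_determined S Y"
  shows "ball_determined (max R S) (X \<inter> Y)"
proof -
  have "ball_determined (max R S) X" "ball_determined (max R S) Y"
    using assms by (auto intro: ball_determined_mono)
  note * = this[THEN ball_determinedD]
  show ?thesis
    unfolding ball_determined_def Int_iff
  proof (intro allI impI)
    fix s t assume eq: "tree_ball (max R S) s = tree_ball (max R S) t"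
    show "(s \<in> X \<and> s \<in> Y) = (t \<in> X \<and> t \<in> Y)"
      unfolding *(1)[OF eq] *(2)[OF eq] ..
  qed
qed

lemma ball_determined_open:
  assumes "ball_determined R X"
  shows "open X"
  unfolding open_dist
proof
  fix x assume x: "x \<in> X"
  have "y \<in> X" if "dist y x < inverse (1 + real R)" for y
  proof -
    have "tree_ball R y = tree_ball R x" using that unfolding dist_btree_less_iff by (rule tree_ball_Suc_eqD)
    from ball_determinedD[OF assms this] show ?thesis using x by simp
  qed
  then show "\<exists>e>0. \<forall>y. dist y x < e \<longrightarrow> y \<in> X"
    by (intro exI[of _ "inverse (1 + real R)"]) (auto simp: add_pos_nonneg)
qed

lemma ball_determined_closed: "ball_determined R X \<Longrightarrow> closed X"
  unfolding closed_def by (intro ball_determined_open ball_determined_Compl)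

lemma ball_determined_tree_ball: "ball_determined R {t. tree_ball R t = b}"
  by (auto simp: ball_determined_def)

text \<open>Two trees with the same ball of radius \<open>R + 1\<close> are at distance less than
  \<open>1 / (R + 1)\<close>, so finitely many balls mean total boundedness, and the space of
  all trees is complete.\<close>

lemma compact_if_finite_balls:
  assumes "closed S" "\<And>R. finite (tree_ball R ` S)"
  shows "compact S"
  unfolding compact_eq_totally_bounded complete_eq_closed
proof (intro conjI allI impI assms(1))
  fix e :: real assume "e > 0"
  then obtain R where R: "inverse (1 + real R) < e" using ex_radius by blast
  obtain K where K: "K \<subseteq> S" "finite K" "tree_ball (Suc R) ` K = tree_ball (Suc R) ` S"
    using finite_subset_image[OF assms(2)[of "Suc R"] subset_refl] by metis
  have "S \<subseteq> (\<Union>x\<in>K. ball x e)"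
  proof
    fix s assume "s \<in> S"
    then have "tree_ball (Suc R) s \<in> tree_ball (Suc R) ` K" unfolding K(3) by (rule imageI)
    then obtain k where k: "k \<in> K" "tree_ball (Suc R) k = tree_ball (Suc R) s" by (metis imageE)
    have "dist k s < e" using dist_btree_less_iff[THEN iffD2, OF k(2)] R by linarith
    then show "s \<in> (\<Union>x\<in>K. ball x e)" using k(1) by auto
  qed
  with K(2) show "\<exists>k. finite k \<and> S \<subseteq> (\<Union>x\<in>k. ball x e)" by blast
qed

text \<open>An event determined by a ball is a finite disjoint union of events that prescribe the ball.
  Convergence on the latter thus gives convergence on the former.\<close>

lemma finite_balls_decomposition:
  assumes "finite (tree_ball R ` S)" "ball_determined R X" "finite_measure M"
    "sets M = sets (restrict_space borel S)"
  shows "measure M (S \<inter> X) = (\<Sum>b\<in>tree_ball R ` (S \<inter> X). measure M {t \<in> S. tree_ball R t = b})"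
proof -
  interpret finite_measure M by fact
  have "S \<inter> X = (\<Union>b\<in>tree_ball R ` (S \<inter> X). {t \<in> S. tree_ball R t = b})"
    by (auto simp: image_iff intro: assms(2)[unfolded ball_determined_def, rule_format, THEN iffD1])
  moreover have "measure M (\<Union>b\<in>tree_ball R ` (S \<inter> X). {t \<in> S. tree_ball R t = b}) =
      (\<Sum>b\<in>tree_ball R ` (S \<inter> X). measure M {t \<in> S. tree_ball R t = b})"
  proof (rule finite_measure_finite_Union)
    show "finite (tree_ball R ` (S \<inter> X))" by (rule finite_subset[OF _ assms(1)]) auto
    have "{t \<in> S. tree_ball R t = b} \<in> sets M" for b
    proof -
      have "{t \<in> S. tree_ball R t = b} = S \<inter> {t. tree_ball R t = b}" by auto
      moreover have "{t. tree_ball R t = b} \<in> sets borel"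
        by (intro borel_open ball_determined_open[OF ball_determined_tree_ball])
      ultimately show ?thesis unfolding assms(4) sets_restrict_space by blast
    qed
    then show "(\<lambda>b. {t \<in> S. tree_ball R t = b}) ` (tree_ball R ` (S \<inter> X)) \<subseteq> sets M" by blast
    show "disjoint_family_on (\<lambda>b. {t \<in> S. tree_ball R t = b}) (tree_ball R ` (S \<inter> X))"
      by (auto simp: disjoint_family_on_def)
  qed
  ultimately show ?thesis by simp
qed

lemma sets_restrict_borel_ball_determined:
  "ball_determined R X \<Longrightarrow> S \<inter> X \<in> sets (restrict_space borel S)"
  unfolding sets_restrict_space by (intro imageI borel_open ball_determined_open)

text \<open>Every open set is the union over \<open>R\<close> of the sets of trees whose whole
  \<open>R\<close>-neighbourhood it contains. This union is countable, so the algebra of ball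
  events generates the Borel sets.\<close>

lemma sigma_sets_ball_determined:
  "sigma_sets S {S \<inter> X | X R. ball_determined R X} = sets (restrict_space borel S)" (is "sigma_sets S ?C = _")
proof
  show "sigma_sets S ?C \<subseteq> sets (restrict_space borel S)"
    using sets.sigma_sets_subset[of ?C "restrict_space borel S"] sets_restrict_borel_ball_determined
    by (auto simp: space_restrict_space)
  let ?M = "sigma S ?C"
  have sp: "space ?M = S" and sets: "sets ?M = sigma_sets S ?C"
    by (simp add: space_measure_of_conv) (rule sets_measure_of, blast)
  have id: "(\<lambda>x. x) \<in> borel_measurable ?M"
  proof (rule borel_measurableI)
    fix U :: "btree set" assume U: "open U"
    \<comment> \<open>The largest subset of \<open>U\<close> that is determined by balls of radius \<open>R\<close>.\<close>
    define V where "V R = {t. \<forall>s. tree_ball R s = tree_ball R t \<longrightarrow> s \<in> U}" for R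
    have "U = (\<Union>R. V R)"
    proof
      show "U \<subseteq> (\<Union>R. V R)"
      proof
        fix t assume "t \<in> U"
        then obtain e where e: "e > 0" "\<And>y. dist y t < e \<Longrightarrow> y \<in> U" using U unfolding open_dist by blast
        then obtain R where R: "inverse (1 + real R) < e" using ex_radius by blast
        then have "t \<in> V (Suc R)"
          unfolding V_def mem_Collect_eq
          using e(2) dist_btree_less_iff[THEN iffD2, of R _ t] by (metis order.strict_trans)
        then show "t \<in> (\<Union>R. V R)" by blast
      qed
    qed (auto simp: V_def)
    moreover have "ball_determined R (V R)" for R by (auto simp: V_def ball_determined_def)
    then have "S \<inter> V R \<in> sigma_sets S ?C" for R by (intro sigma_sets.Basic) blast
    then have "(\<Union>R. S \<inter> V R) \<in> sigma_sets S ?C" by (rule sigma_sets.Union)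
    ultimately show "(\<lambda>x. x) -` U \<inter> space ?M \<in> sets ?M" unfolding sp sets by (simp add: Int_commute)
  qed
  have "S \<inter> B \<in> sigma_sets S ?C" if "B \<in> sets borel" for B
    using measurable_sets[OF id that] unfolding sp sets by (simp add: Int_commute)
  then show "sets (restrict_space borel S) \<subseteq> sigma_sets S ?C"
    unfolding sets_restrict_space by (rule image_subsetI)
qed

text \<open>Limits of probabilities are finitely additive on the algebra of ball events. These events
  are compact, so a decreasing sequence of them with empty intersection is eventually empty,
  and Caratheodory's extension theorem applies.\<close>

lemma limit_measure_exists:
  assumes S: "closed S" "\<And>R. finite (tree_ball R ` S)"
    and M: "\<And>n. prob_space (M n)" "\<And>n. sets (M n) = sets (restrict_space borel S)"
    and conv: "\<And>R b. convergent (\<lambda>n. measure (M n) {t \<in> S. tree_ball R t = b})"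
  shows "\<exists>P. prob_space P \<and> sets P = sets (restrict_space borel S) \<and>
    (\<forall>R X. ball_determined R X \<longrightarrow> (\<lambda>n. measure (M n) (S \<inter> X)) \<longlonglongrightarrow> measure P (S \<inter> X))"
proof -
  define C where "C = {S \<inter> X | X R. ball_determined R X}"
  define f where "f A = lim (\<lambda>n. measure (M n) A)" for A
  have fin: "finite_measure (M n)" for n using M(1) by (simp add: prob_space.finite_measure)
  have Cs: "A \<in> sets (M n)" if "A \<in> C" for A n
    using that sets_restrict_borel_ball_determined unfolding C_def M(2) by blast
  have lim: "(\<lambda>n. measure (M n) A) \<longlonglongrightarrow> f A" if A: "A \<in> C" for A
  proof -
    obtain X R where X: "A = S \<inter> X" "ball_determined R X" using A unfolding C_def by blast
    have "convergent (\<lambda>n. measure (M n) A)"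
      unfolding X(1) finite_balls_decomposition[OF S(2) X(2) fin M(2)] by (intro convergent_sum conv)
    then show ?thesis unfolding f_def by (simp add: convergent_LIMSEQ_iff)
  qed
  have f_nonneg: "f A \<ge> 0" if "A \<in> C" for A
    by (rule LIMSEQ_le_const[OF lim[OF that]]) auto
  have alg: "algebra S C"
    unfolding algebra_iff_Int
  proof (intro conjI ballI)
    show "C \<subseteq> Pow S" by (auto simp: C_def)
    show "{} \<in> C" unfolding C_def by (rule CollectI, intro exI[of _ "{}"]) (auto simp: ball_determined_def)
    fix a b assume "a \<in> C" "b \<in> C"
    then obtain X R Y R' where X: "a = S \<inter> X" "ball_determined R X" "b = S \<inter> Y" "ball_determined R' Y"
      by (auto simp: C_def)
    then show "a \<inter> b \<in> C" unfolding C_def using ball_determined_Int[OF X(2,4)]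
      by (intro CollectI exI[of _ "X \<inter> Y"]) auto
  next
    fix a assume "a \<in> C"
    then obtain X R where X: "a = S \<inter> X" "ball_determined R X" by (auto simp: C_def)
    then show "S - a \<in> C" unfolding C_def using ball_determined_Compl[OF X(2)]
      by (intro CollectI exI[of _ "- X"]) auto
  qed
  interpret A: algebra S C by (rule alg)
  have spM: "space (M n) = S" for n
    using sets_eq_imp_space_eq[OF M(2)] by (simp add: space_restrict_space)
  have "\<exists>\<mu>. (\<forall>s\<in>C. \<mu> s = ennreal (f s)) \<and> measure_space S (sigma_sets S C) \<mu>"
  proof (rule A.caratheodory_empty_continuous)
    have "f {} = 0" using lim[OF A.empty_sets] by (simp add: LIMSEQ_const_iff)
    then show "positive C (\<lambda>s. ennreal (f s))" by (simp add: positive_def)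
    show "additive C (\<lambda>s. ennreal (f s))"
      unfolding additive_def
    proof (intro ballI impI)
      fix x y assume xy: "x \<in> C" "y \<in> C" "x \<inter> y = {}"
      have "(\<lambda>n. measure (M n) x + measure (M n) y) \<longlonglongrightarrow> f x + f y" by (intro tendsto_add lim xy)
      moreover have "measure (M n) x + measure (M n) y = measure (M n) (x \<union> y)" for n
        using finite_measure.finite_measure_Union[OF fin Cs[OF xy(1)] Cs[OF xy(2)] xy(3)] by simp
      ultimately have "f (x \<union> y) = f x + f y"
        using lim[OF A.Un[OF xy(1,2)]] LIMSEQ_unique by fastforce
      then show "ennreal (f (x \<union> y)) = ennreal (f x) + ennreal (f y)" using f_nonneg xy by (simp add: ennreal_plus)
    qed
    fix A :: "nat \<Rightarrow> btree set" assume A: "range A \<subseteq> C" "decseq A" "(\<Inter>i. A i) = {}"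
    have cl: "closed (A i)" for i
    proof -
      obtain X R where "A i = S \<inter> X" "ball_determined R X" using A(1) unfolding C_def by blast
      then show ?thesis using S(1) ball_determined_closed by auto
    qed
    have "\<exists>i. A i = {}"
    proof (rule ccontr)
      assume ne: "\<not> ?thesis"
      have "S \<inter> (\<Inter>(range A)) \<noteq> {}"
      proof (rule compact_imp_fip[OF compact_if_finite_balls[OF S]])
        fix F' assume "finite F'" "F' \<subseteq> range A"
        then obtain I where I: "finite I" "F' = A ` I" by (meson finite_subset_image)
        have "A (Max (insert 0 I)) \<subseteq> A i" if "i \<in> I" for i
          using that I(1) by (intro decseqD[OF A(2)] Max_ge) simp_all
        moreover have "A (Max (insert 0 I)) \<subseteq> S" using A(1) unfolding C_def by blast
        ultimately have "A (Max (insert 0 I)) \<subseteq> S \<inter> \<Inter>F'" unfolding I(2) by (intro Int_greatest INT_greatest)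
        with ne show "S \<inter> \<Inter>F' \<noteq> {}" by (metis subset_empty)
      next
        fix T assume "T \<in> range A"
        then show "closed T" using cl by (metis imageE)
      qed
      with A(3) show False by simp
    qed
    then obtain i where "A i = {}" by blast
    then have "A j = {}" if "j \<ge> i" for j using decseqD[OF A(2) that] by simp
    then have "ennreal (f (A j)) = 0" if "j \<ge> i" for j using \<open>f {} = 0\<close> that by simp
    then have "eventually (\<lambda>j. ennreal (f (A j)) = 0) sequentially"
      unfolding eventually_sequentially by blast
    then show "(\<lambda>i. ennreal (f (A i))) \<longlonglongrightarrow> 0" by (rule tendsto_eventually)
  qed simp
  then obtain \<mu> where \<mu>: "\<And>s. s \<in> C \<Longrightarrow> \<mu> s = ennreal (f s)" "measure_space S (sigma_sets S C) \<mu>" by blast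
  define P where "P = measure_of S (sigma_sets S C) \<mu>"
  have sub: "C \<subseteq> Pow S" using A.space_closed .
  have sp: "space P = S" unfolding P_def by (simp add: space_measure_of_conv)
  have setsP: "sets P = sets (restrict_space borel S)"
  proof -
    have "sigma_sets S C \<subseteq> Pow S" using sigma_sets_into_sp[OF sub] by blast
    then have "sets P = sigma_sets S C"
      unfolding P_def by (simp add: sigma_sets_sigma_sets_eq[OF sub])
    also have "\<dots> = sets (restrict_space borel S)"
      unfolding C_def by (rule sigma_sets_ball_determined)
    finally show ?thesis .
  qed
  have em: "emeasure P s = ennreal (f s)" if "s \<in> C" for s
    unfolding P_def using \<mu> that
    by (subst emeasure_measure_of_sigma) (auto simp: measure_space_def)
  have ms: "measure P s = f s" if "s \<in> C" for s
    using em[OF that] f_nonneg[OF that] by (simp add: measure_def)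
  have "f S = 1"
  proof -
    have "measure (M n) S = 1" for n using prob_space.prob_space[OF M(1)] by (simp add: spM)
    then show ?thesis using lim[OF A.top] by (simp add: LIMSEQ_const_iff)
  qed
  then have "prob_space P" using em[OF A.top] by (intro prob_spaceI) (simp add: sp)
  moreover have "(\<lambda>n. measure (M n) (S \<inter> X)) \<longlonglongrightarrow> measure P (S \<inter> X)" if "ball_determined R X" for R X
  proof -
    have "S \<inter> X \<in> C" using that unfolding C_def by blast
    then show ?thesis using lim ms by simp
  qed
  ultimately show ?thesis using setsP by blast
qed

lemma (in prob_space) integral_close:
  fixes f h :: "'a \<Rightarrow> real"
  assumes "integrable M f" "integrable M h" "\<And>x. x \<in> space M \<Longrightarrow> \<bar>f x - h x\<bar> \<le> e"
  shows "\<bar>integral\<^sup>L M f - integral\<^sup>L M h\<bar> \<le> e"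
proof -
  have "integral\<^sup>L M f - integral\<^sup>L M h = integral\<^sup>L M (\<lambda>x. f x - h x)"
    using assms by simp
  also have "\<bar>\<dots>\<bar> \<le> integral\<^sup>L M (\<lambda>x. \<bar>f x - h x\<bar>)"
    using integral_norm_bound[of M "\<lambda>x. f x - h x"] by simp
  also have "\<dots> \<le> e"
    using assms by (intro integral_le_const) auto
  finally show ?thesis .
qed

text \<open>A continuous function on the compact space is uniformly close to one that takes finitely
  many values and depends on a ball only. The integrals of the latter are finite linear
  combinations of ball probabilities.\<close>

lemma weak_conv_on_if_balls_converge:
  assumes S: "closed S" "\<And>R. finite (tree_ball R ` S)"
    and M: "\<And>n. prob_space (M n)" "\<And>n. sets (M n) = sets (restrict_space borel S)"
    and P: "prob_space P" "sets P = sets (restrict_space borel S)"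
    and conv: "\<And>R b. (\<lambda>n. measure (M n) {t \<in> S. tree_ball R t = b}) \<longlonglongrightarrow> measure P {t \<in> S. tree_ball R t = b}"
  shows "weak_conv_on S M P"
  unfolding weak_conv_on_def
proof (intro allI impI, elim conjE)
  fix f :: "btree \<Rightarrow> real"
  assume f: "continuous_on S f" "bounded (f ` S)"
  obtain B where B: "\<And>x. x \<in> S \<Longrightarrow> \<bar>f x\<bar> \<le> B" using f(2) by (auto simp: bounded_iff)
  have fm: "f \<in> borel_measurable (restrict_space borel S)"
    by (rule borel_measurable_continuous_on_restrict[OF f(1)])
  have uc: "uniformly_continuous_on S f"
    by (rule compact_uniformly_continuous[OF f(1) compact_if_finite_balls[OF S]])
  show "(\<lambda>n. \<integral>x. f x \<partial>M n) \<longlonglongrightarrow> (\<integral>x. f x \<partial>P)"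
  proof (rule LIMSEQ_I)
    fix r :: real assume r: "r > 0"
    define e where "e = r / 3"
    have e: "e > 0" using r by (simp add: e_def)
    obtain \<delta> where \<delta>: "\<delta> > 0" "\<And>x y. x \<in> S \<Longrightarrow> y \<in> S \<Longrightarrow> dist y x < \<delta> \<Longrightarrow> dist (f y) (f x) < e"
      using uc e unfolding uniformly_continuous_on_def by metis
    obtain R where R: "inverse (1 + real R) < \<delta>" using ex_radius \<delta>(1) by blast
    define Q where "Q = Suc R"
    have Q: "dist x y < \<delta>" if "tree_ball Q x = tree_ball Q y" for x y
      using dist_btree_less_iff[THEN iffD2, OF that[unfolded Q_def]] R by linarith
    \<comment> \<open>A representative of each ball; \<open>h\<close> replaces the value of \<open>f\<close> by the one at the representative.\<close>
    define c where "c = inv_into S (tree_ball Q)"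
    let ?I = "tree_ball Q ` S"
    let ?E = "\<lambda>b. {t \<in> S. tree_ball Q t = b}"
    define h where "h x = (\<Sum>b\<in>?I. f (c b) * indicator (?E b) x)" for x
    have c: "c b \<in> S" "tree_ball Q (c b) = b" if "b \<in> ?I" for b
      using inv_into_into[OF that] f_inv_into_f[OF that] unfolding c_def by blast+
    have hx: "h x = f (c (tree_ball Q x))" if "x \<in> S" for x
    proof -
      have "h x = (\<Sum>b\<in>?I. if b = tree_ball Q x then f (c b) else 0)"
        unfolding h_def using that by (intro sum.cong) auto
      then show ?thesis using S(2) that by (simp add: sum.delta)
    qed
    have close: "\<bar>f x - h x\<bar> \<le> e" if "x \<in> S" for x
    proof -
      have b: "tree_ball Q x \<in> ?I" using that by blast
      have "dist x (c (tree_ball Q x)) < \<delta>"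
        by (rule Q[OF c(2)[OF b, symmetric]])
      then have "dist (f x) (f (c (tree_ball Q x))) < e"
        using \<delta>(2) c(1)[OF b] that by blast
      then show ?thesis unfolding hx[OF that] by (simp add: dist_real_def)
    qed
    have E: "?E b \<in> sets (restrict_space borel S)" for b
      using sets_restrict_borel_ball_determined[OF ball_determined_tree_ball, of S Q b]
      by (simp only: Int_def mem_Collect_eq)
    have main: "\<bar>(\<integral>x. f x \<partial>N) - (\<Sum>b\<in>?I. f (c b) * measure N (?E b))\<bar> \<le> e"
      if N: "prob_space N" "sets N = sets (restrict_space borel S)" for N
    proof -
      interpret N: prob_space N by fact
      have sp: "space N = S" using sets_eq_imp_space_eq[OF N(2)] by (simp add: space_restrict_space)
      have "f \<in> borel_measurable N" using fm measurable_cong_sets[OF N(2) refl] by blast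
      then have fi: "integrable N f"
        by (intro N.integrable_const_bound[of _ B]) (auto simp: sp B)
      have Ei: "integrable N (\<lambda>x. f (c b) * indicator (?E b) x)" for b
        using E[of b] unfolding N(2)[symmetric]
        by (intro integrable_mult_right integrable_real_indicator) (simp_all add: N.emeasure_eq_measure)
      then have hi: "integrable N h" unfolding h_def by (intro Bochner_Integration.integrable_sum)
      have "(\<integral>x. h x \<partial>N) = (\<Sum>b\<in>?I. \<integral>x. f (c b) * indicator (?E b) x \<partial>N)"
        unfolding h_def by (intro Bochner_Integration.integral_sum Ei)
      also have "\<dots> = (\<Sum>b\<in>?I. f (c b) * measure N (?E b))"
        using E unfolding N(2)[symmetric] by (intro sum.cong refl) (simp add: sets.Int_space_eq2)
      finally show ?thesis using N.integral_close[OF fi hi, of e] close by (simp add: sp)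
    qed
    have "(\<lambda>n. \<Sum>b\<in>?I. f (c b) * measure (M n) (?E b)) \<longlonglongrightarrow> (\<Sum>b\<in>?I. f (c b) * measure P (?E b))"
      by (intro tendsto_sum tendsto_mult tendsto_const conv)
    from LIMSEQ_D[OF this e] obtain n0 where n0: "\<And>n. n \<ge> n0 \<Longrightarrow>
       norm ((\<Sum>b\<in>?I. f (c b) * measure (M n) (?E b)) - (\<Sum>b\<in>?I. f (c b) * measure P (?E b))) < e"
      by blast
    have triangle: "norm (x - y) < r" if "norm (u - v) < e" "\<bar>x - u\<bar> \<le> e" "\<bar>y - v\<bar> \<le> e" for x y u v :: real
      using that unfolding real_norm_def e_def by linarith
    have "norm ((\<integral>x. f x \<partial>M n) - (\<integral>x. f x \<partial>P)) < r" if "n \<ge> n0" for n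
      by (rule triangle[OF n0[OF that] main[OF M(1,2)] main[OF P]])
    then show "\<exists>no. \<forall>n\<ge>no. norm ((\<integral>x. f x \<partial>M n) - (\<integral>x. f x \<partial>P)) < r" by blast
  qed
qed

section \<open>Subtrees and balls\<close>

lemma tree_ball_Suc_half:
  assumes "tree_ball (Suc R) s = tree_ball (Suc R) t"
  shows "length (halves s) = length (halves t)"
    "i < length (halves t) \<Longrightarrow> map_half_edge (tree_ball R) (halves s ! i) = map_half_edge (tree_ball R) (halves t ! i)"
proof -
  have eq: "map (map_half_edge (tree_ball R)) (halves s) = map (map_half_edge (tree_ball R)) (halves t)"
    using assms by simp
  from arg_cong[OF eq, of length] show len: "length (halves s) = length (halves t)" by simp
  show "map_half_edge (tree_ball R) (halves s ! i) = map_half_edge (tree_ball R) (halves t ! i)"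
    if "i < length (halves t)"
    using arg_cong[OF eq, of "\<lambda>l. l ! i"] that len by simp
qed

text \<open>Local properties at a vertex of height \<open>h\<close> that depend on a ball of radius
  \<open>R\<close> are determined by the ball of radius \<open>h + R\<close> around the root;
  this is how they pass to limits of trees.\<close>

lemma subtree_tree_ball:
  assumes "tree_ball (length v + R) s = tree_ball (length v + R) t" "v \<in> verts t"
  shows "v \<in> verts s \<and> tree_ball R (subtree s v) = tree_ball R (subtree t v)"
  using assms
proof (induction v arbitrary: s t)
  case (Cons i v)
  from Cons.prems(2) obtain u where u: "i < length (halves t)" "halves t ! i = Edge u" "v \<in> verts u"
    by (auto simp: Cons_in_verts)
  have eq: "tree_ball (Suc (length v + R)) s = tree_ball (Suc (length v + R)) t"
    using Cons.prems(1) by (simp only: list.size add_Suc_right add_Suc add_0_right)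
  note * = tree_ball_Suc_half[OF eq]
  from *(2)[OF u(1)] u(2) obtain u' where u': "halves s ! i = Edge u'"
    "tree_ball (length v + R) u' = tree_ball (length v + R) u"
    by (cases "halves s ! i") auto
  from Cons.IH[OF u'(2) u(3)] show ?case
    using u u'(1) *(1) by (simp add: Cons_in_verts subtree_Cons)
qed simp

lemma ball_determined_verts: "ball_determined (length v) {t. v \<in> verts t}"
  unfolding ball_determined_def mem_Collect_eq
proof (intro allI impI)
  fix s t assume eq: "tree_ball (length v) s = tree_ball (length v) t"
  show "v \<in> verts s \<longleftrightarrow> v \<in> verts t"
    using subtree_tree_ball[of v 0 s t] subtree_tree_ball[of v 0 t s] eq by auto
qed

text \<open>A tree without vertices at height \<open>k\<close> coincides with its ball, so that bounded
  degrees leave finitely many such trees.\<close>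

lemma tree_ball_id:
  assumes "\<And>w. length w = k \<Longrightarrow> w \<notin> verts t"
  shows "tree_ball k t = t"
  using assms
proof (induction k arbitrary: t)
  case 0
  from 0[of "[]"] show ?case by simp
next
  case (Suc k)
  have "map_half_edge (tree_ball k) x = x" if x: "x \<in> set (halves t)" for x
  proof (cases x)
    case (Edge u)
    obtain i where i: "i < length (halves t)" "halves t ! i = Edge u"
      using x Edge unfolding in_set_conv_nth by blast
    have "w \<notin> verts u" if "length w = k" for w
      using Suc.prems[of "i # w"] that i by (auto simp: Cons_in_verts)
    from Suc.IH[OF this] show ?thesis by (simp add: Edge)
  qed simp
  then have "map (map_half_edge (tree_ball k)) (halves t) = halves t" by (intro map_idI)
  then show ?case by simp
qed

lemma verts_butlast: "v @ w \<in> verts t \<Longrightarrow> v \<in> verts t"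
  by (simp add: append_in_verts)

section \<open>Spines\<close>

text \<open>The subtree at \<open>v\<close> is infinite, stated through its heights so that it is a
  countable intersection of ball events.\<close>

definition alive :: "btree \<Rightarrow> nat list \<Rightarrow> bool" where
  "alive t v \<longleftrightarrow> (\<forall>k. \<exists>w. length w = k \<and> v @ w \<in> verts t)"

lemma alive_in_verts: "alive t v \<Longrightarrow> v \<in> verts t"
  unfolding alive_def using verts_butlast by blast

lemma alive_prefix: "alive t (v @ w) \<Longrightarrow> alive t v"
  unfolding alive_def
proof
  fix k assume a: "\<forall>k. \<exists>x. length x = k \<and> (v @ w) @ x \<in> verts t"
  then obtain x where x: "length x = k" "(v @ w) @ x \<in> verts t" by blast
  then have "(v @ take k (w @ x)) @ drop k (w @ x) \<in> verts t"
    by (simp only: append_assoc append_take_drop_id)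
  then have "v @ take k (w @ x) \<in> verts t" by (rule verts_butlast)
  then show "\<exists>w. length w = k \<and> v @ w \<in> verts t" using x by (intro exI[of _ "take k (w @ x)"]) auto
qed

text \<open>The step of Koenig's lemma: if every child had a subtree of bounded height, the sum of the
  finitely many bounds would bound the subtree of \<open>v\<close>.\<close>

lemma alive_child:
  assumes "alive t v"
  shows "\<exists>i. alive t (v @ [i])"
proof (rule ccontr)
  assume "\<not> ?thesis"
  then have "\<forall>i. \<exists>k. \<forall>w. length w = k \<longrightarrow> (v @ [i]) @ w \<notin> verts t"
    unfolding alive_def by blast
  then obtain K where K: "\<And>i w. length w = K i \<Longrightarrow> (v @ [i]) @ w \<notin> verts t" by metis
  \<comment> \<open>The sum bounds each \<open>K i\<close>, also if \<open>v\<close> has no children; a descendant \<open>N + 1\<close> levels below \<open>v\<close> is \<open>N\<close> levels below a child.\<close>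
  define N where "N = (\<Sum>i<length (halves (subtree t v)). K i)"
  obtain w where w: "length w = Suc N" "v @ w \<in> verts t" using assms unfolding alive_def by blast
  then obtain i w' where iw: "w = i # w'" "length w' = N" by (cases w) auto
  have mem: "(v @ [i]) @ w' \<in> verts t" using w(2) iw(1) by simp
  then have "i < length (halves (subtree t v))"
    using verts_butlast[OF mem] by (simp add: snoc_in_verts)
  then have "K i \<le> N" unfolding N_def by (intro member_le_sum) auto
  have "((v @ [i]) @ take (K i) w') @ drop (K i) w' \<in> verts t" using mem by simp
  then have "(v @ [i]) @ take (K i) w' \<in> verts t" by (rule verts_butlast)
  with K[of "take (K i) w'" i] \<open>K i \<le> N\<close> iw(2) show False by simp
qed

lemma in_childrenD: "u \<in> children t v \<Longrightarrow> \<exists>i. u = v @ [i]"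
  by (auto simp: children_def)

text \<open>A self-avoiding path from the root can never step back to a parent, as it would revisit the
  previous vertex.\<close>

lemma spine_iff: "spine t p \<longleftrightarrow> p 0 = [] \<and> (\<forall>k. p (Suc k) \<in> children t (p k))"
proof
  assume s: "spine t p"
  have inj: "p a = p b \<Longrightarrow> a = b" for a b using s unfolding spine_def inj_def by blast
  have ch: "p (Suc k) \<in> children t (p k)" for k
  proof (induction k)
    case 0
    have "p (Suc 0) \<in> children t (p 0) \<or> p 0 \<in> children t (p (Suc 0))"
      using s unfolding spine_def adjacent_def by blast
    then show ?case using s in_childrenD[of "p 0" t "p (Suc 0)"] unfolding spine_def by auto
  next
    case (Suc k)
    have "p (Suc (Suc k)) \<in> children t (p (Suc k)) \<or> p (Suc k) \<in> children t (p (Suc (Suc k)))"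
      using s unfolding spine_def adjacent_def by blast
    moreover have "p (Suc k) \<notin> children t (p (Suc (Suc k)))"
    proof
      assume "p (Suc k) \<in> children t (p (Suc (Suc k)))"
      then have "p k = p (Suc (Suc k))" using in_childrenD in_childrenD[OF Suc] by fastforce
      then show False using inj by fastforce
    qed
    ultimately show ?case by blast
  qed
  then show "p 0 = [] \<and> (\<forall>k. p (Suc k) \<in> children t (p k))" using s unfolding spine_def by blast
next
  assume s: "p 0 = [] \<and> (\<forall>k. p (Suc k) \<in> children t (p k))"
  have len: "length (p k) = k" for k
  proof (induction k)
    case (Suc k)
    then show ?case using in_childrenD[of "p (Suc k)" t "p k"] s by auto
  qed (use s in simp)
  have "p k \<in> verts t" for k
    using s by (cases k) (auto simp: children_def)
  then show "spine t p"
    unfolding spine_def adjacent_def using s len by (metis injI)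
qed

lemma spine_alive:
  assumes "spine t p"
  shows "alive t (p k)"
  unfolding alive_def
proof
  fix j
  have ch: "p (Suc k) \<in> children t (p k)" for k using assms unfolding spine_iff by blast
  have "\<exists>w. length w = j \<and> p (k + j) = p k @ w"
  proof (induction j)
    case (Suc j)
    then obtain w i where "length w = j" "p (k + j) = p k @ w" "p (Suc (k + j)) = p (k + j) @ [i]"
      using in_childrenD[OF ch[of "k + j"]] by blast
    then show ?case by (intro exI[of _ "w @ [i]"]) simp
  qed simp
  then obtain w where w: "length w = j" "p (k + j) = p k @ w" by blast
  have "p n \<in> verts t" for n
    using ch assms by (cases n) (auto simp: children_def spine_def)
  from this[of "k + j"] show "\<exists>w. length w = j \<and> p k @ w \<in> verts t" using w by auto
qed

lemma spine_through_alive: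
  assumes "alive t v"
  shows "\<exists>p. spine t p \<and> p (length v) = v"
proof -
  \<comment> \<open>The path follows \<open>v\<close> as far as it goes, and infinite subtrees afterwards.\<close>
  define Q where "Q k u \<longleftrightarrow> alive t u \<and> length u = k \<and> (k \<le> length v \<longrightarrow> u = take k v)" for k u
  have "\<exists>p. \<forall>k. Q k (p k) \<and> (\<exists>i. p (Suc k) = p k @ [i])"
  proof (rule dependent_nat_choice)
    show "\<exists>u. Q 0 u" using alive_prefix[of t "[]" v] assms by (auto simp: Q_def)
    fix u k assume u: "Q k u"
    show "\<exists>u'. Q (Suc k) u' \<and> (\<exists>i. u' = u @ [i])"
    proof (cases "k < length v")
      case True
      have "alive t (take (Suc k) v @ drop (Suc k) v)" using assms by simp
      then have "alive t (take (Suc k) v)" by (rule alive_prefix)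
      moreover have "take (Suc k) v = u @ [v ! k]" using True u by (simp add: Q_def take_Suc_conv_app_nth)
      ultimately show ?thesis using True by (intro exI[of _ "take (Suc k) v"]) (use u in \<open>simp add: Q_def\<close>)
    next
      case False
      have "alive t u" using u by (simp add: Q_def)
      from alive_child[OF this] obtain i where "alive t (u @ [i])" by blast
      with False u show ?thesis by (intro exI[of _ "u @ [i]"]) (auto simp: Q_def)
    qed
  qed
  then obtain p where p: "\<And>k. Q k (p k)" "\<And>k. \<exists>i. p (Suc k) = p k @ [i]" by blast
  have "p k \<in> verts t" for k using p(1)[of k] alive_in_verts by (simp add: Q_def)
  then have "spine t p"
    unfolding spine_iff children_def using p(1)[of 0] p(2) by (auto simp: Q_def)
  moreover have "p (length v) = v" using p(1)[of "length v"] by (simp add: Q_def)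
  ultimately show ?thesis by blast
qed

text \<open>Spines can be extended inside infinite subtrees, hence two infinite subtrees at different
  children of a vertex give two spines, and conversely two spines separate at some vertex.\<close>

lemma single_spine_iff:
  "single_spine t \<longleftrightarrow> alive t [] \<and> (\<forall>v i j. i \<noteq> j \<longrightarrow> \<not> (alive t (v @ [i]) \<and> alive t (v @ [j])))"
proof
  assume s: "single_spine t"
  then obtain p where p: "spine t p" "\<And>q. spine t q \<Longrightarrow> q = p" unfolding single_spine_def by blast
  have "alive t []" using spine_alive[OF p(1), of 0] p(1) by (simp add: spine_def)
  moreover have "v @ [i] = v @ [j]" if a: "alive t (v @ [i])" "alive t (v @ [j])" for v i j
  proof -
    obtain q where q: "spine t q" "q (length (v @ [i])) = v @ [i]" using spine_through_alive[OF a(1)] by blast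
    obtain q' where q': "spine t q'" "q' (length (v @ [j])) = v @ [j]" using spine_through_alive[OF a(2)] by blast
    show ?thesis using p(2)[OF q(1)] p(2)[OF q'(1)] q(2) q'(2) by simp
  qed
  ultimately show "alive t [] \<and> (\<forall>v i j. i \<noteq> j \<longrightarrow> \<not> (alive t (v @ [i]) \<and> alive t (v @ [j])))" by blast
next
  assume a: "alive t [] \<and> (\<forall>v i j. i \<noteq> j \<longrightarrow> \<not> (alive t (v @ [i]) \<and> alive t (v @ [j])))"
  then obtain p where p: "spine t p" using spine_through_alive by blast
  have "q = p" if q: "spine t q" for q
  proof
    fix k
    show "q k = p k"
    proof (induction k)
      case 0
      then show ?case using p q by (simp add: spine_def)
    next
      case (Suc k)
      have "p (Suc k) \<in> children t (p k)" "q (Suc k) \<in> children t (q k)"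
        using p q unfolding spine_iff by blast+
      then obtain i j where ij: "p (Suc k) = p k @ [i]" "q (Suc k) = p k @ [j]"
        using in_childrenD Suc by metis
      then show ?case using spine_alive[OF p, of "Suc k"] spine_alive[OF q, of "Suc k"] a by metis
    qed
  qed
  with p show "single_spine t" unfolding single_spine_def by blast
qed

section \<open>Charge functions of infinite trees\<close>

lemma sum_children:
  assumes "v \<in> verts t"
  shows "(\<Sum>u\<in>children t v. (g u :: int)) =
    (\<Sum>i<length (halves (subtree t v)). case halves (subtree t v) ! i of Stem \<Rightarrow> 0 | Edge u \<Rightarrow> g (v @ [i]))"
proof -
  let ?h = "halves (subtree t v)"
  have "children t v = (\<lambda>i. v @ [i]) ` {i. i < length ?h \<and> ?h ! i \<noteq> Stem}"
  proof (rule set_eqI)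
    fix u
    have "v @ [i] \<in> verts t \<longleftrightarrow> i < length ?h \<and> ?h ! i \<noteq> Stem" for i
      using assms by (cases "?h ! i") (auto simp: snoc_in_verts)
    then show "u \<in> children t v \<longleftrightarrow> u \<in> (\<lambda>i. v @ [i]) ` {i. i < length ?h \<and> ?h ! i \<noteq> Stem}"
      by (auto simp: children_def)
  qed
  then have "(\<Sum>u\<in>children t v. g u) = (\<Sum>i\<in>{i. i < length ?h \<and> ?h ! i \<noteq> Stem}. g (v @ [i]))"
    by (simp add: sum.reindex inj_on_def)
  also have "\<dots> = (\<Sum>i<length ?h. case ?h ! i of Stem \<Rightarrow> 0 | Edge u \<Rightarrow> g (v @ [i]))"
    by (intro sum.mono_neutral_cong_left) (auto split: half_edge.splits)
  finally show ?thesis .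
qed

text \<open>At each vertex the difference of two charge functions is the sum of its values at the
  children. So a nonzero value is passed on to some child, and the subtree of the vertex is
  infinite: all such vertices lie on the spine. Along the spine the other children contribute
  nothing, so the value stays what it is at the root, namely zero.\<close>

lemma unique_charge_function:
  assumes s: "single_spine t" and c: "charge_function t c" "charge_function t c'"
  shows "c = c'"
proof (rule ccontr)
  assume ne: "c \<noteq> c'"
  define \<delta> where "\<delta> v = c v - c' v" for v
  have sum: "\<delta> v = (\<Sum>u\<in>children t v. \<delta> u)" if "v \<in> verts t" for v
    using c that unfolding charge_function_def \<delta>_def by (simp add: sum_subtractf)
  have step: "\<exists>i. v @ [i] \<in> verts t \<and> \<delta> (v @ [i]) \<noteq> 0" if v: "v \<in> verts t" "\<delta> v \<noteq> 0" for v
  proof -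
    have "\<exists>u\<in>children t v. \<delta> u \<noteq> 0" using sum[OF v(1)] v(2) sum.neutral by metis
    then show ?thesis by (auto simp: children_def)
  qed
  have al: "alive t v" if v: "v \<in> verts t" "\<delta> v \<noteq> 0" for v
    unfolding alive_def
  proof
    fix k
    have "\<exists>w. length w = k \<and> v @ w \<in> verts t \<and> \<delta> (v @ w) \<noteq> 0"
    proof (induction k)
      case (Suc k)
      then obtain w where w: "length w = k" "v @ w \<in> verts t" "\<delta> (v @ w) \<noteq> 0" by blast
      from step[OF w(2,3)] obtain i where "(v @ w) @ [i] \<in> verts t" "\<delta> ((v @ w) @ [i]) \<noteq> 0" by blast
      then show ?case using w(1) by (intro exI[of _ "w @ [i]"]) auto
    qed (use v in simp)
    then show "\<exists>w. length w = k \<and> v @ w \<in> verts t" by blast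
  qed
  obtain p where p: "spine t p" using s unfolding single_spine_def by blast
  have ch: "p (Suc k) \<in> children t (p k)" for k using p unfolding spine_iff by blast
  have pv: "p k \<in> verts t" for k using spine_alive[OF p] alive_in_verts by blast
  have fin: "finite (children t v)" if "v \<in> verts t" for v
  proof -
    have "children t v \<subseteq> (\<lambda>i. v @ [i]) ` {..<length (halves (subtree t v))}"
      by (auto simp: children_def snoc_in_verts)
    then show ?thesis by (rule finite_subset) simp
  qed
  have zero: "\<delta> (p k) = 0" for k
  proof (induction k)
    case 0
    then show ?case using c p by (simp add: \<delta>_def charge_function_def spine_def)
  next
    case (Suc k)
    have "\<delta> u = 0" if u: "u \<in> children t (p k) - {p (Suc k)}" for u
    proof (rule ccontr)
      assume "\<delta> u \<noteq> 0"
      then have "alive t u" using al u by (simp add: children_def)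
      moreover have "alive t (p (Suc k))" by (rule spine_alive[OF p])
      moreover obtain i j where "u = p k @ [i]" "p (Suc k) = p k @ [j]"
        using u in_childrenD[OF ch[of k]] in_childrenD[of u t "p k"] by blast
      ultimately show False using s u unfolding single_spine_iff by (metis DiffD2 singletonI)
    qed
    then have "(\<Sum>u\<in>children t (p k). \<delta> u) = \<delta> (p (Suc k))"
      using sum.remove[OF fin[OF pv[of k]] ch[of k], of \<delta>] by simp
    then show ?case using sum[OF pv[of k]] Suc by simp
  qed
  have "\<delta> v = 0" if v: "v \<in> verts t" for v
  proof (rule ccontr)
    assume nz: "\<delta> v \<noteq> 0"
    obtain q where "spine t q" "q (length v) = v" using spine_through_alive[OF al[OF v nz]] by blast
    moreover have "q = p" using s p \<open>spine t q\<close> unfolding single_spine_def by blast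
    ultimately show False using zero nz by metis
  qed
  then have "c = c'"
    using c unfolding charge_function_def \<delta>_def by (intro extensionalityI[of c "verts t" c']) auto
  with ne show False by contradiction
qed

text \<open>The local consequences of membership in \<open>trees_n\<close>, in a form that is closed in
  the local topology.\<close>

definition full_shape :: "nat \<Rightarrow> btree \<Rightarrow> bool" where
  "full_shape m t \<longleftrightarrow> colour t = Black \<and> (\<exists>q\<le>m. half_colours t = (replicate (Suc m) Stem)[q := Edge White]) \<and>
     (\<forall>v\<in>verts t. v \<noteq> [] \<longrightarrow> regular_shape m (subtree t v))"

lemma trees_n_0: "trees_n d 0 = {}"
proof -
  have False if "t \<in> trees_n d 0" for t
  proof -
    have "finite {v \<in> verts t. colour_at t v = Black}" "[] \<in> {v \<in> verts t. colour_at t v = Black}"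
      using that by (auto simp: trees_n_def)
    then have "card {v \<in> verts t. colour_at t v = Black} \<noteq> 0" by (metis card_0_eq empty_iff)
    then show False using that by (simp add: trees_n_def)
  qed
  then show ?thesis by blast
qed

lemma full_shape_trees_n:
  assumes "t \<in> trees_n (Suc m) n"
  shows "full_shape m t"
proof -
  obtain k where "n = Suc k" using assms trees_n_0 by (cases n) auto
  with assms have "t \<in> (\<lambda>(r, l). black_vertex (Suc m) r (Vertex White l)) `
      ({..m} \<times> {l. length l = m \<and> (\<forall>x\<in>set l. slot m x) \<and> sum_list (map weight l) = k})"
    unfolding trees_n_Suc[symmetric] by blast
  then obtain z where z: "z \<in> {..m} \<times> {l. length l = m \<and> (\<forall>x\<in>set l. slot m x) \<and> sum_list (map weight l) = k}"
    "t = (case z of (r, l) \<Rightarrow> black_vertex (Suc m) r (Vertex White l))" by blast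
  obtain r l where rl: "z = (r, l)" by (cases z)
  then have r: "r \<le> m" and l: "length l = m" "\<forall>x\<in>set l. slot m x"
    and t: "t = black_vertex (Suc m) r (Vertex White l)" using z by auto
  have w: "\<forall>v\<in>verts (Vertex White l). admissible m (subtree (Vertex White l) v) \<and> regular_shape m (subtree (Vertex White l) v)"
    using white_vertex_of_slots[of l m] l slot_properties by blast
  have "half_colours t = (replicate (Suc m) Stem)[r := Edge White]"
    unfolding t half_colours_def halves_black_vertex map_update map_replicate by simp
  moreover have "regular_shape m (subtree t v)" if v: "v \<in> verts t" "v \<noteq> []" for v
  proof -
    obtain i v' where iv: "v = i # v'" using v(2) by (cases v) auto
    with v(1) obtain u where u: "i < length (halves t)" "halves t ! i = Edge u" "v' \<in> verts u"
      by (auto simp: Cons_in_verts)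
    then have "Edge u \<in> set (halves t)" by (metis nth_mem)
    then have "u = Vertex White l" unfolding t using Edge_in_black_vertex[of r "Suc m"] r by simp
    then show ?thesis using w u iv by (simp add: subtree_Cons)
  qed
  ultimately show ?thesis using r t by (auto simp: full_shape_def)
qed

lemma half_colours_tree_ball:
  "tree_ball 1 s = tree_ball 1 t \<Longrightarrow> colour s = colour t \<and> half_colours s = half_colours t"
proof -
  assume eq: "tree_ball 1 s = tree_ball 1 t"
  have "half_colours u = map (map_half_edge colour) (halves (tree_ball 1 u))" for u
    by (simp add: half_colours_def half_edge.map_comp o_def)
  moreover have "colour u = colour (tree_ball 1 u)" for u by simp
  ultimately show ?thesis using eq by metis
qed

lemma full_shape_closure:
  assumes "T \<in> trees_completion (Suc m)"
  shows "full_shape m T"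
proof -
  have *: "\<exists>t. full_shape m t \<and> tree_ball R T = tree_ball R t" for R
  proof -
    obtain t where "t \<in> trees (Suc m)" "tree_ball R T = tree_ball R t"
      using assms unfolding trees_completion_def closure_iff_tree_balls by blast
    then show ?thesis using full_shape_trees_n unfolding trees_def by blast
  qed
  have "regular_shape m (subtree T v)" if v: "v \<in> verts T" "v \<noteq> []" for v
  proof -
    obtain t where t: "full_shape m t" "tree_ball (length v + 1) T = tree_ball (length v + 1) t" using * by blast
    from subtree_tree_ball[OF t(2)[symmetric] v(1)]
    have "v \<in> verts t" "tree_ball 1 (subtree t v) = tree_ball 1 (subtree T v)" by blast+
    with t(1) v(2) half_colours_tree_ball show ?thesis
      unfolding full_shape_def regular_shape_def by metis
  qed
  moreover obtain t where "full_shape m t" "tree_ball 1 T = tree_ball 1 t" using * by blast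
  ultimately show ?thesis using half_colours_tree_ball unfolding full_shape_def by metis
qed

text \<open>The charges of the subtrees of a finite well-charged tree, continued to infinite trees where
  charges of subtrees have no meaning. The value at the root is prescribed separately.\<close>

definition canonical_charge :: "nat \<Rightarrow> btree \<Rightarrow> nat list \<Rightarrow> int" where
  "canonical_charge m t = (\<lambda>v\<in>verts t. if v = [] then 0 else if colour_at t v = Black then 1 else int m)"

lemma sum_list_half_colours:
  "(\<Sum>i<length (halves u). case halves u ! i of Stem \<Rightarrow> a | Edge y \<Rightarrow> (if colour y = Black then b else c)) =
   sum_list (map (case_half_edge a (\<lambda>x. if x = Black then b else c)) (half_colours u))" for a :: int
  unfolding half_colours_def
  by (simp add: sum_list_sum_nth atLeast0LessThan) (intro sum.cong refl, auto split: half_edge.splits)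

lemma num_stems_half_colours:
  "int (num_stems t v) = sum_list (map (case_half_edge 1 (\<lambda>_. 0)) (half_colours (subtree t v)))"
proof -
  have "int (count_list hs Stem) = sum_list (map (case_half_edge 1 (\<lambda>_. 0)) (map (map_half_edge colour) hs))"
    for hs :: "btree half_edge list"
  proof (induction hs)
    case (Cons x hs)
    then show ?case by (cases x) auto
  qed simp
  then show ?thesis by (simp add: num_stems_def half_colours_def)
qed

text \<open>Checked vertex by vertex: a black vertex has one child of charge \<open>m\<close> and
  \<open>m - 1\<close> opening stems (\<open>m\<close> at the root), and each of the
  \<open>m\<close> half-edges of a white vertex contributes \<open>1\<close>.\<close>

lemma canonical_charge_function:
  assumes "full_shape m t" "m \<ge> 1"
  shows "charge_function t (canonical_charge m t)"
  unfolding charge_function_def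
proof (intro conjI ballI)
  show "canonical_charge m t \<in> extensional (verts t)" by (simp add: canonical_charge_def)
  show "canonical_charge m t [] = 0" by (simp add: canonical_charge_def)
  fix v assume v: "v \<in> verts t"
  define H where "H = half_colours (subtree t v)"
  define \<sigma> :: int where "\<sigma> = (if colour_at t v = White then 1 else - 1)"
  have "(\<Sum>u\<in>children t v. canonical_charge m t u) =
    (\<Sum>i<length (halves (subtree t v)). case halves (subtree t v) ! i of Stem \<Rightarrow> 0 |
      Edge y \<Rightarrow> (if colour y = Black then 1 else int m))"
    unfolding sum_children[OF v]
  proof (intro sum.cong refl)
    fix i assume i: "i \<in> {..<length (halves (subtree t v))}"
    show "(case halves (subtree t v) ! i of Stem \<Rightarrow> 0 | Edge u \<Rightarrow> canonical_charge m t (v @ [i])) =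
      (case halves (subtree t v) ! i of Stem \<Rightarrow> 0 | Edge y \<Rightarrow> (if colour y = Black then 1 else int m))"
    proof (cases "halves (subtree t v) ! i")
      case (Edge y)
      then have "v @ [i] \<in> verts t" "subtree t (v @ [i]) = y"
        using v i by (auto simp: snoc_in_verts subtree_append subtree_Cons)
      then show ?thesis using Edge by (simp add: canonical_charge_def)
    qed simp
  qed
  then have ch: "(\<Sum>u\<in>children t v. canonical_charge m t u) =
     sum_list (map (case_half_edge 0 (\<lambda>x. if x = Black then 1 else int m)) H)"
    unfolding H_def sum_list_half_colours .
  have st: "int (num_closing t v) - int (num_opening t v) =
     \<sigma> * sum_list (map (case_half_edge 1 (\<lambda>_. 0)) H)"
    unfolding H_def num_stems_half_colours[symmetric] \<sigma>_def
    by (cases "colour_at t v") (simp_all add: num_closing_def num_opening_def)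
  have black: "\<sigma> * sum_list (map (case_half_edge 1 (\<lambda>_. 0)) H) +
      sum_list (map (case_half_edge 0 (\<lambda>x. if x = Black then 1 else int m)) H) = int m - int (k - 1)"
    if "H = (replicate k Stem)[q := Edge White]" "q < k" "colour_at t v = Black" for k q
    unfolding that(1) sum_list_one_edge[OF that(2)] using that(3) by (simp add: \<sigma>_def)
  have "canonical_charge m t v = \<sigma> * sum_list (map (case_half_edge 1 (\<lambda>_. 0)) H) +
      sum_list (map (case_half_edge 0 (\<lambda>x. if x = Black then 1 else int m)) H)"
  proof (cases "v = []")
    case True
    then obtain q where "q < Suc m" "H = (replicate (Suc m) Stem)[q := Edge White]" "colour_at t v = Black"
      using assms(1) unfolding full_shape_def H_def by (auto simp: less_Suc_eq_le)
    from black[OF this(2,1,3)] show ?thesis using True by (simp add: canonical_charge_def)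
  next
    case False
    then have rs: "regular_shape m (subtree t v)" using assms(1) v unfolding full_shape_def by blast
    show ?thesis
    proof (cases "colour_at t v")
      case Black
      then obtain q where "q < m" "H = (replicate m Stem)[q := Edge White]"
        using rs unfolding regular_shape_def H_def by blast
      from black[OF this(2,1) Black] show ?thesis using False v Black assms(2) by (simp add: canonical_charge_def)
    next
      case White
      then have H: "length H = m" "Edge White \<notin> set H" using rs unfolding regular_shape_def H_def by auto
      have "sum_list (map (case_half_edge 1 (\<lambda>_. 0)) L) +
        sum_list (map (case_half_edge 0 (\<lambda>x. if x = Black then 1 else int m)) L) = int (length L)"
        if "Edge White \<notin> set L" for L
        using that by (induction L) (auto split: half_edge.splits)
      from this[OF H(2)] show ?thesis using False v White H(1) by (simp add: canonical_charge_def \<sigma>_def)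
    qed
  qed
  then show "canonical_charge m t v = int (num_closing t v) - int (num_opening t v) +
     (\<Sum>u\<in>children t v. canonical_charge m t u)"
    unfolding ch st .
qed

lemma infinite_well_charged_if_single_spine:
  assumes "full_shape m t" "m \<ge> 1" "single_spine t"
  shows "infinite_well_charged t"
proof -
  have c: "charge_function t (canonical_charge m t)" by (rule canonical_charge_function[OF assms(1,2)])
  have "charges_bounded t (canonical_charge m t)"
    using assms(1) by (auto simp: charges_bounded_def canonical_charge_def full_shape_def)
  then show ?thesis
    unfolding infinite_well_charged_def using c unique_charge_function[OF assms(3)] by metis
qed

lemma infinite_trees_if_alive:
  assumes "T \<in> trees_completion d" "alive T []"
  shows "T \<in> infinite_trees d"
proof -
  have "T \<notin> trees d"
  proof
    assume "T \<in> trees d"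
    then have fin: "finite (verts T)" unfolding trees_def trees_n_def by blast
    have "k \<in> length ` verts T" for k
    proof -
      obtain w where "length w = k" "[] @ w \<in> verts T"
        using assms(2)[unfolded alive_def, THEN spec, of k] by blast
      then show ?thesis by (intro image_eqI[of _ _ w]) auto
    qed
    then have "UNIV \<subseteq> length ` verts T" by blast
    then show False using fin by (meson finite_imageI finite_subset infinite_UNIV_nat)
  qed
  then show ?thesis using assms(1) by (simp add: infinite_trees_def)
qed

text \<open>An infinite spine excludes finite trees, and the charge conditions hold automatically, so
  only the number of spines has to be controlled.\<close>

lemma support_eq:
  assumes "m \<ge> 1"
  shows "{T \<in> infinite_trees (Suc m). single_spine T \<and> infinite_well_charged T} =
    {T \<in> trees_completion (Suc m). single_spine T}"
proof (intro subset_antisym subsetI)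
  fix T assume "T \<in> {T \<in> trees_completion (Suc m). single_spine T}"
  then have T: "T \<in> trees_completion (Suc m)" "single_spine T" by auto
  then have "alive T []" unfolding single_spine_iff by blast
  then show "T \<in> {T \<in> infinite_trees (Suc m). single_spine T \<and> infinite_well_charged T}"
    using infinite_trees_if_alive[OF T(1)] infinite_well_charged_if_single_spine[OF full_shape_closure[OF T(1)] assms T(2)] T(2)
    by simp
qed (auto simp: infinite_trees_def)

section \<open>Events of uniform random trees\<close>

lemma trees_n_event:
  "trees_n (Suc m) (Suc n) \<inter> X =
    (\<lambda>(r, l). black_vertex (Suc m) r (Vertex White l)) `
      (SIGMA r:{..m}. {l. length l = m \<and> black_vertex (Suc m) r (Vertex White l) \<in> X} \<inter> forests m n)"
  unfolding trees_n_Suc forests_def by auto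

definition root_event :: "nat \<Rightarrow> btree set \<Rightarrow> nat \<Rightarrow> btree half_edge list set" where
  "root_event m X r = {l. length l = m \<and> black_vertex (Suc m) r (Vertex White l) \<in> X}"

lemma card_trees_n_event:
  "finite (trees_n (Suc m) (Suc n) \<inter> X)"
  "real (card (trees_n (Suc m) (Suc n) \<inter> X)) = (\<Sum>r\<le>m. fps_nth (forest_gf m (root_event m X r)) n)"
proof -
  let ?A = "SIGMA r:{..m}. root_event m X r \<inter> forests m n"
  have fin: "finite (root_event m X r \<inter> forests m n)" for r
    by (rule finite_forests[of _ m]) (auto simp: root_event_def)
  have eq: "trees_n (Suc m) (Suc n) \<inter> X = (\<lambda>(r, l). black_vertex (Suc m) r (Vertex White l)) ` ?A"
    unfolding root_event_def by (rule trees_n_event)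
  show "finite (trees_n (Suc m) (Suc n) \<inter> X)"
    unfolding eq using fin by (intro finite_imageI finite_SigmaI) auto
  have "inj_on (\<lambda>(r, l). black_vertex (Suc m) r (Vertex White l)) ?A"
    by (auto simp: inj_on_def black_vertex_eq_iff)
  then have "card (trees_n (Suc m) (Suc n) \<inter> X) = card ?A"
    unfolding eq by (rule card_image)
  also have "\<dots> = (\<Sum>r\<le>m. card (root_event m X r \<inter> forests m n))"
    using fin by (subst card_SigmaI) auto
  finally show "real (card (trees_n (Suc m) (Suc n) \<inter> X)) = (\<Sum>r\<le>m. fps_nth (forest_gf m (root_event m X r)) n)"
    by (simp add: forest_gf_def)
qed

lemma finite_trees_n: "finite (trees_n (Suc m) (Suc n))"
  using card_trees_n_event(1)[of m n UNIV] by simp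

lemma card_trees_n: "real (card (trees_n (Suc m) (Suc n))) = real (Suc m) * fps_nth (slot_gf m UNIV ^ m) n"
  using card_trees_n_event(2)[of m n UNIV] forest_gf_all_in[of m m UNIV] by (simp add: root_event_def)

lemma trees_n_subset_completion: "trees_n d (Suc n) \<subseteq> trees_completion d"
proof -
  have "trees_n d (Suc n) \<subseteq> trees d" unfolding trees_def by auto
  then show ?thesis unfolding trees_completion_def using closure_subset by blast
qed

lemma space_borel_completion: "space (borel_completion d) = trees_completion d"
  by (simp add: borel_completion_def space_restrict_space)

lemma measurable_unif_trees:
  "(\<lambda>t. t) \<in> uniform_count_measure (trees_n d (Suc n)) \<rightarrow>\<^sub>M borel_completion d"
  using trees_n_subset_completion[of d n]
  by (auto simp: measurable_def space_uniform_count_measure sets_uniform_count_measure space_borel_completion)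

lemma sets_unif_trees: "sets (unif_trees d n) = sets (borel_completion d)"
  by (simp add: unif_trees_def)

section \<open>Vertices with two high subtrees\<close>

definition deep :: "nat \<Rightarrow> btree half_edge \<Rightarrow> bool" where
  "deep h x \<longleftrightarrow> (\<exists>u w. x = Edge u \<and> length w = h \<and> w \<in> verts u)"

lemma deep_Stem [simp]: "\<not> deep h Stem"
  by (simp add: deep_def)

lemma deep_Edge: "deep h (Edge u) \<longleftrightarrow> (\<exists>w. length w = h \<and> w \<in> verts u)"
  by (simp add: deep_def)

lemma ex_verts_Suc:
  "(\<exists>w. length w = Suc h \<and> w \<in> verts t) \<longleftrightarrow> (\<exists>x\<in>set (halves t). deep h x)"
  (is "?l \<longleftrightarrow> ?r")
proof
  assume ?l
  then obtain i w where w: "length w = h" "i # w \<in> verts t" by (auto simp: length_Suc_conv)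
  then obtain u where u: "i < length (halves t)" "halves t ! i = Edge u" "w \<in> verts u"
    by (auto simp: Cons_in_verts)
  then have "deep h (halves t ! i)" using w(1) unfolding deep_def by blast
  with nth_mem[OF u(1)] show ?r by (rule rev_bexI)
next
  assume ?r
  then obtain x where x: "x \<in> set (halves t)" "deep h x" by blast
  then obtain i where i: "i < length (halves t)" "halves t ! i = x"
    unfolding in_set_conv_nth by blast
  obtain u w where "x = Edge u" "length w = h" "w \<in> verts u" using x(2) unfolding deep_def by blast
  with i show ?l by (intro exI[of _ "i # w"]) (simp add: Cons_in_verts)
qed

text \<open>Passing from a slot to the slots of its white vertex consumes two levels, one for each
  colour.\<close>

lemma deep_branch:
  assumes "q < m"
  shows "deep (Suc (Suc h)) (branch m q l) \<longleftrightarrow> (\<exists>y\<in>set l. deep h y)"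
proof -
  have "deep (Suc (Suc h)) (branch m q l) \<longleftrightarrow>
      (\<exists>x\<in>set (halves (black_vertex m q (Vertex White l))). deep (Suc h) x)"
    unfolding branch_def deep_Edge by (rule ex_verts_Suc)
  also have "\<dots> \<longleftrightarrow> deep (Suc h) (Edge (Vertex White l))"
  proof
    assume "\<exists>x\<in>set (halves (black_vertex m q (Vertex White l))). deep (Suc h) x"
    then obtain x where x: "x \<in> set (halves (black_vertex m q (Vertex White l)))" "deep (Suc h) x" by blast
    then obtain u where "x = Edge u" unfolding deep_def by blast
    with x show "deep (Suc h) (Edge (Vertex White l))"
      by (simp only: Edge_in_black_vertex[OF assms])
  next
    assume "deep (Suc h) (Edge (Vertex White l))"
    moreover have "Edge (Vertex White l) \<in> set (halves (black_vertex m q (Vertex White l)))"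
      by (simp only: Edge_in_black_vertex[OF assms])
    ultimately show "\<exists>x\<in>set (halves (black_vertex m q (Vertex White l))). deep (Suc h) x" by (rule bexI)
  qed
  also have "\<dots> \<longleftrightarrow> (\<exists>y\<in>set l. deep h y)"
    unfolding deep_Edge ex_verts_Suc by simp
  finally show ?thesis .
qed

text \<open>As \<open>h\<close> grows, these ball events decrease to the event that two different
  children of \<open>v\<close> have infinite subtrees, which \<open>single_spine_iff\<close>
  has to exclude.\<close>

definition forked :: "nat list \<Rightarrow> nat \<Rightarrow> nat \<Rightarrow> nat \<Rightarrow> btree \<Rightarrow> bool" where
  "forked v i j h T \<longleftrightarrow> (\<exists>w. length w = h \<and> v @ i # w \<in> verts T) \<and> (\<exists>w. length w = h \<and> v @ j # w \<in> verts T)"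

lemma forked_Nil:
  "forked [] i j h t \<longleftrightarrow> i < length (halves t) \<and> j < length (halves t) \<and>
     deep h (halves t ! i) \<and> deep h (halves t ! j)"
  unfolding forked_def deep_def by (auto simp: Cons_in_verts)

lemma forked_Cons:
  "forked (s # v) i j h t \<longleftrightarrow> s < length (halves t) \<and> (\<exists>u. halves t ! s = Edge u \<and> forked v i j h u)"
  unfolding forked_def by (auto simp: Cons_in_verts)

text \<open>Black vertices have a single child, so two branches can only separate at a white vertex.\<close>

lemma forked_black_vertex:
  assumes "q < k" "i \<noteq> j"
  shows "\<not> forked [] i j h (black_vertex k q w)"
    "forked (s # v) i j h (black_vertex k q w) \<longleftrightarrow> s = q \<and> forked v i j h w"
  using assms by (auto simp: forked_Nil forked_Cons nth_halves_black_vertex split: if_splits)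

section \<open>Limits of event probabilities\<close>

context
  fixes m :: nat
  assumes m: "m \<ge> 2"
begin

interpretation tree_series m "slot_gf m UNIV"
  using m by unfold_locales (auto intro: slot_gf_UNIV)

lemma card_trees_n_pos: "card (trees_n (Suc m) (Suc n)) > 0"
proof -
  have "real (card (trees_n (Suc m) (Suc n))) > 0"
    unfolding card_trees_n using m coef_pos[of m n] by simp
  then show ?thesis by simp
qed

lemma prob_space_unif_trees: "prob_space (unif_trees (Suc m) (Suc n))"
  unfolding unif_trees_def
proof (rule prob_space.prob_space_distr)
  have "trees_n (Suc m) (Suc n) \<noteq> {}" using card_trees_n_pos[of n] by force
  then show "prob_space (uniform_count_measure (trees_n (Suc m) (Suc n)))"
    by (intro prob_space_uniform_count_measure finite_trees_n)
qed (rule measurable_unif_trees)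

lemma measure_unif_trees:
  assumes "trees_completion (Suc m) \<inter> X \<in> sets (borel_completion (Suc m))"
  shows "measure (unif_trees (Suc m) (Suc n)) (trees_completion (Suc m) \<inter> X) =
    real (card (trees_n (Suc m) (Suc n) \<inter> X)) / real (card (trees_n (Suc m) (Suc n)))"
proof -
  have "measure (unif_trees (Suc m) (Suc n)) (trees_completion (Suc m) \<inter> X) =
     measure (uniform_count_measure (trees_n (Suc m) (Suc n))) (trees_n (Suc m) (Suc n) \<inter> X)"
    unfolding unif_trees_def using trees_n_subset_completion[of "Suc m" n]
    by (subst measure_distr[OF measurable_unif_trees assms])
       (auto simp: space_uniform_count_measure intro!: arg_cong[of _ _ "measure _"])
  then show ?thesis
    by (simp add: measure_uniform_count_measure finite_trees_n)
qed

text \<open>Numerator and denominator of the probability are compared with the coefficients of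
  \<open>G\<close>.\<close>

lemma measure_unif_trees_limit:
  assumes X: "trees_completion (Suc m) \<inter> X \<in> sets (borel_completion (Suc m))"
    and L: "\<And>r. r \<le> m \<Longrightarrow> (\<lambda>n. fps_nth (forest_gf m (root_event m X r)) n / coef 1 n) \<longlonglongrightarrow> L r"
  shows "(\<lambda>n. measure (unif_trees (Suc m) (Suc n)) (trees_completion (Suc m) \<inter> X)) \<longlonglongrightarrow>
     (\<Sum>r\<le>m. L r) / (real (Suc m) * (real m * tau ^ (m - 1)))"
proof -
  have "(\<lambda>n. (\<Sum>r\<le>m. fps_nth (forest_gf m (root_event m X r)) n / coef 1 n) / (real (Suc m) * (coef m n / coef 1 n)))
     \<longlonglongrightarrow> (\<Sum>r\<le>m. L r) / (real (Suc m) * (real m * tau ^ (m - 1)))"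
    using m tau_gt_1 by (intro tendsto_intros coef_limit L) auto
  moreover have "(\<Sum>r\<le>m. fps_nth (forest_gf m (root_event m X r)) n / coef 1 n) / (real (Suc m) * (coef m n / coef 1 n))
     = measure (unif_trees (Suc m) (Suc n)) (trees_completion (Suc m) \<inter> X)" for n
  proof -
    have "coef 1 n > 0" by (rule coef_pos) simp
    moreover have "coef m n > 0" using m by (intro coef_pos) simp
    ultimately show ?thesis
      unfolding measure_unif_trees[OF X] card_trees_n_event(2) card_trees_n sum_divide_distrib[symmetric]
      by (simp add: field_simps)
  qed
  ultimately show ?thesis by simp
qed

text \<open>The form of the generating function of an event that explores part of a forest:
  \<open>p\<close> records the explored vertices and the exponent the number of slots about
  which nothing is known.\<close>

definition exploration_series :: "real fps \<Rightarrow> bool" where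
  "exploration_series A \<longleftrightarrow> (\<exists>p k. A = fps_of_poly p * slot_gf m UNIV ^ k)"

lemma exploration_series_0: "exploration_series 0"
  unfolding exploration_series_def by (intro exI[of _ 0]) simp

lemma exploration_series_1: "exploration_series 1"
  unfolding exploration_series_def by (intro exI[of _ 1] exI[of _ 0]) simp

lemma exploration_series_mult:
  assumes "exploration_series A" "exploration_series B"
  shows "exploration_series (A * B)"
proof -
  obtain p k q l where "A = fps_of_poly p * slot_gf m UNIV ^ k" "B = fps_of_poly q * slot_gf m UNIV ^ l"
    using assms unfolding exploration_series_def by blast
  then have "A * B = fps_of_poly (p * q) * slot_gf m UNIV ^ (k + l)"
    by (simp add: fps_of_poly_mult power_add algebra_simps)
  then show ?thesis unfolding exploration_series_def by blast
qed

lemma exploration_series_X: "exploration_series fps_X"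
  unfolding exploration_series_def by (intro exI[of _ "[:0, 1:]"] exI[of _ 0]) (simp add: fps_of_poly_pCons)

lemma exploration_series_power: "exploration_series (slot_gf m UNIV ^ k)"
  unfolding exploration_series_def by (intro exI[of _ 1] exI[of _ k]) simp

lemma exploration_series_nonempty_slots: "exploration_series (slot_gf m (- {Stem}))"
proof -
  have "slot_gf m ({Stem} \<union> - {Stem}) = 1 + slot_gf m (- {Stem})"
    by (subst slot_gf_Un) (auto simp: slot_gf_Stem)
  then have "slot_gf m (- {Stem}) = of_nat m * fps_X * slot_gf m UNIV ^ m"
    using slot_gf_UNIV[of m] by simp
  also have "\<dots> = fps_of_poly [:0, of_nat m:] * slot_gf m UNIV ^ m"
    by (simp add: fps_of_poly_pCons fps_of_nat mult.commute)
  finally show ?thesis unfolding exploration_series_def by blast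
qed

lemma exploration_series_limit:
  "exploration_series A \<Longrightarrow> \<exists>L. (\<lambda>n. fps_nth A n / coef 1 n) \<longlonglongrightarrow> L"
  unfolding exploration_series_def using poly_power_limit by blast

lemma tree_ball_branch:
  "map_half_edge (tree_ball (Suc (Suc R))) (branch m q l) = branch m q (map (map_half_edge (tree_ball R)) l)"
  by (simp add: branch_def black_vertex_def map_update)

lemma forest_gf_listset_explore:
  assumes "\<And>b. exploration_series (slot_gf m {x. f x = b})"
  shows "exploration_series (forest_gf m {l. length l = m \<and> map f l = bs})"
proof (cases "length bs = m")
  case True
  have "{l. length l = m \<and> map f l = bs} = listset (map (\<lambda>b. {x. f x = b}) bs)"
    using True by (auto simp: in_listset list_all2_conv_all_nth list_eq_iff_nth_eq)
  moreover have "exploration_series (prod_list (map (\<lambda>b. slot_gf m {x. f x = b}) cs))" for cs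
    by (induction cs) (auto intro: exploration_series_1 exploration_series_mult assms)
  ultimately show ?thesis by (simp add: forest_gf_listset o_def)
next
  case False
  then have "{l. length l = m \<and> map f l = bs} = {}" by auto
  then show ?thesis by (simp only: forest_gf_empty exploration_series_0)
qed

text \<open>Only even radii are considered, since two levels of a tree make one generation of slots. At
  the boundary of the ball a slot is merely known to be empty or not.\<close>

lemma exploration_series_ball:
  "exploration_series (slot_gf m {x. map_half_edge (tree_ball (2 * R)) x = b})"
proof (induction R arbitrary: b)
  case 0
  define f where "f = map_half_edge (tree_ball (2 * 0))"
  have f: "f Stem = Stem" "f (branch m q l) = Edge (Vertex Black [])" for q l
    by (simp_all add: f_def branch_def)
  have "exploration_series (slot_gf m {x. f x = b})"
  proof (cases "b = Stem")
    case True
    have "f x = b \<longleftrightarrow> x = Stem" if "slot m x" for x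
      using that by (cases rule: slot_cases) (simp_all add: f True)
    then have "slot_gf m {x. f x = b} = slot_gf m {Stem}" by (intro slot_gf_cong) simp
    then show ?thesis by (simp add: slot_gf_Stem exploration_series_1)
  next
    case b: False
    show ?thesis
    proof (cases "b = Edge (Vertex Black [])")
      case True
      have "f x = b \<longleftrightarrow> x \<noteq> Stem" if "slot m x" for x
        using that by (cases rule: slot_cases) (simp_all add: f True)
      then have "slot_gf m {x. f x = b} = slot_gf m (- {Stem})" by (intro slot_gf_cong) simp
      then show ?thesis by (simp add: exploration_series_nonempty_slots)
    next
      case False
      have "f x \<noteq> b" if "slot m x" for x
        using that b[symmetric] False[symmetric] by (cases rule: slot_cases) (simp_all add: f)
      then have "slot_gf m {x. f x = b} = slot_gf m {}" by (intro slot_gf_cong) simp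
      then show ?thesis by (simp add: exploration_series_0)
    qed
  qed
  then show ?case by (simp only: f_def)
next
  case (Suc R)
  define f where "f = map_half_edge (tree_ball (2 * R))"
  define g where "g = map_half_edge (tree_ball (2 * Suc R))"
  have gb: "g (branch m q l) = branch m q (map f l)" for q l
    using tree_ball_branch[of "2 * R" q l] by (simp only: f_def g_def mult_Suc_right add_2_eq_Suc)
  have gs: "g Stem = Stem" by (simp add: g_def)
  have "exploration_series (slot_gf m {x. g x = b})"
  proof (cases "\<exists>q bs. q < m \<and> b = branch m q bs")
    case True
    then obtain q bs where q: "q < m" "b = branch m q bs" by blast
    have "g x = b \<longleftrightarrow> x \<in> branch m q ` {l. length l = m \<and> map f l = bs}" if "slot m x" for x
      using that
    proof (cases rule: slot_cases)
      case (2 r l)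
      then show ?thesis by (auto simp add: gb q(2) q(1) image_iff)
    qed (auto simp: gs q(2))
    then have "slot_gf m {x. g x = b} = slot_gf m (branch m q ` {l. length l = m \<and> map f l = bs})"
      by (intro slot_gf_cong) blast
    also have "\<dots> = fps_X * forest_gf m {l. length l = m \<and> map f l = bs}"
      using q by (intro slot_gf_branch) auto
    also have "exploration_series \<dots>"
      unfolding f_def by (intro exploration_series_mult exploration_series_X forest_gf_listset_explore Suc)
    finally show ?thesis .
  next
    case False
    show ?thesis
    proof (cases "b = Stem")
      case True
      have "g x = b \<longleftrightarrow> x = Stem" if "slot m x" for x
        using that by (cases rule: slot_cases) (simp_all add: gb gs True)
      then have "slot_gf m {x. g x = b} = slot_gf m {Stem}" by (intro slot_gf_cong) simp
      then show ?thesis by (simp add: slot_gf_Stem exploration_series_1)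
    next
      case b: False
      have "g x \<noteq> b" if "slot m x" for x
        using that
      proof (cases rule: slot_cases)
        case (2 r l)
        then show ?thesis using False by (metis gb)
      qed (use b gs in simp)
      then have "slot_gf m {x. g x = b} = slot_gf m {}" by (intro slot_gf_cong) simp
      then show ?thesis by (simp add: exploration_series_0)
    qed
  qed
  then show ?case by (simp only: g_def)
qed

lemma exploration_series_root_ball:
  assumes "r \<le> m"
  shows "exploration_series (forest_gf m (root_event m {t. tree_ball (2 * R) t = b} r))"
proof (cases R)
  case 0
  have all: "forest_gf m {l. length l = m} = slot_gf m UNIV ^ m" using forest_gf_all_in[of m m UNIV] by simp
  have "root_event m {t. tree_ball (2 * R) t = b} r = (if b = Vertex Black [] then {l. length l = m} else {})"
    by (auto simp: root_event_def 0)
  then show ?thesis by (simp add: all exploration_series_power exploration_series_0)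
next
  case (Suc S)
  define f where "f = map_half_edge (tree_ball (2 * S))"
  have tb: "tree_ball (2 * R) (black_vertex (Suc m) r (Vertex White l)) =
      black_vertex (Suc m) r (Vertex White (map f l))" for l
    by (simp add: Suc f_def black_vertex_def map_update del: replicate.simps)
  show ?thesis
  proof (cases "\<exists>bs. b = black_vertex (Suc m) r (Vertex White bs)")
    case True
    then obtain bs where b: "b = black_vertex (Suc m) r (Vertex White bs)" by blast
    have "root_event m {t. tree_ball (2 * R) t = b} r = {l. length l = m \<and> map f l = bs}"
      using assms unfolding root_event_def mem_Collect_eq tb b by (simp add: black_vertex_eq_iff)
    then show ?thesis unfolding f_def by (simp only: forest_gf_listset_explore exploration_series_ball)
  next
    case False
    then have "root_event m {t. tree_ball (2 * R) t = b} r = {}"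
      unfolding root_event_def mem_Collect_eq tb by blast
    then show ?thesis by (simp add: exploration_series_0)
  qed
qed

text \<open>Slots of height below \<open>2 k\<close> are built in at most \<open>k\<close> generations,
  so they have a polynomial generating function.\<close>

lemma slot_gf_not_deep: "slot_gf m {x. \<not> deep (2 * k) x} = fps_of_poly (low_poly k)"
proof (induction k)
  case 0
  have d: "deep 0 (branch m q l)" for q l
    by (simp add: branch_def deep_Edge)
  have "\<not> deep (2 * 0) x \<longleftrightarrow> x = Stem" if "slot m x" for x
    using that by (cases rule: slot_cases) (simp_all add: d)
  then have "slot_gf m {x. \<not> deep (2 * 0) x} = slot_gf m {Stem}"
    by (intro slot_gf_cong) simp
  then show ?case by (simp add: slot_gf_Stem)
next
  case (Suc k)
  let ?Y = "{x. \<not> deep (2 * k) x}"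
  have "\<not> deep (2 * Suc k) x \<longleftrightarrow> x \<in> insert Stem (\<Union>q<m. branch m q ` {l. length l = m \<and> set l \<subseteq> ?Y})"
    if "slot m x" for x
    using that
  proof (cases rule: slot_cases)
    case (2 q l)
    have "\<not> deep (2 * Suc k) x \<longleftrightarrow> set l \<subseteq> ?Y"
      using deep_branch[OF 2(2), of "2 * k" l] unfolding 2(1) by auto
    also have "\<dots> \<longleftrightarrow> x \<in> insert Stem (\<Union>q<m. branch m q ` {l. length l = m \<and> set l \<subseteq> ?Y})"
    proof
      assume "set l \<subseteq> ?Y"
      then show "x \<in> insert Stem (\<Union>q<m. branch m q ` {l. length l = m \<and> set l \<subseteq> ?Y})"
        using 2 by blast
    next
      assume "x \<in> insert Stem (\<Union>q<m. branch m q ` {l. length l = m \<and> set l \<subseteq> ?Y})"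
      then obtain r l' where "x = branch m r l'" "set l' \<subseteq> ?Y"
        using 2(1) branch_neq_Stem by blast
      then show "set l \<subseteq> ?Y" using 2(1,2) branch_eq_iff by metis
    qed
    finally show ?thesis .
  qed simp
  then have "slot_gf m {x. \<not> deep (2 * Suc k) x} =
     slot_gf m (insert Stem (\<Union>q<m. branch m q ` {l. length l = m \<and> set l \<subseteq> ?Y}))"
    by (intro slot_gf_cong) blast
  also have "\<dots> = 1 + of_nat m * fps_X * slot_gf m ?Y ^ m" by (rule slot_gf_Stem_or_branch)
  also have "\<dots> = fps_of_poly (low_poly (Suc k))"
  proof -
    have "fps_of_poly [:0, real m:] = of_nat m * fps_X"
      by (simp add: fps_of_poly_pCons fps_of_nat mult.commute)
    then show ?thesis
      unfolding Suc low_poly.simps fps_of_poly_add fps_of_poly_mult fps_of_poly_power fps_of_poly_1 by simp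
  qed
  finally show ?case .
qed

lemma slot_gf_deep: "slot_gf m {x. deep (2 * k) x} = slot_gf m UNIV - fps_of_poly (low_poly k)"
proof -
  have "slot_gf m ({x. deep (2 * k) x} \<union> {x. \<not> deep (2 * k) x}) = slot_gf m {x. deep (2 * k) x} + fps_of_poly (low_poly k)"
    unfolding slot_gf_not_deep[symmetric] by (rule slot_gf_Un) auto
  moreover have "{x. deep (2 * k) x} \<union> {x. \<not> deep (2 * k) x} = UNIV" by auto
  ultimately show ?thesis by simp
qed

text \<open>By induction along the path to \<open>v\<close>, two levels at a time. Each generation on
  the path contributes a factor \<open>z\<close> for its black vertex and \<open>m - 1\<close>
  free slots, and the white vertex at the end has two constrained slots and \<open>m -
  2\<close> free ones. The exponents do not depend on \<open>k\<close>, which allows \<open>k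
  \<longrightarrow> \<infinity>\<close> afterwards. The generating function is zero if the
  path is incompatible with the tree structure, for instance if it ends at a black vertex.\<close>

lemma forest_gf_forked:
  assumes "i \<noteq> j"
  shows "(\<forall>k. forest_gf m {l. length l = m \<and> forked v i j (2 * k) (Vertex White l)} = 0) \<or>
    (\<exists>a r. \<forall>k. forest_gf m {l. length l = m \<and> forked v i j (2 * k) (Vertex White l)} =
       fps_X ^ a * slot_gf m UNIV ^ r * (slot_gf m UNIV - fps_of_poly (low_poly k))\<^sup>2)"
proof (induction v rule: induct_list012)
  case 1
  show ?case
  proof (cases "i < m \<and> j < m")
    case True
    have "forest_gf m {l. length l = m \<and> forked [] i j (2 * k) (Vertex White l)} =
       fps_X ^ 0 * slot_gf m UNIV ^ (m - 2) * (slot_gf m UNIV - fps_of_poly (low_poly k))\<^sup>2" for k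
    proof -
      have eq: "{l. length l = m \<and> forked [] i j (2 * k) (Vertex White l)} =
        {l. length l = m \<and> (\<forall>s\<in>{i, j}. l ! s \<in> {x. deep (2 * k) x})}"
        using True by (auto simp: forked_Nil)
      have "{i, j} \<subseteq> {..<m}" "card {i, j} = 2" using True assms by auto
      then show ?thesis
        unfolding eq forest_gf_marked[OF \<open>{i, j} \<subseteq> {..<m}\<close>] slot_gf_deep by (simp add: mult.commute)
    qed
    then show ?thesis by blast
  next
    case False
    then have "{l. length l = m \<and> forked [] i j (2 * k) (Vertex White l)} = {}" for k
      by (auto simp: forked_Nil)
    then have "forest_gf m {l. length l = m \<and> forked [] i j (2 * k) (Vertex White l)} = 0" for k
      by (simp only: forest_gf_empty)
    then show ?thesis by blast
  qed
next
  case (2 s)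
  have "forest_gf m {l. length l = m \<and> forked [s] i j (2 * k) (Vertex White l)} = forest_gf m {}" for k
  proof (rule forest_gf_cong)
    fix l assume l: "\<forall>x\<in>set l. slot m x"
    have "\<not> forked [s] i j (2 * k) (Vertex White l)"
    proof
      assume "forked [s] i j (2 * k) (Vertex White l)"
      then obtain u where u: "s < length l" "l ! s = Edge u" "forked [] i j (2 * k) u" by (auto simp: forked_Cons)
      then have "slot m (Edge u)" using l by (metis nth_mem)
      then show False using u(3) forked_black_vertex(1)[OF _ assms] by cases auto
    qed
    then show "l \<in> {l. length l = m \<and> forked [s] i j (2 * k) (Vertex White l)} \<longleftrightarrow> l \<in> {}" by simp
  qed
  then show ?case by simp
next
  case (3 s q v)
  define E where "E k = {l. length l = m \<and> forked v i j (2 * k) (Vertex White l)}" for k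
  have *: "forest_gf m {l. length l = m \<and> forked (s # q # v) i j (2 * k) (Vertex White l)} =
     (if s < m \<and> q < m then fps_X * slot_gf m UNIV ^ (m - 1) * forest_gf m (E k) else 0)" for k
  proof (cases "s < m \<and> q < m")
    case True
    have "forest_gf m {l. length l = m \<and> forked (s # q # v) i j (2 * k) (Vertex White l)} =
      forest_gf m {l. length l = m \<and> (\<forall>i\<in>{s}. l ! i \<in> branch m q ` E k)}"
    proof (rule forest_gf_cong)
      fix l assume l: "\<forall>x\<in>set l. slot m x"
      have "forked (s # q # v) i j (2 * k) (Vertex White l) \<longleftrightarrow> l ! s \<in> branch m q ` E k" if len: "length l = m"
      proof -
        have "slot m (l ! s)" using l True len by simp
        then show ?thesis
        proof (cases rule: slot_cases)
          case 1
          then show ?thesis by (auto simp: forked_Cons[of s])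
        next
          case (2 r l')
          then show ?thesis using True len
            by (auto simp: forked_Cons[of s] branch_def[of m r] forked_black_vertex(2)[OF _ assms] E_def
                 branch_def[of m q] black_vertex_eq_iff)
        qed
      qed
      then show "l \<in> {l. length l = m \<and> forked (s # q # v) i j (2 * k) (Vertex White l)} \<longleftrightarrow>
        l \<in> {l. length l = m \<and> (\<forall>i\<in>{s}. l ! i \<in> branch m q ` E k)}"
        by auto
    qed
    also have "\<dots> = slot_gf m (branch m q ` E k) * slot_gf m UNIV ^ (m - 1)"
      using True forest_gf_marked[of "{s}" m m "branch m q ` E k"] by simp
    also have "slot_gf m (branch m q ` E k) = fps_X * forest_gf m (E k)"
      using True by (intro slot_gf_branch) (auto simp: E_def)
    finally show ?thesis using True by (simp add: algebra_simps)
  next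
    case False
    have "forest_gf m {l. length l = m \<and> forked (s # q # v) i j (2 * k) (Vertex White l)} = forest_gf m {}"
    proof (rule forest_gf_cong)
      fix l assume l: "\<forall>x\<in>set l. slot m x"
      have "\<not> (length l = m \<and> forked (s # q # v) i j (2 * k) (Vertex White l))"
      proof
        assume "length l = m \<and> forked (s # q # v) i j (2 * k) (Vertex White l)"
        then obtain u where u: "length l = m" "s < length l" "l ! s = Edge u" "forked (q # v) i j (2 * k) u"
          by (auto simp: forked_Cons[of s])
        then have "slot m (Edge u)" using l by (metis nth_mem)
        then show False using u False forked_black_vertex(2)[OF _ assms] by cases auto
      qed
      then show "l \<in> {l. length l = m \<and> forked (s # q # v) i j (2 * k) (Vertex White l)} \<longleftrightarrow> l \<in> {}" by simp
    qed
    then show ?thesis unfolding if_not_P[OF False] by (simp only: forest_gf_empty)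
  qed
  show ?case
    using "3.IH"(1)
  proof
    assume "\<forall>k. forest_gf m {l. length l = m \<and> forked v i j (2 * k) (Vertex White l)} = 0"
    then show ?thesis unfolding * E_def by simp
  next
    assume "\<exists>a r. \<forall>k. forest_gf m {l. length l = m \<and> forked v i j (2 * k) (Vertex White l)} =
       fps_X ^ a * slot_gf m UNIV ^ r * (slot_gf m UNIV - fps_of_poly (low_poly k))\<^sup>2"
    then obtain a r where ar: "\<And>k. forest_gf m (E k) =
       fps_X ^ a * slot_gf m UNIV ^ r * (slot_gf m UNIV - fps_of_poly (low_poly k))\<^sup>2" unfolding E_def by blast
    show ?thesis
    proof (cases "s < m \<and> q < m")
      case True
      have "fps_X * slot_gf m UNIV ^ (m - 1) * forest_gf m (E k) =
         fps_X ^ Suc a * slot_gf m UNIV ^ (m - 1 + r) * (slot_gf m UNIV - fps_of_poly (low_poly k))\<^sup>2" for k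
        unfolding ar by (simp add: power_add algebra_simps)
      then show ?thesis unfolding * if_P[OF True] by blast
    next
      case False
      then show ?thesis unfolding * if_not_P[OF False] by blast
    qed
  qed
qed

lemma forked_limit:
  assumes "i \<noteq> j"
  shows "\<exists>L. L \<longlonglongrightarrow> 0 \<and> (\<forall>k. (\<lambda>n. fps_nth (forest_gf m {l. length l = m \<and> forked v i j (2 * k) (Vertex White l)}) n / coef 1 n) \<longlonglongrightarrow> L k)"
  using forest_gf_forked[OF assms, of v]
proof
  assume "\<forall>k. forest_gf m {l. length l = m \<and> forked v i j (2 * k) (Vertex White l)} = 0"
  then show ?thesis by (intro exI[of _ "\<lambda>_. 0"]) simp
next
  assume "\<exists>a r. \<forall>k. forest_gf m {l. length l = m \<and> forked v i j (2 * k) (Vertex White l)} =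
       fps_X ^ a * slot_gf m UNIV ^ r * (slot_gf m UNIV - fps_of_poly (low_poly k))\<^sup>2"
  then obtain a r where ar: "\<And>k. forest_gf m {l. length l = m \<and> forked v i j (2 * k) (Vertex White l)} =
       fps_X ^ a * slot_gf m UNIV ^ r * (slot_gf m UNIV - fps_of_poly (low_poly k))\<^sup>2" by blast
  show ?thesis
    unfolding ar using two_deep_coefficient_limit two_deep_limit_vanishes by (intro exI[of _ "two_deep_limit a r"]) blast
qed

lemma measure_forked_limit:
  assumes "i \<noteq> j"
    and sets: "\<And>h. trees_completion (Suc m) \<inter> {T. forked v i j h T} \<in> sets (borel_completion (Suc m))"
  shows "\<exists>L. L \<longlonglongrightarrow> 0 \<and> (\<forall>k. (\<lambda>n. measure (unif_trees (Suc m) (Suc n)) (trees_completion (Suc m) \<inter> {T. forked v i j (2 * k) T})) \<longlonglongrightarrow> L k)"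
proof -
  define c where "c = real (Suc m) * (real m * tau ^ (m - 1))"
  have ev: "root_event m {T. forked v i j h T} r = (case v of [] \<Rightarrow> {} |
      s # v' \<Rightarrow> if r = s then {l. length l = m \<and> forked v' i j h (Vertex White l)} else {})" if "r \<le> m" for h r
    using that assms(1) by (auto simp: root_event_def forked_black_vertex split: list.split)
  have "\<exists>L. L \<longlonglongrightarrow> 0 \<and> (\<forall>k. (\<lambda>n. fps_nth (forest_gf m (root_event m {T. forked v i j (2 * k) T} r)) n / coef 1 n) \<longlonglongrightarrow> L k)"
    if "r \<le> m" for r
  proof (cases "v \<noteq> [] \<and> r = hd v")
    case True
    then obtain v' where "v = r # v'" by (cases v) auto
    then have "root_event m {T. forked v i j h T} r = {l. length l = m \<and> forked v' i j h (Vertex White l)}" for h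
      by (subst ev[OF that]) simp
    then show ?thesis using forked_limit[OF assms(1), of v'] by simp
  next
    case False
    then have "root_event m {T. forked v i j (2 * k) T} r = {}" for k
      by (auto simp: ev[OF that] split: list.split)
    then show ?thesis by (intro exI[of _ "\<lambda>_. 0"]) simp
  qed
  then have "\<forall>r. \<exists>L. r \<le> m \<longrightarrow> L \<longlonglongrightarrow> 0 \<and> (\<forall>k. (\<lambda>n. fps_nth (forest_gf m (root_event m {T. forked v i j (2 * k) T} r)) n / coef 1 n) \<longlonglongrightarrow> L k)"
    by blast
  then obtain L where L: "\<And>r. r \<le> m \<Longrightarrow> L r \<longlonglongrightarrow> 0"
    "\<And>r k. r \<le> m \<Longrightarrow> (\<lambda>n. fps_nth (forest_gf m (root_event m {T. forked v i j (2 * k) T} r)) n / coef 1 n) \<longlonglongrightarrow> L r k"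
    by metis
  have "(\<lambda>k. (\<Sum>r\<le>m. L r k) / c) \<longlonglongrightarrow> (\<Sum>r\<le>m. 0) / c"
    unfolding c_def using m tau_gt_1 by (intro tendsto_intros L) auto
  then have "(\<lambda>k. (\<Sum>r\<le>m. L r k) / c) \<longlonglongrightarrow> 0" by simp
  moreover have "(\<lambda>n. measure (unif_trees (Suc m) (Suc n)) (trees_completion (Suc m) \<inter> {T. forked v i j (2 * k) T})) \<longlonglongrightarrow> (\<Sum>r\<le>m. L r k) / c" for k
    unfolding c_def by (intro measure_unif_trees_limit sets L)
  ultimately show ?thesis by (intro exI[of _ "\<lambda>k. (\<Sum>r\<le>m. L r k) / c"]) blast
qed

lemma measure_ball_convergent:
  assumes sets: "trees_completion (Suc m) \<inter> {T. tree_ball (2 * R) T = b} \<in> sets (borel_completion (Suc m))"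
  shows "convergent (\<lambda>n. measure (unif_trees (Suc m) (Suc n)) (trees_completion (Suc m) \<inter> {T. tree_ball (2 * R) T = b}))"
proof -
  have "\<forall>r. \<exists>L. r \<le> m \<longrightarrow> (\<lambda>n. fps_nth (forest_gf m (root_event m {T. tree_ball (2 * R) T = b} r)) n / coef 1 n) \<longlonglongrightarrow> L"
    using exploration_series_limit exploration_series_root_ball by blast
  then obtain L where "\<And>r. r \<le> m \<Longrightarrow> (\<lambda>n. fps_nth (forest_gf m (root_event m {T. tree_ball (2 * R) T = b} r)) n / coef 1 n) \<longlonglongrightarrow> L r"
    by metis
  from measure_unif_trees_limit[OF sets this] show ?thesis by (auto simp: convergent_def)
qed

end

section \<open>The limiting distribution\<close>

lemma verts_cong_if_balls_eq:
  assumes "tree_ball K s = tree_ball K t" "length u \<le> K"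
  shows "u \<in> verts s \<longleftrightarrow> u \<in> verts t"
  using ball_determinedD[OF ball_determined_mono[OF ball_determined_verts assms(2)] assms(1)] by simp

lemma ball_determined_height: "ball_determined k {T. \<exists>w. length w = k \<and> w \<in> verts T}"
  unfolding ball_determined_def mem_Collect_eq
proof (intro allI impI)
  fix s t assume eq: "tree_ball k s = tree_ball k t"
  show "(\<exists>w. length w = k \<and> w \<in> verts s) \<longleftrightarrow> (\<exists>w. length w = k \<and> w \<in> verts t)"
    using verts_cong_if_balls_eq[OF eq] by blast
qed

lemma ball_determined_forked: "ball_determined (length v + Suc h) {T. forked v i j h T}"
  unfolding ball_determined_def mem_Collect_eq
proof (intro allI impI)
  fix s t assume eq: "tree_ball (length v + Suc h) s = tree_ball (length v + Suc h) t"
  have *: "(\<exists>w. length w = h \<and> v @ q # w \<in> verts s) \<longleftrightarrow> (\<exists>w. length w = h \<and> v @ q # w \<in> verts t)" for q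
  proof -
    have "v @ q # w \<in> verts s \<longleftrightarrow> v @ q # w \<in> verts t" if "length w = h" for w
      by (rule verts_cong_if_balls_eq[OF eq]) (simp add: that)
    then show ?thesis by blast
  qed
  show "forked v i j h s \<longleftrightarrow> forked v i j h t"
    unfolding forked_def * ..
qed

text \<open>Even heights suffice as reaching a height includes reaching all smaller ones.\<close>

lemma alive_pair_iff:
  "alive T (v @ [i]) \<and> alive T (v @ [j]) \<longleftrightarrow> (\<forall>k. forked v i j (2 * k) T)"
proof
  assume "alive T (v @ [i]) \<and> alive T (v @ [j])"
  then show "\<forall>k. forked v i j (2 * k) T" unfolding alive_def forked_def by simp
next
  assume f: "\<forall>k. forked v i j (2 * k) T"
  have *: "\<exists>w. length w = k \<and> (v @ [q]) @ w \<in> verts T"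
    if w: "length w = 2 * k" "v @ q # w \<in> verts T" for w k q
  proof -
    have "((v @ [q]) @ take k w) @ drop k w \<in> verts T" using w(2) by simp
    then have "(v @ [q]) @ take k w \<in> verts T" by (rule verts_butlast)
    then show ?thesis using w(1) by (intro exI[of _ "take k w"]) simp
  qed
  show "alive T (v @ [i]) \<and> alive T (v @ [j])"
    using f * unfolding alive_def forked_def by meson
qed

text \<open>A finite set that contains the balls of radius \<open>R\<close> of all trees with at most
  \<open>D\<close> half-edges listed at each vertex.\<close>

primrec bounded_balls :: "nat \<Rightarrow> nat \<Rightarrow> btree set" where
  "bounded_balls D 0 = {Vertex Black [], Vertex White []}"
| "bounded_balls D (Suc R) = (\<lambda>(c, l). Vertex c l) `
     ({Black, White} \<times> {l. set l \<subseteq> insert Stem (Edge ` bounded_balls D R) \<and> length l \<le> D})"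

lemma finite_bounded_balls: "finite (bounded_balls D R)"
proof (induction R)
  case (Suc R)
  then have "finite {l. set l \<subseteq> insert Stem (Edge ` bounded_balls D R) \<and> length l \<le> D}"
    by (intro finite_lists_length_le) auto
  then show ?case by simp
qed simp

lemma tree_ball_in_bounded_balls:
  assumes "\<forall>v\<in>verts t. length (halves (subtree t v)) \<le> D"
  shows "tree_ball R t \<in> bounded_balls D R"
  using assms
proof (induction R arbitrary: t)
  case 0
  then show ?case by (cases "colour t") auto
next
  case (Suc R)
  have len: "length (halves t) \<le> D"
    and ch: "\<And>u. Edge u \<in> set (halves t) \<Longrightarrow> \<forall>v\<in>verts u. length (halves (subtree u v)) \<le> D"
    using Suc.prems unfolding all_verts_unfold[of t "\<lambda>u. length (halves u) \<le> D"] by blast+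
  have "map_half_edge (tree_ball R) x \<in> insert Stem (Edge ` bounded_balls D R)" if "x \<in> set (halves t)" for x
  proof (cases x)
    case (Edge u)
    then show ?thesis using Suc.IH[OF ch[of u]] that by simp
  qed simp
  then have "set (map (map_half_edge (tree_ball R)) (halves t)) \<subseteq> insert Stem (Edge ` bounded_balls D R)"
    unfolding set_map by (rule image_subsetI)
  moreover have "colour t \<in> {Black, White}" by (cases "colour t") auto
  ultimately show ?case
    using len unfolding tree_ball.simps bounded_balls.simps
    by (intro image_eqI[of _ _ "(colour t, map (map_half_edge (tree_ball R)) (halves t))"])
       (simp_all del: set_map)
qed

lemma finite_balls_completion: "finite (tree_ball R ` trees_completion d)"
proof (rule finite_subset[OF _ finite_bounded_balls])
  show "tree_ball R ` trees_completion d \<subseteq> bounded_balls d R"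
  proof (rule image_subsetI)
    fix T assume "T \<in> trees_completion d"
    then obtain t where t: "t \<in> trees d" "tree_ball R T = tree_ball R t"
      unfolding trees_completion_def closure_iff_tree_balls by blast
    from t(1) have "regular d t" unfolding trees_def trees_n_def by blast
    then have "\<forall>v\<in>verts t. length (halves (subtree t v)) \<le> d"
      unfolding regular_def degree_def by auto
    then show "tree_ball R T \<in> bounded_balls d R"
      unfolding t(2) by (rule tree_ball_in_bounded_balls)
  qed
qed

lemma closed_trees_completion: "closed (trees_completion d)"
  by (simp add: trees_completion_def)

text \<open>Trees that do not reach height \<open>k\<close> are among the finitely many balls of radius
  \<open>k\<close>, so their sizes are bounded.\<close>

lemma trees_n_eventually_high:
  "\<exists>N. \<forall>n\<ge>N. trees_n d (Suc n) \<subseteq> {T. \<exists>w. length w = k \<and> w \<in> verts T}"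
proof -
  have "finite (num_black ` tree_ball k ` trees_completion d)"
    by (intro finite_imageI finite_balls_completion)
  then obtain N where N: "\<And>n. n \<in> num_black ` tree_ball k ` trees_completion d \<Longrightarrow> n \<le> N"
    unfolding finite_nat_set_iff_bounded_le by blast
  have "\<exists>w. length w = k \<and> w \<in> verts t" if n: "n \<ge> N" and t: "t \<in> trees_n d (Suc n)" for n t
  proof (rule ccontr)
    assume "\<not> ?thesis"
    then have "tree_ball k t = t" by (intro tree_ball_id) blast
    moreover have "t \<in> trees_completion d" using t trees_n_subset_completion by blast
    ultimately have "t \<in> tree_ball k ` trees_completion d" by (metis imageI)
    then have "num_black t \<le> N" by (intro N imageI)
    moreover have "num_black t = Suc n" using t by (simp add: trees_n_def num_black_def)
    ultimately show False using n by simp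
  qed
  then show ?thesis by (intro exI[of _ N]) blast
qed

theorem theorem5:
  fixes d :: nat
  assumes "d \<ge> 3"
  shows "\<exists>P :: btree measure.
           prob_space P \<and> sets P = sets (borel_completion d) \<and>
           weak_conv_on (trees_completion d) (unif_trees d) P \<and>
           measure P {T \<in> infinite_trees d. single_spine T \<and> infinite_well_charged T} = 1"
proof -
  define m where "m = d - 1"
  have m: "m \<ge> 2" and d: "d = Suc m" using assms by (auto simp: m_def)
  let ?S = "trees_completion d"
  \<comment> \<open>There is no tree without black vertices, so the sequence of probability measures starts at \<open>1\<close>.\<close>
  define M where "M n = unif_trees d (Suc n)" for n
  have setsM: "sets (M n) = sets (restrict_space borel ?S)" for n
    unfolding M_def sets_unif_trees borel_completion_def ..
  have M: "prob_space (M n)" for n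
    unfolding M_def d by (rule prob_space_unif_trees[OF m])
  have fin: "finite_measure (M n)" for n using M by (simp add: prob_space.finite_measure)
  have sets: "?S \<inter> X \<in> sets (borel_completion d)" if "ball_determined R X" for R X
    unfolding borel_completion_def by (rule sets_restrict_borel_ball_determined[OF that])
  have Int_eq: "{t \<in> ?S. tree_ball R t = b} = ?S \<inter> {t. tree_ball R t = b}" for R b by blast
  have conv: "convergent (\<lambda>n. measure (M n) {t \<in> ?S. tree_ball R t = b})" for R b
  proof -
    \<comment> \<open>Balls of odd radius are reduced to balls of even radius.\<close>
    have det: "ball_determined (2 * R) {t. tree_ball R t = b}"
      by (rule ball_determined_mono[OF ball_determined_tree_ball]) simp
    have "convergent (\<lambda>n. measure (M n) (?S \<inter> {t. tree_ball (2 * R) t = b'}))" for b'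
      unfolding M_def d by (rule measure_ball_convergent[OF m sets[unfolded d, OF ball_determined_tree_ball]])
    then show ?thesis
      unfolding Int_eq[of R] finite_balls_decomposition[OF finite_balls_completion det fin setsM] Int_eq[of "2 * R"]
      by (intro convergent_sum)
  qed
  obtain P where P: "prob_space P" "sets P = sets (restrict_space borel ?S)"
    and lim: "\<And>R X. ball_determined R X \<Longrightarrow> (\<lambda>n. measure (M n) (?S \<inter> X)) \<longlonglongrightarrow> measure P (?S \<inter> X)"
    using limit_measure_exists[OF closed_trees_completion finite_balls_completion M setsM conv] by blast
  have setsP: "sets P = sets (borel_completion d)" using P(2) by (simp add: borel_completion_def)
  have "weak_conv_on ?S M P"
    using lim[OF ball_determined_tree_ball]
    by (intro weak_conv_on_if_balls_converge[OF closed_trees_completion finite_balls_completion M setsM P])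
       (simp only: Int_eq)
  then have weak: "weak_conv_on ?S (unif_trees d) P"
    unfolding weak_conv_on_def M_def filterlim_sequentially_Suc[of "\<lambda>n. integral\<^sup>L (unif_trees d n) f" for f] .
  interpret P: prob_space P by (rule P(1))
  have sp: "space P = ?S" using sets_eq_imp_space_eq[OF P(2)] by (simp add: space_restrict_space)
  have pred: "Measurable.pred P (\<lambda>T. T \<in> X)" if "ball_determined R X" for R X
  proof -
    have "{T \<in> space P. T \<in> X} = ?S \<inter> X" unfolding sp by blast
    then show ?thesis using sets[OF that] unfolding setsP[symmetric] by (simp add: pred_def)
  qed
  define H where "H k T \<longleftrightarrow> (\<exists>w. length w = k \<and> w \<in> verts T)" for k T
  have pred_height [measurable]: "Measurable.pred P (H k)" for k
    using pred[OF ball_determined_height[of k]] unfolding mem_Collect_eq H_def .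
  have pred_forked [measurable]: "Measurable.pred P (forked v i j h)" for v i j h
    using pred[OF ball_determined_forked[of v h i j]] unfolding mem_Collect_eq .
  have high: "AE T in P. H k T" for k
  proof -
    let ?H = "{T. \<exists>w. length w = k \<and> w \<in> verts T}"
    obtain N where N: "\<And>n. n \<ge> N \<Longrightarrow> trees_n d (Suc n) \<subseteq> ?H"
      using trees_n_eventually_high[of d k] by blast
    have "measure (M n) (?S \<inter> ?H) = 1" if "n \<ge> N" for n
    proof -
      have "trees_n (Suc m) (Suc n) \<inter> ?H = trees_n (Suc m) (Suc n)"
        using N[OF that] unfolding d by (rule Int_absorb2)
      then show ?thesis
        unfolding M_def d measure_unif_trees[OF m sets[OF ball_determined_height, unfolded d]]
        using card_trees_n_pos[OF m, of n] by simp
    qed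
    then have "(\<lambda>n. measure (M n) (?S \<inter> ?H)) \<longlonglongrightarrow> 1"
      by (intro tendsto_eventually eventually_sequentiallyI)
    then have "measure P (?S \<inter> ?H) = 1"
      using lim[OF ball_determined_height[of k]] LIMSEQ_unique by blast
    then have "AE T in P. T \<in> ?S \<inter> ?H"
      using sets[OF ball_determined_height[of k]] unfolding setsP[symmetric] by (subst (asm) P.prob_eq_1)
    then show ?thesis by eventually_elim (simp add: H_def)
  qed
  have not_forked: "AE T in P. \<not> (\<forall>k. forked v i j (2 * k) T)" if ij: "i \<noteq> j" for v i j
  proof -
    let ?F = "\<lambda>k. {T. forked v i j (2 * k) T}"
    obtain L where L: "L \<longlonglongrightarrow> 0" "\<And>k. (\<lambda>n. measure (M n) (?S \<inter> ?F k)) \<longlonglongrightarrow> L k"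
      using measure_forked_limit[OF m ij, of v, OF sets[OF ball_determined_forked, unfolded d]]
      unfolding M_def d by blast
    have PF: "measure P (?S \<inter> ?F k) = L k" for k
      using L(2)[of k] lim[OF ball_determined_forked[of v "2 * k" i j]] LIMSEQ_unique by blast
    define A where "A = {T \<in> space P. \<forall>k. forked v i j (2 * k) T}"
    have A: "A \<in> sets P" unfolding A_def by measurable
    have "measure P A \<le> L k" for k
      unfolding PF[symmetric]
      using sets[OF ball_determined_forked] unfolding setsP[symmetric]
      by (intro P.finite_measure_mono) (auto simp: A_def sp)
    then have "measure P A \<le> 0" by (intro LIMSEQ_le_const[OF L(1)]) auto
    then have "measure P A = 0" using measure_nonneg[of P A] by linarith
    then have "A \<in> null_sets P" using A by (auto simp: P.emeasure_eq_measure)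
    then show ?thesis by (rule AE_I') (auto simp: A_def)
  qed
  have iff: "single_spine T \<longleftrightarrow> (\<forall>k. H k T) \<and>
      (\<forall>v i j. i \<noteq> j \<longrightarrow> \<not> (\<forall>k. forked v i j (2 * k) T))" for T
    unfolding single_spine_iff alive_pair_iff by (simp add: alive_def H_def)
  have "AE T in P. single_spine T"
    unfolding iff using high not_forked by (simp add: AE_all_countable)
  moreover have "{T \<in> space P. single_spine T} \<in> sets P"
    unfolding iff by measurable
  ultimately have "measure P {T \<in> space P. single_spine T} = 1"
    by (simp add: P.prob_Collect_eq_1)
  then have "measure P {T \<in> infinite_trees d. single_spine T \<and> infinite_well_charged T} = 1"
  proof -
    have "m \<ge> 1" using m by simp
    from support_eq[OF this] show ?thesis using \<open>measure P {T \<in> space P. single_spine T} = 1\<close>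
      unfolding sp d by (simp only:)
  qed
  with P(1) setsP weak show ?thesis by blast
qed

end
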